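(* Let $R$ be a noetherian normal integral domain with field of fractions $K$, let $L/K$ be a finite separable extension inside a fixed separable closure $\bar K$ of $K$, let $S$ be the normalization of $R$ in $L$, and let $\mathfrak p\in\operatorname{Spec}R$. Let $M\subset\bar K$ be the Galois closure of $L/K$ and let $T$ be the normalization of $R$ in $M$. Then $S/R$ is universally tamely ramified over $\mathfrak p$ if and only if $T/R$ is tamely ramified over $\mathfrak p$.
   Context: The Galois closure of $L/K$ is the intersection of all finite Galois extensions of $K$ in $\bar K$ containing $L$. For a normal integral domain $R$ and $S$ the normalization of $R$ in a finite separable extension $L$ of its field of fractions $K$, the trace $\mathrm{Tr}_{L/K}$ restricts to an $R$-linear map $\mathrm{Tr}\colon S\to R$; for $\mathfrak p\in\operatorname{Spec}R$ set $\mathfrak p^{\mathrm{Tr}}=\{s\in S\mid\mathrm{Tr}(sS)\subset\mathfrak p\}$, and say that $S/R$ is tamely ramified over $\mathfrak p$ if $\mathfrak p^{\mathrm{Tr}}=\sqrt{\mathfrak pS}$. $S/R$ is universally tamely ramified over $\mathfrak p$ if for every field $E$ containing $L$ and every subfield $K'\subset E$ containing $K$, letting $L'=LK'\subset E$ be the composite field, $R'$ the normalization (integral closure) of $R$ in $K'$ and $S'$ the normalization of $S$ in $L'$, the extension $S'/R'$ is tamely ramified (with respect to the restriction $S'\to R'$ of $\mathrm{Tr}_{L'/K'}$) over every prime of $R'$ lying over $\mathfrak p$. *)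

theory Defs
  imports "HOL-Algebra.Algebra"
begin

text \<open>
  All rings and fields live inside an ambient field \<open>F\<close>, as subsets of its carrier; the ring
  structure of a subset \<open>R\<close> is \<open>F\<lparr>carrier := R\<rparr>\<close>. Univariate polynomials are those of
  \<open>HOL-Algebra\<close>: coefficient lists with the leading coefficient first.
\<close>

definition fractions_of :: "('a, 'b) ring_scheme \<Rightarrow> 'a set \<Rightarrow> 'a set" where
  "fractions_of F R = {a \<otimes>\<^bsub>F\<^esub> inv\<^bsub>F\<^esub> b | a b. a \<in> R \<and> b \<in> R \<and> b \<noteq> \<zero>\<^bsub>F\<^esub>}"

definition integral_closure :: "('a, 'b) ring_scheme \<Rightarrow> 'a set \<Rightarrow> 'a set \<Rightarrow> 'a set" where
  "integral_closure F R A =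
     {x \<in> A. \<exists>f \<in> carrier (univ_poly F R).
               f \<noteq> [] \<and> lead_coeff f = \<one>\<^bsub>F\<^esub> \<and> ring.eval F f x = \<zero>\<^bsub>F\<^esub>}"


section \<open>Separable and Galois extensions\<close>

text \<open>The formal derivative: the coefficient of \<open>X ^ (i - 1)\<close> is \<open>i\<close> times that of \<open>X ^ i\<close> in \<open>f\<close>.\<close>

definition formal_deriv :: "('a, 'b) ring_scheme \<Rightarrow> 'a list \<Rightarrow> 'a list" where
  "formal_deriv F f =
     ring.normalize F (map (\<lambda>i. [i] \<cdot>\<^bsub>F\<^esub> ring.coeff F f i) (rev [1..<length f]))"

definition separable_poly :: "('a, 'b) ring_scheme \<Rightarrow> 'a set \<Rightarrow> 'a list \<Rightarrow> bool" where
  "separable_poly F K f \<longleftrightarrow>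
     f \<in> carrier (univ_poly F K) \<and>
     (\<exists>u \<in> carrier (univ_poly F K). \<exists>v \<in> carrier (univ_poly F K).
        (u \<otimes>\<^bsub>univ_poly F K\<^esub> f) \<oplus>\<^bsub>univ_poly F K\<^esub> (v \<otimes>\<^bsub>univ_poly F K\<^esub> formal_deriv F f)
          = \<one>\<^bsub>univ_poly F K\<^esub>)"

definition separable_extension :: "('a, 'b) ring_scheme \<Rightarrow> 'a set \<Rightarrow> 'a set \<Rightarrow> bool" where
  "separable_extension F K L \<longleftrightarrow>
     K \<subseteq> L \<and> (\<forall>x \<in> L. ring.algebraic F K x \<and> separable_poly F K (ring.Irr F K x))"

definition finite_separable_extension :: "('a, 'b) ring_scheme \<Rightarrow> 'a set \<Rightarrow> 'a set \<Rightarrow> bool" where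
  "finite_separable_extension F K L \<longleftrightarrow>
     subfield K F \<and> subfield L F \<and> ring.finite_dimension F K L \<and> separable_extension F K L"

definition separably_closed :: "('a, 'b) ring_scheme \<Rightarrow> bool" where
  "separably_closed F \<longleftrightarrow> (\<forall>f. separable_poly F (carrier F) f \<longrightarrow> ring.splitted F f)"

text \<open>\<open>F\<close> itself is a separable closure of its subfield \<open>K\<close>.\<close>

definition separable_closure_of :: "('a, 'b) ring_scheme \<Rightarrow> 'a set \<Rightarrow> bool" where
  "separable_closure_of F K \<longleftrightarrow>
     field F \<and> subfield K F \<and> separable_extension F K (carrier F) \<and> separably_closed F"

text \<open>A finite Galois extension is a finite, separable and normal one. Splitting over \<open>N\<close> is
  expressed in the ring \<open>F\<lparr>carrier := N\<rparr>\<close>, since \<^const>\<open>ring.splitted_on\<close> finds no roots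
  in an infinite set.\<close>

definition finite_galois_extension :: "('a, 'b) ring_scheme \<Rightarrow> 'a set \<Rightarrow> 'a set \<Rightarrow> bool" where
  "finite_galois_extension F K N \<longleftrightarrow>
     finite_separable_extension F K N \<and>
     (\<forall>x \<in> N. ring.splitted (F\<lparr>carrier := N\<rparr>) (ring.Irr F K x))"

definition galois_closure :: "('a, 'b) ring_scheme \<Rightarrow> 'a set \<Rightarrow> 'a set \<Rightarrow> 'a set" where
  "galois_closure F K L = \<Inter> {N. finite_galois_extension F K N \<and> L \<subseteq> N}"


section \<open>The trace and tame ramification\<close>

definition basis_of :: "('a, 'b) ring_scheme \<Rightarrow> 'a set \<Rightarrow> 'a set \<Rightarrow> 'a list \<Rightarrow> bool" where
  "basis_of F K L Us \<longleftrightarrow> ring.independent F K Us \<and> ring.Span F K Us = L"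

definition coordinates :: "('a, 'b) ring_scheme \<Rightarrow> 'a set \<Rightarrow> 'a list \<Rightarrow> 'a \<Rightarrow> 'a list" where
  "coordinates F K Us v =
     (THE Ks. length Ks = length Us \<and> set Ks \<subseteq> K \<and> ring.combine F Ks Us = v)"

text \<open>\<open>Tr\<^sub>L\<^sub>/\<^sub>K(x)\<close>: the trace of the matrix of multiplication by \<open>x\<close> in some \<open>K\<close>-basis of \<open>L\<close>
  (the value does not depend on the basis).\<close>

definition field_trace :: "('a, 'b) ring_scheme \<Rightarrow> 'a set \<Rightarrow> 'a set \<Rightarrow> 'a \<Rightarrow> 'a" where
  "field_trace F K L x =
     (let Us = (SOME Us. basis_of F K L Us)
      in (\<Oplus>\<^bsub>F\<^esub> i \<in> {..<length Us}. coordinates F K Us (x \<otimes>\<^bsub>F\<^esub> (Us ! i)) ! i))"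

text \<open>\<open>\<pp>\<^sup>T\<^sup>r = {s \<in> S. Tr\<^sub>L\<^sub>/\<^sub>K(sS) \<subseteq> \<pp>}\<close>\<close>

definition trace_ideal ::
    "('a, 'b) ring_scheme \<Rightarrow> 'a set \<Rightarrow> 'a set \<Rightarrow> 'a set \<Rightarrow> 'a set \<Rightarrow> 'a set" where
  "trace_ideal F K L S \<pp> = {s \<in> S. \<forall>u \<in> S. field_trace F K L (s \<otimes>\<^bsub>F\<^esub> u) \<in> \<pp>}"

definition radical_of_ext :: "('a, 'b) ring_scheme \<Rightarrow> 'a set \<Rightarrow> 'a set \<Rightarrow> 'a set" where
  "radical_of_ext F S \<pp> =
     {s \<in> S. \<exists>n::nat. s [^]\<^bsub>F\<^esub> n \<in> Idl\<^bsub>F\<lparr>carrier := S\<rparr>\<^esub> \<pp>}"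

text \<open>Tame ramification over \<open>\<pp>\<close> of an extension of rings with top ring \<open>S\<close>, with respect to
  \<open>Tr\<^sub>L\<^sub>/\<^sub>K\<close>. The base ring \<open>R\<close> enters only through its prime ideal \<open>\<pp>\<close>.\<close>

definition tamely_ramified ::
    "('a, 'b) ring_scheme \<Rightarrow> 'a set \<Rightarrow> 'a set \<Rightarrow> 'a set \<Rightarrow> 'a set \<Rightarrow> bool" where
  "tamely_ramified F K L S \<pp> \<longleftrightarrow> trace_ideal F K L S \<pp> = radical_of_ext F S \<pp>"

text \<open>HOL cannot quantify over types inside a formula, so the carrier type \<open>'e\<close> of the fields \<open>E\<close>
  containing \<open>L\<close> is a parameter. The containment of \<open>L\<close> in \<open>E\<close> is an embedding \<open>\<phi>\<close> (a ring
  homomorphism from a field to a field is injective), because \<open>E\<close> need not be related to \<open>F\<close>.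
  The base ring \<open>R'\<close> need not have fraction field \<open>K'\<close>, as \<open>K'\<close> may be transcendental over \<open>K\<close>.\<close>

definition universally_tamely_ramified ::
    "'e itself \<Rightarrow> ('a, 'b) ring_scheme \<Rightarrow> 'a set \<Rightarrow> 'a set \<Rightarrow> 'a set \<Rightarrow> 'a set \<Rightarrow> 'a set \<Rightarrow> bool" where
  "universally_tamely_ramified (_ :: 'e itself) F K L R S \<pp> \<longleftrightarrow>
     (\<forall>(E :: 'e ring) \<phi> K'.
        field E \<and> \<phi> \<in> ring_hom (F\<lparr>carrier := L\<rparr>) E \<and> subfield K' E \<and> \<phi> ` K \<subseteq> K' \<longrightarrow>
        (let L' = generate_field E (\<phi> ` L \<union> K');
             R' = integral_closure E (\<phi> ` R) K';
             S' = integral_closure E (\<phi> ` S) L'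
         in \<forall>\<qq>. primeideal \<qq> (E\<lparr>carrier := R'\<rparr>) \<and> \<qq> \<inter> \<phi> ` R = \<phi> ` \<pp> \<longrightarrow>
                 tamely_ramified E K' L' S' \<qq>))"

end

theory Submission
  imports Defs
begin

text \<open>
  For a finite group \<open>G\<close> of automorphisms of a field \<open>M\<close> and a prime \<open>P\<close> of a \<open>G\<close>-stable subring
  \<open>T\<close>, let \<open>I\<close> be the inertia group of the \<open>g\<close> with \<open>g t \<equiv> t\<close> modulo \<open>P\<close> for all \<open>t \<in> T\<close>.
  Modulo \<open>P\<close>, the elements of \<open>G\<close> induce distinct characters \<open>c\<close> of \<open>T\<close>, each of them for a coset of
  \<open>I\<close>, so that \<open>Tr(t) \<equiv> |I| \<Sum> c(t)\<close>. Since distinct characters are linearly independent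
  over \<open>T/P\<close>, everything about tameness is decided by whether the number \<open>|I|\<close> lies in \<open>P\<close>:

  \<^item> If the trace takes a value outside \<open>P\<close>, then \<open>|I| \<notin> P\<close>; a tamely ramified extension has such a
    value, because \<open>1\<close> is not in the radical of \<open>\<pp>S\<close>.

  \<^item> If \<open>|I| \<notin> P\<close>, then \<open>Tr(st) \<in> P\<close> for all \<open>t\<close> forces all conjugates of \<open>s\<close> into \<open>P\<close>, which
    says that \<open>s\<close> is in the radical of \<open>\<pp>S\<close>. Since the trace from \<open>M\<close> is the trace from \<open>L\<close>
    after that from \<open>M\<close> to \<open>L\<close>, this gives tameness for each \<open>L\<close> between the fixed field and \<open>M\<close>.

  Now let \<open>M\<close> be the Galois closure of \<open>L/K\<close> and \<open>P\<close> a prime of \<open>T\<close> over \<open>\<pp>\<close>. Suppose that \<open>T/R\<close>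
  is tame, so \<open>|I| \<notin> P\<close>. After a base change to \<open>K'\<close>, in an algebraically closed field, the composite
  of \<open>M\<close> and \<open>K'\<close> is a Galois extension of \<open>K'\<close> that contains \<open>LK'\<close>, and restriction embeds its
  inertia groups into those of \<open>M/K\<close>. Their orders are divisors of such numbers \<open>|I|\<close> and
  remain invertible, so \<open>S'/R'\<close> is tame (theorem \<open>tame_base_change\<close>).

  Conversely, let \<open>L/K\<close> be universally tame, and suppose that \<open>|I| \<in> P\<close>. Choose a subgroup \<open>J\<close>
  of \<open>I\<close> of least order with \<open>|J| \<in> P\<close>, and let \<open>K'\<close> be its fixed field. For each \<open>g \<in> G\<close>,
  base change along \<open>g : L \<rightarrow> M\<close> gives the extension \<open>g(L)K'\<close> of \<open>K'\<close>, and it is tame. As all of \<open>J\<close> is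
  inertial, its trace is congruent to multiplication by its degree, the index in \<open>J\<close> of the
  stabilizer \<open>H\<close> of \<open>g(L)\<close>. So this index is not in \<open>P\<close>, hence \<open>|H| \<in> P\<close>, and \<open>H = J\<close> by the choice
  of \<open>J\<close>. Thus \<open>J\<close> fixes all conjugates of \<open>L\<close>, which generate \<open>M\<close>; then \<open>J\<close> is trivial and \<open>|J| = 1\<close> is
  not in \<open>P\<close>, a contradiction (theorem \<open>universally_tame_imp_tame\<close>).

  The commutative algebra behind this is the description of an integral closure as an
  intersection of valuation rings, which makes it a ring; lying over for the invariants of a finite
  group, which supplies the primes \<open>P\<close>; and the formula for the trace as a sum of conjugates, which
  is obtained from a dual basis.
\<close>

section \<open>Integrality and valuation rings\<close>

definition (in ring) valuation_subring :: "'a set \<Rightarrow> bool" where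
  "valuation_subring V \<longleftrightarrow> subring V R \<and> (\<forall>z \<in> carrier R - {\<zero>}. z \<in> V \<or> inv z \<in> V)"

context field
begin

lemma eval_reciprocal:
  assumes "set g \<subseteq> carrier R" "x \<in> carrier R" "y \<in> carrier R" "x \<otimes> y = \<one>"
  shows "eval g y \<otimes> x [^] length g = eval (rev g) x \<otimes> x"
  using assms(1)
proof (induct g)
  case Nil
  then show ?case using assms by simp
next
  case (Cons a g)
  have a: "a \<in> carrier R" and g: "set g \<subseteq> carrier R" using Cons.prems by auto
  have e: "eval g y \<in> carrier R" "eval (rev g) x \<in> carrier R"
    using eval_in_carrier g assms by auto
  have yx: "y [^] length g \<otimes> x [^] length g = \<one>"
    using assms by (metis m_comm nat_pow_distrib nat_pow_one)
  have "eval (a # g) y \<otimes> x [^] length (a # g)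
      = (a \<otimes> y [^] length g \<oplus> eval g y) \<otimes> (x [^] length g \<otimes> x)" by simp
  also have "\<dots> = a \<otimes> (y [^] length g \<otimes> x [^] length g) \<otimes> x \<oplus> (eval g y \<otimes> x [^] length g) \<otimes> x"
    using a e assms by (simp add: l_distr m_assoc)
  also have "\<dots> = (eval (rev g) x \<otimes> x \<oplus> a) \<otimes> x"
    unfolding yx Cons.hyps[OF g] using a e assms by (simp add: l_distr a_comm)
  also have "\<dots> = eval (rev (a # g)) x \<otimes> x"
    using eval_append_aux[of "rev g" a x] a g assms by simp
  finally show ?case .
qed

lemma eval_mem_subring:
  assumes "subring V R" "set g \<subseteq> V" "x \<in> V"
  shows "eval g x \<in> V"
  using assms(2)
proof (induct g)
  case Nil
  then show ?case using subringE(2)[OF assms(1)] by simp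
next
  case (Cons a g)
  have "x [^] n \<in> V" for n :: nat
    by (induct n) (use subringE[OF assms(1)] assms(3) in auto)
  then show ?case
    using Cons subringE(6,7)[OF assms(1)] by simp
qed

lemma eval_map_mult:
  assumes "set g \<subseteq> carrier R" "a \<in> carrier R" "x \<in> carrier R"
  shows "eval (map ((\<otimes>) a) g) x = a \<otimes> eval g x"
  using assms(1)
proof (induct g)
  case (Cons b g)
  then show ?case using assms eval_in_carrier[of g x] by (simp add: r_distr m_assoc)
qed (use assms in simp)

lemma simple_extension_obtain_list:
  assumes "subring V R" "x \<in> carrier R" "z \<in> simple_extension V x"
  obtains g where "set g \<subseteq> V" "z = eval g x"
proof -
  have "z \<in> (\<lambda>p. eval p x) ` carrier (V[X])"
    using assms simple_extension_as_eval_img[OF subringE(1)[OF assms(1)] assms(2)] by simp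
  then obtain g where "g \<in> carrier (V[X])" "z = eval g x" by auto
  then show ?thesis using that univ_poly_carrier polynomial_incl by (metis)
qed

text \<open>If \<open>x\<close> is not integral over \<open>A\<close>, then \<open>x \<notin> A[1/x]\<close>: clearing denominators in
  \<open>x = a\<^sub>0 + a\<^sub>1/x + \<dots> + a\<^sub>n/x\<^sup>n\<close> is an equation of integral dependence.\<close>

lemma integral_if_mem_reciprocal_extension:
  assumes A: "subring A R" and x: "x \<in> carrier R" "x \<noteq> \<zero>"
    and mem: "x \<in> simple_extension A (inv x)"
  shows "\<exists>f \<in> carrier (A[X]). f \<noteq> [] \<and> lead_coeff f = \<one> \<and> eval f x = \<zero>"
proof -
  have ix: "inv x \<in> carrier R" "x \<otimes> inv x = \<one>" using x by (auto simp: field_Units)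
  obtain g where g: "set g \<subseteq> A" "x = eval g (inv x)"
    using simple_extension_obtain_list[OF A ix(1) mem] .
  have AR: "A \<subseteq> carrier R" using subringE(1)[OF A] .
  then have gR: "set g \<subseteq> carrier R" using g by auto
  define h where "h = map ((\<otimes>) (\<ominus> \<one>)) (rev g)"
  have e: "eval (rev g) x \<in> carrier R" using eval_in_carrier gR x by auto
  have "x \<otimes> x [^] length g = x \<otimes> eval (rev g) x"
    using eval_reciprocal[OF gR x(1) ix] g(2) x e by (simp add: m_comm)
  then have xg: "x [^] length g = eval (rev g) x"
    using x e m_lcancel by simp
  have "eval h x = \<ominus> eval (rev g) x"
    unfolding h_def using eval_map_mult[of "rev g" "\<ominus> \<one>" x] gR x e by (simp add: l_minus)
  then have "eval (\<one> # h) x = \<zero>"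
    using xg e by (simp add: h_def r_neg)
  moreover have "set h \<subseteq> A"
    using g subringE[OF A] by (auto simp: h_def)
  then have "\<one> # h \<in> carrier (A[X])"
    using subringE(3)[OF A] by (simp add: univ_poly_carrier[symmetric] polynomial_def)
  ultimately show ?thesis by (intro bexI[of _ "\<one> # h"]) auto
qed

text \<open>If \<open>x \<notin> V\<close>, then \<open>1/x \<in> V\<close>, and dividing the equation of integral dependence by \<open>x\<^sup>n\<^sup>-\<^sup>1\<close>
  expresses \<open>x\<close> as a polynomial in \<open>1/x\<close>.\<close>

lemma integral_imp_mem_valuation_subring:
  assumes V: "valuation_subring V" and f: "set f \<subseteq> V" "f \<noteq> []" "lead_coeff f = \<one>"
    and x: "x \<in> carrier R" "eval f x = \<zero>"
  shows "x \<in> V"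
proof (rule ccontr)
  assume nx: "x \<notin> V"
  have sV: "subring V R" using V by (simp add: valuation_subring_def)
  note VE = subringE[OF sV]
  have x0: "x \<noteq> \<zero>" using nx VE(2) by auto
  have y: "inv x \<in> V" using V nx x x0 by (auto simp: valuation_subring_def)
  have ix: "inv x \<in> carrier R" "inv x \<otimes> x = \<one>" using x x0 by (auto simp: field_Units)
  have fR: "set f \<subseteq> carrier R" using f VE(1) by auto
  obtain g where fg: "f = \<one> # g" using f by (cases f) auto
  have g: "set g \<subseteq> V" "set g \<subseteq> carrier R" using f fR fg by auto
  have e: "eval (rev g) (inv x) \<in> V" by (rule eval_mem_subring[OF sV]) (use g y in auto)
  have eg: "eval g x \<in> carrier R" using eval_in_carrier g x by auto
  have "\<zero> = eval f x \<otimes> inv x [^] length g" using x ix by simp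
  also have "\<dots> = (x [^] length g \<oplus> eval g x) \<otimes> inv x [^] length g"
    using fg x by simp
  also have "\<dots> = (x \<otimes> inv x) [^] length g \<oplus> eval g x \<otimes> inv x [^] length g"
    using x(1) eg ix(1) nat_pow_distrib[OF x(1) ix(1)] by (simp add: l_distr)
  also have "\<dots> = \<one> \<oplus> eval (rev g) (inv x) \<otimes> inv x"
    using eval_reciprocal[OF g(2) ix(1) x(1)] ix x(1) m_comm[of x "inv x"] by simp
  finally have "\<one> = \<ominus> (eval (rev g) (inv x)) \<otimes> inv x"
    using e VE(1) ix(1) minus_equality[of "\<one>" "eval (rev g) (inv x) \<otimes> inv x"]
    by (auto simp: l_minus)
  then have "\<one> \<otimes> x = \<ominus> (eval (rev g) (inv x)) \<otimes> (inv x \<otimes> x)"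
    using e VE(1) ix(1) x(1) m_assoc[of "\<ominus> (eval (rev g) (inv x))" "inv x" x] by auto
  then have "x = \<ominus> (eval (rev g) (inv x))"
    using e VE(1) ix x by auto
  then show False using e VE(5) nx by metis
qed

text \<open>The valuation ring is a subring \<open>V\<close> maximal among those containing \<open>A\<close> and \<open>1/x\<close> but not
  \<open>x\<close>. Such a \<open>V\<close> is local with \<open>1/x\<close> in its maximal ideal; and if neither \<open>z\<close> nor \<open>1/z\<close>
  were in \<open>V\<close>, then \<open>x\<close> would be a polynomial in \<open>z\<close> and one in \<open>1/z\<close>, and the shortest of these
  could be shortened further.\<close>

lemma maximal_subring_one_minus_unit:
  assumes V: "subring V R" and x: "x \<in> carrier R" "x \<noteq> \<zero>" "x \<notin> V" and y: "inv x \<in> V"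
    and max: "\<And>W. subring W R \<Longrightarrow> V \<subseteq> W \<Longrightarrow> x \<notin> W \<Longrightarrow> W = V"
    and b: "b \<in> V"
  shows "\<exists>u \<in> V. (\<one> \<ominus> inv x \<otimes> b) \<otimes> u = \<one>"
proof -
  note VE = subringE[OF V]
  have VR: "\<And>v. v \<in> V \<Longrightarrow> v \<in> carrier R" using VE(1) by auto
  define s where "s = \<one> \<ominus> inv x \<otimes> b"
  have sV: "s \<in> V" unfolding s_def a_minus_def using VE b y by auto
  have xs: "x \<otimes> s = x \<ominus> b"
  proof -
    have "x \<otimes> (inv x \<otimes> b) = b"
      using x VR b y by (simp add: m_assoc[symmetric] field_Units)
    then show ?thesis unfolding s_def a_minus_def
      using x VR b y by (simp add: r_distr r_minus)
  qed
  have s0: "s \<noteq> \<zero>"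
  proof
    assume "s = \<zero>"
    then have "x \<ominus> b = \<zero>" using xs x by simp
    then have "x = b" using x VR[OF b] by simp
    then show False using x b by simp
  qed
  have is1: "inv s \<in> carrier R" "s \<otimes> inv s = \<one>" using VR[OF sV] s0 by (auto simp: field_Units)
  \<comment> \<open>\<open>x s\<^sup>k \<equiv> x\<close> modulo \<open>V\<close>; a polynomial expression of \<open>x\<close> in \<open>1/s\<close> then gives \<open>x \<in> V\<close>\<close>
  have pow: "\<exists>v \<in> V. x \<otimes> s [^] (k::nat) = x \<ominus> v" for k
  proof (induct k)
    case 0
    then show ?case using x VE(2) by (intro bexI[of _ \<zero>]) (auto simp: a_minus_def)
  next
    case (Suc k)
    then obtain v where v: "v \<in> V" "x \<otimes> s [^] k = x \<ominus> v" by auto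
    have "x \<otimes> s [^] Suc k = (x \<ominus> v) \<otimes> s"
      using v x VR sV by (simp add: m_assoc[symmetric])
    also have "\<dots> = x \<ominus> (b \<oplus> v \<otimes> s)"
      using xs VR v sV b x unfolding a_minus_def
      by (simp add: l_distr l_minus minus_add a_assoc)
    finally show ?case using VE(6,7) v sV b by blast
  qed
  have "inv s \<in> V"
  proof (rule ccontr)
    assume n: "inv s \<notin> V"
    let ?W = "simple_extension V (inv s)"
    have W: "subring ?W R" using simple_extension_is_subring[OF V is1(1)] .
    have "V \<subseteq> ?W" using simple_extension_incl[OF VE(1) is1(1)] .
    moreover have "?W \<noteq> V" using simple_extension_mem[OF V is1(1)] n by auto
    ultimately have "x \<in> ?W" using max W by blast
    then obtain g where g: "set g \<subseteq> V" "x = eval g (inv s)"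
      using simple_extension_obtain_list[OF V is1(1)] by blast
    have "x \<otimes> s [^] length g = eval (rev g) s \<otimes> s"
      using eval_reciprocal[of g s "inv s"] g VE(1) VR sV is1 by auto
    moreover have "eval (rev g) s \<otimes> s \<in> V"
      using VE(6) eval_mem_subring[OF V, of "rev g" s] g sV by simp
    moreover obtain v where v: "v \<in> V" "x \<otimes> s [^] length g = x \<ominus> v" using pow by blast
    ultimately have "x \<ominus> v \<in> V" by simp
    then have "x \<ominus> v \<oplus> v \<in> V" using VE(7) v by blast
    then have "x \<in> V" using x VR v by (simp add: a_minus_def a_assoc l_neg)
    then show False using x by simp
  qed
  then show ?thesis using is1 s_def by auto
qed

lemma maximal_subring_is_valuation:
  assumes V: "subring V R" and x: "x \<in> carrier R" "x \<noteq> \<zero>" "x \<notin> V" and y: "inv x \<in> V"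
    and max: "\<And>W. subring W R \<Longrightarrow> V \<subseteq> W \<Longrightarrow> x \<notin> W \<Longrightarrow> W = V"
  shows "valuation_subring V"
proof -
  note VE = subringE[OF V]
  have VR: "\<And>v. v \<in> V \<Longrightarrow> v \<in> carrier R" using VE(1) by auto
  define len where "len z = (LEAST n. \<exists>g. set g \<subseteq> V \<and> length g = n \<and> x = eval g z)" for z
  have ex: "\<exists>g. set g \<subseteq> V \<and> length g = len z \<and> x = eval g z"
    if z: "z \<in> carrier R" "z \<notin> V" for z
  proof -
    let ?W = "simple_extension V z"
    have "subring ?W R" "V \<subseteq> ?W" "z \<in> ?W"
      using simple_extension_is_subring[OF V z(1)] simple_extension_incl[OF VE(1) z(1)]
        simple_extension_mem[OF V z(1)] by auto
    then have "x \<in> ?W" using max z by blast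
    then obtain g where "set g \<subseteq> V" "x = eval g z"
      using simple_extension_obtain_list[OF V z(1)] by blast
    then have "\<exists>n g. set g \<subseteq> V \<and> length g = n \<and> x = eval g z" by blast
    then show ?thesis unfolding len_def by (rule LeastI_ex)
  qed
  \<comment> \<open>the reduction step; by symmetry the expression in \<open>1/z\<close> may be taken to be the shorter one\<close>
  have key: False if z: "z \<in> carrier R" "z \<noteq> \<zero>" "z \<notin> V" "inv z \<notin> V" "len (inv z) \<le> len z" for z
  proof -
    have w: "inv z \<in> carrier R" "z \<otimes> inv z = \<one>" using z by (auto simp: field_Units)
    obtain g where g: "set g \<subseteq> V" "length g = len z" "x = eval g z" using ex z by blast
    obtain h where h: "set h \<subseteq> V" "length h = len (inv z)" "x = eval h (inv z)" using ex z w by blast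
    have ne: "g \<noteq> []" "h \<noteq> []" using g(3) h(3) x by auto
    then obtain a g' where ga: "g = a # g'" by (cases g) auto
    obtain h' b where hb: "h = h' @ [b]" using ne by (metis rev_exhaust)
    have aV: "a \<in> V" "set g' \<subseteq> V" "b \<in> V" "set h' \<subseteq> V" using g h ga hb by auto
    note aR = VR[OF aV(1)] VR[OF aV(3)] 
    have setR: "set g' \<subseteq> carrier R" "set h' \<subseteq> carrier R" using aV VE(1) by auto
    have eh: "eval h' (inv z) \<in> carrier R" using eval_in_carrier setR w by auto
    have ix: "inv x \<in> carrier R" "inv x \<otimes> x = \<one>" "x \<otimes> inv x = \<one>" using x by (auto simp: field_Units)
    obtain u where u: "u \<in> V" "(\<one> \<ominus> inv x \<otimes> b) \<otimes> u = \<one>"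
      using maximal_subring_one_minus_unit[OF V x y max aV(3)] by auto
    note uR = VR[OF u(1)]
    have xb: "x \<ominus> b = eval h' (inv z) \<otimes> inv z"
      using h(3) hb eval_append_aux[OF setR(2) aR(2) w(1)] eh aR w
      by (simp add: a_minus_def a_assoc r_neg)
    have "(x \<ominus> b) \<otimes> u = x"
    proof -
      have "x \<ominus> b = x \<otimes> (\<one> \<ominus> inv x \<otimes> b)"
        using x ix aR unfolding a_minus_def
        by (simp add: r_distr r_minus m_assoc[symmetric])
      then have "(x \<ominus> b) \<otimes> u = x \<otimes> ((\<one> \<ominus> inv x \<otimes> b) \<otimes> u)"
        using x ix aR uR by (simp add: m_assoc)
      then show ?thesis using u x by simp
    qed
    then have x1: "x = u \<otimes> eval h' (inv z) \<otimes> inv z"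
      using xb eh uR w by (simp add: m_ac)
    \<comment> \<open>the constant coefficient \<open>b\<close> of \<open>h\<close> is removed by dividing by the unit \<open>1 - b/x\<close>\<close>
    define k where "k = map ((\<otimes>) u) (rev h')"
    have kV: "set k \<subseteq> V" using aV u VE(6) by (auto simp: k_def)
    then have kR: "set k \<subseteq> carrier R" using VE(1) by auto
    have er: "eval (rev h') z \<in> carrier R" using eval_in_carrier setR z by auto
    have ek: "eval k z = u \<otimes> eval (rev h') z"
      unfolding k_def using eval_map_mult[of "rev h'" u z] setR uR z by simp
    have zn: "z [^] (n::nat) \<in> carrier R" for n using z by simp
    have xz: "x \<otimes> z [^] length h' = eval k z"
    proof -
      have zw: "z \<otimes> inv z = \<one>" using w by simp
      have "x \<otimes> z [^] length h' = u \<otimes> inv z \<otimes> (eval h' (inv z) \<otimes> z [^] length h')"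
        unfolding x1 using uR w eh zn by (simp add: m_ac)
      also have "\<dots> = u \<otimes> inv z \<otimes> (eval (rev h') z \<otimes> z)"
        using eval_reciprocal[OF setR(2) z(1) w(1) w(2)] by simp
      also have "\<dots> = u \<otimes> eval (rev h') z \<otimes> (z \<otimes> inv z)"
        using uR w(1) er z(1) by (simp add: m_ac del: Units_r_inv)
      finally show ?thesis using w ek uR er by simp
    qed
    \<comment> \<open>so the leading term \<open>a z\<^sup>m = (a/x) x z\<^sup>m\<close> of \<open>g\<close> becomes a combination of lower powers of \<open>z\<close>\<close>
    define c where "c = a \<otimes> inv x"
    have cV: "c \<in> V" using aV y VE(6) by (simp add: c_def)
    note cR = VR[OF cV]
    have le: "length h' \<le> length g'" using z(5) g h ga hb by simp
    define k' where "k' = map ((\<otimes>) c) k @ replicate (length g' - length h') \<zero>"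
    have k'V: "set k' \<subseteq> V" using cV kV VE(2,6) by (auto simp: k'_def)
    then have k'R: "set k' \<subseteq> carrier R" using VE(1) by auto
    have lk': "length k' = length g'" using le by (simp add: k'_def k_def)
    have ekR: "eval k z \<in> carrier R" using eval_in_carrier kR z by auto
    have rep: "eval (replicate m \<zero>) z = \<zero>" for m
      using eval_replicate[of "[]" z m] z by simp
    have "eval k' z = c \<otimes> eval k z \<otimes> z [^] (length g' - length h')"
    proof -
      have "set (map ((\<otimes>) c) k) \<subseteq> carrier R" using kR cR by auto
      moreover have "set (replicate (length g' - length h') \<zero>) \<subseteq> carrier R" by auto
      ultimately show ?thesis
        unfolding k'_def using eval_append[of "map ((\<otimes>) c) k" "replicate (length g' - length h') \<zero>" z]
          eval_map_mult[OF kR cR z(1)] rep z cR ekR by simp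
    qed
    also have "\<dots> = c \<otimes> x \<otimes> (z [^] length h' \<otimes> z [^] (length g' - length h'))"
      unfolding xz[symmetric] using cR x zn by (simp add: m_ac)
    also have "\<dots> = c \<otimes> x \<otimes> z [^] length g'"
      using z le by (simp add: nat_pow_mult)
    also have "\<dots> = a \<otimes> z [^] length g'"
    proof -
      have "c \<otimes> x = a" using ix aR x by (simp add: c_def m_assoc)
      then show ?thesis by simp
    qed
    finally have ek': "eval k' z = a \<otimes> z [^] length g'" .
    have "eval (poly_add k' g') z = x"
      using eval_poly_add[OF k'R setR(1) z(1)] ek' g(3) ga by simp
    moreover have "set (poly_add k' g') \<subseteq> V"
      using polynomial_incl[OF poly_add_is_polynomial[OF V k'V aV(2)]] .
    ultimately have "len z \<le> length (poly_add k' g')"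
      unfolding len_def by (intro Least_le) metis
    also have "\<dots> \<le> length g'"
      using poly_add_length_le[of k' g'] lk' by simp
    finally show False using g ga by simp
  qed
  have "z \<in> V \<or> inv z \<in> V" if z: "z \<in> carrier R - {\<zero>}" for z
  proof (rule ccontr)
    assume n: "\<not> ?thesis"
    have w: "inv z \<in> carrier R" "inv (inv z) = z" "inv z \<noteq> \<zero>"
      using z Units_inv_Units[of z] Units_inv_inv[of z] Units_inv_closed[of z] by (auto simp: field_Units)
    show False
      using key[of z] key[of "inv z"] z n w by (cases "len (inv z) \<le> len z") auto
  qed
  then show ?thesis using V by (simp add: valuation_subring_def)
qed

lemma exists_valuation_subring_avoiding:
  assumes A: "subring A R" and x: "x \<in> carrier R" "x \<noteq> \<zero>" "x \<notin> A" and y: "inv x \<in> A"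
  shows "\<exists>V. valuation_subring V \<and> A \<subseteq> V \<and> x \<notin> V"
proof -
  define \<A> where "\<A> = {W. subring W R \<and> A \<subseteq> W \<and> x \<notin> W}"
  have "\<exists>V\<in>\<A>. \<forall>W\<in>\<A>. V \<subseteq> W \<longrightarrow> W = V"
  proof (rule subset_Zorn_nonempty)
    show "\<A> \<noteq> {}" using A x by (auto simp: \<A>_def)
    fix C assume C: "C \<noteq> {}" "subset.chain \<A> C"
    then have CA: "C \<subseteq> \<A>" and lin: "\<And>a b. a \<in> C \<Longrightarrow> b \<in> C \<Longrightarrow> a \<subseteq> b \<or> b \<subseteq> a"
      by (auto simp: subset.chain_def)
    obtain W0 where W0: "W0 \<in> C" using C by auto
    have sub: "\<And>W. W \<in> C \<Longrightarrow> subring W R" using CA by (auto simp: \<A>_def)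
    have "subring (\<Union>C) R"
    proof (rule subringI)
      show "\<Union>C \<subseteq> carrier R" using subringE(1)[OF sub] by auto
      show "\<one> \<in> \<Union>C" using W0 subringE(3)[OF sub] by auto
      show "\<ominus> h \<in> \<Union>C" if "h \<in> \<Union>C" for h
        using that by (elim UnionE) (auto intro: subringE(5)[OF sub])
      fix h1 h2 assume "h1 \<in> \<Union>C" "h2 \<in> \<Union>C"
      then obtain W where "W \<in> C" "h1 \<in> W" "h2 \<in> W" using lin by blast
      then show "h1 \<otimes> h2 \<in> \<Union>C" "h1 \<oplus> h2 \<in> \<Union>C" by (auto intro: subringE(6,7)[OF sub])
    qed
    then show "\<Union>C \<in> \<A>" using CA W0 by (auto simp: \<A>_def)
  qed
  then obtain V where V: "V \<in> \<A>" "\<And>W. W \<in> \<A> \<Longrightarrow> V \<subseteq> W \<Longrightarrow> W = V" by blast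
  have "valuation_subring V"
  proof (rule maximal_subring_is_valuation[OF _ x(1,2)])
    show "subring V R" "x \<notin> V" "inv x \<in> V" using V(1) y by (auto simp: \<A>_def)
    show "\<And>W. subring W R \<Longrightarrow> V \<subseteq> W \<Longrightarrow> x \<notin> W \<Longrightarrow> W = V"
      using V by (auto simp: \<A>_def)
  qed
  then show ?thesis using V(1) by (auto simp: \<A>_def)
qed

text \<open>This description makes both the ring structure of the integral closure and the transitivity
  of integrality evident.\<close>

theorem integral_closure_valuation:
  assumes A: "subring A R" and L: "L \<subseteq> carrier R"
  shows "integral_closure R A L = {x \<in> L. \<forall>V. valuation_subring V \<and> A \<subseteq> V \<longrightarrow> x \<in> V}"
proof (intro equalityI subsetI)
  fix x assume "x \<in> integral_closure R A L"
  then obtain f where f: "x \<in> L" "f \<in> carrier (A[X])" "f \<noteq> []" "lead_coeff f = \<one>" "eval f x = \<zero>"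
    by (auto simp: integral_closure_def)
  have "set f \<subseteq> A" using f(2) univ_poly_carrier polynomial_incl by blast
  then show "x \<in> {x \<in> L. \<forall>V. valuation_subring V \<and> A \<subseteq> V \<longrightarrow> x \<in> V}"
    using integral_imp_mem_valuation_subring[OF _ _ f(3,4) _ f(5)] f(1) L by blast
next
  fix x assume x: "x \<in> {x \<in> L. \<forall>V. valuation_subring V \<and> A \<subseteq> V \<longrightarrow> x \<in> V}"
  then have xL: "x \<in> L" "x \<in> carrier R" using L by auto
  show "x \<in> integral_closure R A L"
  proof (cases "x = \<zero>")
    case True
    have "[\<one>, \<zero>] \<in> carrier (A[X])"
      using subringE(2,3)[OF A] by (simp add: univ_poly_carrier[symmetric] polynomial_def)
    moreover have "eval [\<one>, \<zero>] x = \<zero>" using True by simp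
    ultimately show ?thesis using xL
      unfolding integral_closure_def by (intro CollectI conjI bexI[of _ "[\<one>, \<zero>]"]) auto
  next
    case False
    have ix: "inv x \<in> carrier R" using xL False by (auto simp: field_Units)
    let ?B = "simple_extension A (inv x)"
    have B: "subring ?B R" "A \<subseteq> ?B" "inv x \<in> ?B"
      using simple_extension_is_subring[OF A ix] simple_extension_incl[OF subringE(1)[OF A] ix]
        simple_extension_mem[OF A ix] by auto
    have "x \<in> ?B"
      using exists_valuation_subring_avoiding[OF B(1) xL(2) False _ B(3)] x B(2) by blast
    then show ?thesis
      using integral_if_mem_reciprocal_extension[OF A xL(2) False] xL
      by (auto simp: integral_closure_def)
  qed
qed

corollary integral_closure_subring:
  assumes "subring A R" "subring L R"
  shows "subring (integral_closure R A L) R"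
proof -
  note L = subringE[OF assms(2)]
  note * = integral_closure_valuation[OF assms(1) L(1)]
  have V: "subring V R" if "valuation_subring V" for V
    using that by (simp add: valuation_subring_def)
  show ?thesis unfolding *
  proof (rule subringI)
    show "{x \<in> L. \<forall>V. valuation_subring V \<and> A \<subseteq> V \<longrightarrow> x \<in> V} \<subseteq> carrier R" using L(1) by auto
    show "\<one> \<in> {x \<in> L. \<forall>V. valuation_subring V \<and> A \<subseteq> V \<longrightarrow> x \<in> V}"
      using L(3) subringE(3)[OF V] by auto
  qed (auto intro: L(5-7) subringE(5-7)[OF V])
qed

corollary base_subset_integral_closure:
  assumes "subring A R" "A \<subseteq> L" "L \<subseteq> carrier R"
  shows "A \<subseteq> integral_closure R A L"
  unfolding integral_closure_valuation[OF assms(1,3)] using assms(2) by auto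

corollary integral_closure_trans:
  assumes "subring A R" "subring B R" "A \<subseteq> B" "B \<subseteq> integral_closure R A (carrier R)" "L \<subseteq> carrier R"
  shows "integral_closure R B L = integral_closure R A L"
proof -
  have *: "B \<subseteq> V" if "valuation_subring V" "A \<subseteq> V" for V
    using assms(4) that unfolding integral_closure_valuation[OF assms(1) subset_refl] by auto
  show ?thesis
    unfolding integral_closure_valuation[OF assms(1,5)] integral_closure_valuation[OF assms(2,5)]
    by (intro Collect_cong conj_cong refl) (meson * assms(3) subset_trans)
qed

end

section \<open>Polynomials with simple roots\<close>

definition (in ring) zeros :: "'a list \<Rightarrow> 'a set" where
  "zeros p = {x \<in> carrier R. eval p x = \<zero>}"

text \<open>A product of distinct linear factors. The zeros are counted because a homomorphism of fields
  preserves their number.\<close>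

definition (in ring) splits_simply :: "'a list \<Rightarrow> bool" where
  "splits_simply p \<longleftrightarrow> p \<in> carrier (poly_ring R) \<and> p \<noteq> [] \<and> card (zeros p) = degree p"

context field
begin

lemma zeros_eq_roots:
  assumes "p \<in> carrier (poly_ring R)" "p \<noteq> []"
  shows "zeros p = set_mset (roots p)"
  using roots_mem_iff_is_root[OF assms(1)] assms(2) by (auto simp: zeros_def is_root_def)

lemma card_set_mset_le: "card (set_mset m) \<le> size m"
proof (induct m)
  case (add x m)
  then show ?case by (cases "x \<in># m") (auto simp: insert_absorb)
qed simp

lemma finite_zeros:
  assumes "p \<in> carrier (poly_ring R)" "p \<noteq> []"
  shows "finite (zeros p)" "card (zeros p) \<le> degree p"
  using zeros_eq_roots[OF assms] size_roots_le_degree[OF assms(1)] card_set_mset_le[of "roots p"]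
  by auto

lemma splits_simply_iff:
  assumes p: "p \<in> carrier (poly_ring R)" "p \<noteq> []"
  shows "splits_simply p \<longleftrightarrow> splitted p \<and> (\<forall>x. count (roots p) x \<le> 1)"
proof
  assume "splits_simply p"
  then have c: "card (set_mset (roots p)) = degree p"
    by (simp add: splits_simply_def zeros_eq_roots[OF p])
  then have s: "size (roots p) = card (set_mset (roots p))"
    using size_roots_le_degree[OF p(1)] card_set_mset_le[of "roots p"] by simp
  have sub: "mset_set (set_mset (roots p)) \<subseteq># roots p"
    by (simp add: mset_set_set_mset_msubset)
  have "size (mset_set (set_mset (roots p))) = size (roots p)"
    using s by simp
  then have "mset_set (set_mset (roots p)) = roots p"
    using sub mset_subset_size[of "mset_set (set_mset (roots p))" "roots p"] by (auto simp: subset_mset_def)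
  then have "count (roots p) x \<le> 1" for x
    by (metis count_mset_set(1) count_mset_set(3) finite_set_mset le_numeral_extra(4) zero_le_one)
  then show "splitted p \<and> (\<forall>x. count (roots p) x \<le> 1)"
    using c s by (simp add: splitted_def)
next
  assume a: "splitted p \<and> (\<forall>x. count (roots p) x \<le> 1)"
  have "roots p = mset_set (set_mset (roots p))"
  proof (rule multiset_eqI)
    fix x
    show "count (roots p) x = count (mset_set (set_mset (roots p))) x"
    proof (cases "x \<in># roots p")
      case True
      then have "count (roots p) x = 1"
        using spec[OF conjunct2[OF a], of x] count_greater_zero_iff[of "roots p" x] by linarith
      then show ?thesis using True by simp
    qed (simp add: not_in_iff)
  qed
  then have "card (set_mset (roots p)) = size (roots p)" by (metis size_mset_set)
  then show "splits_simply p"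
    using a p by (simp add: splits_simply_def zeros_eq_roots[OF p] splitted_def)
qed

lemma splits_simply_divisor:
  assumes q: "splits_simply q" and p: "p \<in> carrier (poly_ring R)" "p pdivides q"
  shows "splits_simply p" "zeros p \<subseteq> zeros q"
proof -
  have q': "q \<in> carrier (poly_ring R)" "q \<noteq> []" using q by (auto simp: splits_simply_def)
  have p0: "p \<noteq> []" using p(2) q'(2) zero_pdivides by auto
  have incl: "roots p \<subseteq># roots q" using pdivides_imp_roots_incl[OF p(1) q' p(2)] .
  have q'': "splitted q" "\<And>x. count (roots q) x \<le> 1"
    using splits_simply_iff[OF q'] q by auto
  have "count (roots p) x \<le> 1" for x
    using mset_subset_eq_count[OF incl, of x] q''(2)[of x] by linarith
  then show "splits_simply p"
    using splits_simply_iff[OF p(1) p0] pdivides_imp_splitted[OF p(1) q' q''(1) p(2)] by auto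
  show "zeros p \<subseteq> zeros q"
    using zeros_eq_roots[OF p(1) p0] zeros_eq_roots[OF q'] set_mset_mono[OF incl] by simp
qed

end

text \<open>The value of the derivative, by the same recursion as \<^const>\<open>ring.eval\<close>.\<close>

fun (in ring) deriv_eval :: "'a list \<Rightarrow> 'a \<Rightarrow> 'a" where
  "deriv_eval [] x = \<zero>"
| "deriv_eval (c # p) x = ([length p] \<cdot> c) \<otimes> x [^] (length p - 1) \<oplus> deriv_eval p x"

context field
begin

lemma deriv_eval_closed [simp]:
  assumes "set p \<subseteq> carrier R" "x \<in> carrier R"
  shows "deriv_eval p x \<in> carrier R"
  using assms(1) by (induct p) (use assms(2) in auto)

lemma eval_formal_deriv:
  assumes "set p \<subseteq> carrier R" "x \<in> carrier R"
  shows "eval (formal_deriv R p) x = deriv_eval p x"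
proof -
  let ?d = "\<lambda>p. map (\<lambda>i. [i] \<cdot> coeff p i) (rev [1..<length p])"
  have c: "set (?d p) \<subseteq> carrier R"
    using coeff_in_carrier[OF assms(1)] by auto
  have "eval (?d p) x = deriv_eval p x" using assms(1)
  proof (induct p)
    case (Cons c p)
    show ?case
    proof (cases "p = []")
      case False
      then have "[1..<length (c # p)] = [1..<length p] @ [length p]"
        by (simp add: Suc_leI)
      moreover have "map (\<lambda>i. [i] \<cdot> coeff (c # p) i) (rev [1..<length p]) = ?d p"
        by (rule map_cong) auto
      ultimately have "?d (c # p) = [length p] \<cdot> c # ?d p" by (simp del: upt_Suc)
      then show ?thesis using Cons by simp
    qed (use Cons.prems assms in auto)
  qed simp
  then show ?thesis
    unfolding formal_deriv_def using eval_normalize[OF c assms(2)] by simp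
qed

lemma deriv_eval_normalize:
  assumes "set p \<subseteq> carrier R" "x \<in> carrier R"
  shows "deriv_eval (normalize p) x = deriv_eval p x"
  using assms(1) by (induct p) (use assms(2) in auto)

lemma deriv_eval_map2:
  assumes "length p = length q" "set p \<subseteq> carrier R" "set q \<subseteq> carrier R" "x \<in> carrier R"
  shows "deriv_eval (map2 (\<oplus>) p q) x = deriv_eval p x \<oplus> deriv_eval q x"
  using assms(1-3)
proof (induct p q rule: list_induct2)
  case (Cons c p d q)
  have cl: "c \<in> carrier R" "d \<in> carrier R" "deriv_eval p x \<in> carrier R" "deriv_eval q x \<in> carrier R"
    using Cons assms(4) by auto
  have l: "length (map2 (\<oplus>) p q) = length p" using Cons by simp
  show ?case
    using Cons cl assms(4) l by (simp add: add.nat_pow_distrib l_distr a_ac)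
qed (use assms in simp)

lemma deriv_eval_poly_add:
  assumes p: "set p \<subseteq> carrier R" and q: "set q \<subseteq> carrier R" and x: "x \<in> carrier R"
    and l: "length q \<le> length p"
  shows "deriv_eval (poly_add p q) x = deriv_eval p x \<oplus> deriv_eval q x"
proof -
  let ?q = "replicate (length p - length q) \<zero> @ q"
  have rep: "deriv_eval (replicate n \<zero> @ q) x = deriv_eval q x" for n
    by (induct n) (use q x in auto)
  have *: "set ?q \<subseteq> carrier R" "length p = length ?q" using q l by auto
  have "set (map2 (\<oplus>) p ?q) \<subseteq> carrier R"
  proof
    fix c assume "c \<in> set (map2 (\<oplus>) p ?q)"
    then obtain a b where "(a, b) \<in> set (zip p ?q)" "c = a \<oplus> b" by auto
    then show "c \<in> carrier R"
      using p *(1) set_zip_leftD[of a b p ?q] set_zip_rightD[of a b p ?q] by blast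
  qed
  then show ?thesis
    using deriv_eval_normalize[OF _ x] deriv_eval_map2[OF *(2) p *(1) x] l rep by simp
qed

lemma deriv_eval_scale:
  assumes "set p \<subseteq> carrier R" "a \<in> carrier R" "x \<in> carrier R"
  shows "deriv_eval (map ((\<otimes>) a) p) x = a \<otimes> deriv_eval p x"
  using assms(1)
proof (induct p)
  case (Cons c p)
  then show ?case using assms(2,3)
    by (simp add: r_distr add_pow_rdistr[symmetric] m_assoc del: add_pow_rdistr)
qed (use assms in simp)

lemma deriv_eval_shift:
  assumes "set p \<subseteq> carrier R" "x \<in> carrier R"
  shows "deriv_eval (p @ [\<zero>]) x = eval p x \<oplus> x \<otimes> deriv_eval p x"
  using assms(1)
proof (induct p)
  case (Cons c p)
  have cl: "c \<in> carrier R" "deriv_eval p x \<in> carrier R" "eval p x \<in> carrier R"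
    using Cons.prems assms(2) eval_in_carrier by auto
  have step: "x \<otimes> ([length p] \<cdot> c \<otimes> x [^] (length p - 1)) = [length p] \<cdot> c \<otimes> x [^] length p"
  proof (cases "length p")
    case 0 then show ?thesis using assms(2) by simp
  next
    case (Suc n)
    then show ?thesis using assms(2) cl by (simp add: m_ac)
  qed
  have "deriv_eval ((c # p) @ [\<zero>]) x
      = ([length p] \<cdot> c \<oplus> c) \<otimes> x [^] length p \<oplus> (eval p x \<oplus> x \<otimes> deriv_eval p x)"
    using Cons by simp
  also have "\<dots> = (c \<otimes> x [^] length p \<oplus> eval p x)
      \<oplus> (x \<otimes> ([length p] \<cdot> c \<otimes> x [^] (length p - 1)) \<oplus> x \<otimes> deriv_eval p x)"
    unfolding step using cl assms(2) by (simp add: l_distr a_ac)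
  also have "\<dots> = eval (c # p) x \<oplus> x \<otimes> deriv_eval (c # p) x"
    using cl assms(2) by (simp add: r_distr)
  finally show ?case .
qed (use assms in simp)

text \<open>The product rule at \<open>x\<close> for \<open>(X - x) q\<close>, obtained from the shift \<open>q \<mapsto> Xq\<close> and scaling.\<close>

lemma deriv_eval_linear_factor:
  assumes q: "set q \<subseteq> carrier R" and x: "x \<in> carrier R"
  shows "deriv_eval (poly_mult [\<one>, \<ominus> x] q) x = eval q x"
proof -
  let ?a = "map ((\<otimes>) \<one>) q @ [\<zero>]" and ?b = "poly_mult [\<ominus> x] q"
  have b: "?b = normalize (map ((\<otimes>) (\<ominus> x)) q)"
    using poly_mult_const'(1)[OF q, of "\<ominus> x"] x by simp
  have bR: "set (map ((\<otimes>) (\<ominus> x)) q) \<subseteq> carrier R" using q x by auto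
  have one: "map ((\<otimes>) \<one>) q = q" using q by (induct q) auto
  have e: "deriv_eval q x \<in> carrier R" "eval q x \<in> carrier R" using q x eval_in_carrier by auto
  have l: "length ?b \<le> length ?a" unfolding b using normalize_length_le[of "map ((\<otimes>) (\<ominus> x)) q"] by simp
  have bR': "set ?b \<subseteq> carrier R" unfolding b using normalize_in_carrier[OF bR] .
  have "poly_mult [\<one>, \<ominus> x] q = poly_add ?a ?b" by simp
  then have "deriv_eval (poly_mult [\<one>, \<ominus> x] q) x = deriv_eval ?a x \<oplus> deriv_eval ?b x"
    using deriv_eval_poly_add[OF _ bR' x l] q by (simp add: one)
  also have "\<dots> = (eval q x \<oplus> x \<otimes> deriv_eval q x) \<oplus> (\<ominus> x) \<otimes> deriv_eval q x"
    unfolding b deriv_eval_normalize[OF bR x] one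
    using deriv_eval_shift[OF q x] deriv_eval_scale[OF q _ x, of "\<ominus> x"] x by simp
  also have "\<dots> = eval q x"
    using e x by (simp add: a_assoc l_minus r_neg)
  finally show ?thesis .
qed

text \<open>A double root of \<open>f\<close> is a root of the derivative, hence of \<open>uf + vf' = 1\<close>.\<close>

lemma separable_imp_simple_roots:
  assumes f: "separable_poly R K f" "f \<noteq> []" and K: "subring K R"
  shows "count (roots f) x \<le> 1"
proof (rule ccontr)
  assume n: "\<not> ?thesis"
  obtain u v where uv: "f \<in> carrier (K[X])" "u \<in> carrier (K[X])" "v \<in> carrier (K[X])"
    "(u \<otimes>\<^bsub>K[X]\<^esub> f) \<oplus>\<^bsub>K[X]\<^esub> (v \<otimes>\<^bsub>K[X]\<^esub> formal_deriv R f) = \<one>\<^bsub>K[X]\<^esub>"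
    using f by (auto simp: separable_poly_def)
  have fR: "f \<in> carrier (poly_ring R)" using carrier_polynomial_shell[OF K uv(1)] .
  have set: "set p \<subseteq> carrier R" if "p \<in> carrier (K[X])" for p
    using that subringE(1)[OF K] polynomial_incl unfolding univ_poly_carrier[symmetric] by blast
  have am: "2 \<le> alg_mult f x" using n by (simp add: alg_mult_eq_count_roots[OF fR])
  then have x: "x \<in> carrier R" by (auto simp: alg_mult_def split: if_splits)
  have lin: "[\<one>, \<ominus> x] \<in> carrier (poly_ring R)"
    using x by (simp add: univ_poly_carrier[symmetric] polynomial_def)
  interpret UP: domain "poly_ring R" using univ_poly_is_domain[OF carrier_is_subring] .
  have "([\<one>, \<ominus> x] [^]\<^bsub>poly_ring R\<^esub> (2::nat)) pdivides f"
    using le_alg_mult_imp_pdivides[OF x fR am] .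
  then obtain h where h: "h \<in> carrier (poly_ring R)"
      "f = ([\<one>, \<ominus> x] [^]\<^bsub>poly_ring R\<^esub> (2::nat)) \<otimes>\<^bsub>poly_ring R\<^esub> h"
    by (auto simp: pdivides_def factor_def)
  define q where "q = [\<one>, \<ominus> x] \<otimes>\<^bsub>poly_ring R\<^esub> h"
  have q: "q \<in> carrier (poly_ring R)" using lin h by (simp add: q_def)
  have fq: "f = [\<one>, \<ominus> x] \<otimes>\<^bsub>poly_ring R\<^esub> q"
    unfolding h(2) q_def using lin h(1) by (simp add: numeral_2_eq_2 UP.m_assoc)
  have sR: "set p \<subseteq> carrier R" if "p \<in> carrier (poly_ring R)" for p
    using that polynomial_incl unfolding univ_poly_carrier[symmetric] by blast
  have ev: "eval (p \<otimes>\<^bsub>poly_ring R\<^esub> r) x = eval p x \<otimes> eval r x"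
    if "p \<in> carrier (poly_ring R)" "r \<in> carrier (poly_ring R)" for p r
    using eval_poly_mult[OF sR[OF that(1)] sR[OF that(2)] x] by (simp add: univ_poly_mult)
  have lin0: "eval [\<one>, \<ominus> x] x = \<zero>" using x by (simp add: r_neg)
  have hx: "eval h x \<in> carrier R" "eval q x \<in> carrier R" using eval_in_carrier sR h(1) q x by auto
  have q0: "eval q x = \<zero>" unfolding q_def using ev[OF lin h(1)] lin0 hx by simp
  have f0: "eval f x = \<zero>" unfolding fq using ev[OF lin q] lin0 hx by simp
  have d0: "eval (formal_deriv R f) x = \<zero>"
    using eval_formal_deriv[OF sR[OF fR] x] deriv_eval_linear_factor[OF sR[OF q] x] q0
    by (simp add: fq univ_poly_mult)
  have dR: "set (formal_deriv R f) \<subseteq> carrier R"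
    unfolding formal_deriv_def
    by (rule normalize_in_carrier) (use coeff_in_carrier[OF sR[OF fR]] in auto)
  have e: "eval u x \<in> carrier R" "eval v x \<in> carrier R" using eval_in_carrier set uv x by auto
  have "\<one> = eval (\<one>\<^bsub>K[X]\<^esub>) x" using x by (simp add: univ_poly_one)
  also have "\<dots> = eval u x \<otimes> eval f x \<oplus> eval v x \<otimes> eval (formal_deriv R f) x"
    unfolding uv(4)[symmetric] univ_poly_add univ_poly_mult
    using eval_poly_add[of "poly_mult u f" "poly_mult v (formal_deriv R f)" x]
      poly_mult_in_carrier[of u f] poly_mult_in_carrier[of v "formal_deriv R f"]
      eval_poly_mult[of u f x] eval_poly_mult[of v "formal_deriv R f" x] set uv(1-3) dR x
    by simp
  also have "\<dots> = \<zero>" using f0 d0 e by simp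
  finally show False by simp
qed

lemma separably_closed_splits_simply:
  assumes "separably_closed R" "subring K R" "separable_poly R K f" "f \<noteq> []"
  shows "splits_simply f"
proof -
  obtain u v where uv: "f \<in> carrier (K[X])" "u \<in> carrier (K[X])" "v \<in> carrier (K[X])"
    "(u \<otimes>\<^bsub>K[X]\<^esub> f) \<oplus>\<^bsub>K[X]\<^esub> (v \<otimes>\<^bsub>K[X]\<^esub> formal_deriv R f) = \<one>\<^bsub>K[X]\<^esub>"
    using assms(3) unfolding separable_poly_def by blast
  note up = carrier_polynomial_shell[OF assms(2)]
  have f: "f \<in> carrier (poly_ring R)" using up uv(1) .
  have "separable_poly R (carrier R) f"
    unfolding separable_poly_def
    by (intro conjI f bexI[OF _ up[OF uv(2)]] bexI[OF _ up[OF uv(3)]])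
      (use uv(4) in \<open>simp add: univ_poly_add univ_poly_mult univ_poly_one\<close>)
  then have "splitted f" using assms(1) by (simp add: separably_closed_def)
  then show ?thesis
    using splits_simply_iff[OF f assms(4)] separable_imp_simple_roots[OF assms(3,4,2)] by simp
qed

end

section \<open>Homomorphisms of simple extensions\<close>

context field
begin

lemma set_poly_subset: "p \<in> carrier (K[X]) \<Longrightarrow> set p \<subseteq> K"
  using polynomial_incl unfolding univ_poly_carrier[symmetric] by blast

lemma map_poly_hom:
  assumes "field S" "subfield K R" "h \<in> ring_hom (R\<lparr>carrier := K\<rparr>) S"
  shows "map h \<in> ring_hom (K[X]) (poly_ring S)"
proof -
  interpret S: field S by fact
  note K = subfieldE(1)[OF assms(2)]
  have fK: "field (R\<lparr>carrier := K\<rparr>)" using subfield_iff(2)[OF assms(2)] .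
  interpret KR: field "R\<lparr>carrier := K\<rparr>" by fact
  interpret H: ring_hom_ring "R\<lparr>carrier := K\<rparr>" S h
    by (rule ring_hom_ringI2[OF KR.ring_axioms S.ring_axioms assms(3)])
  have UP: "univ_poly (R\<lparr>carrier := K\<rparr>) K = K[X]" using univ_poly_consistent[OF K] by simp
  have c: "map h p \<in> carrier (poly_ring S)" if "p \<in> carrier (K[X])" for p
    using polynomial_hom[OF assms(3) fK assms(1), of p] that UP by simp
  interpret UPK: domain "K[X]" using univ_poly_is_domain[OF K] .
  show ?thesis
  proof (rule ring_hom_memI)
    fix p q assume pq: "p \<in> carrier (K[X])" "q \<in> carrier (K[X])"
    note s = set_poly_subset[OF pq(1)] set_poly_subset[OF pq(2)]
    have n: "S.normalize (map h p) = map h p" if "p \<in> carrier (K[X])" for p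
      using c[OF that] S.normalize_polynomial unfolding univ_poly_carrier[symmetric] by blast
    show "map h (p \<otimes>\<^bsub>K[X]\<^esub> q) = map h p \<otimes>\<^bsub>poly_ring S\<^esub> map h q"
      using H.poly_mult_hom'[of p q] s n[OF UPK.m_closed[OF pq]] poly_mult_consistent[OF K]
      by (simp add: univ_poly_mult)
    show "map h (p \<oplus>\<^bsub>K[X]\<^esub> q) = map h p \<oplus>\<^bsub>poly_ring S\<^esub> map h q"
      using H.poly_add_hom'[of p q] s n[OF UPK.a_closed[OF pq]] poly_add_consistent[OF K]
      by (simp add: univ_poly_add)
  next
    show "map h \<one>\<^bsub>K [X]\<^esub> = \<one>\<^bsub>poly_ring S\<^esub>"
      using H.hom_one by (simp add: univ_poly_one)
  qed (use c in auto)
qed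

lemma hom_eval:
  assumes "ring S" "subring M R" "h \<in> ring_hom (R\<lparr>carrier := M\<rparr>) S" "set p \<subseteq> M" "x \<in> M"
  shows "h (eval p x) = ring.eval S (map h p) (h x)"
proof -
  interpret S: ring S by fact
  interpret H: ring_hom_ring "R\<lparr>carrier := M\<rparr>" S h
    by (rule ring_hom_ringI2[OF subring_is_ring[OF assms(2)] S.ring_axioms assms(3)])
  show ?thesis using H.eval_hom'[of x p] assms(4,5) eval_consistent[OF assms(2)] by simp
qed

lemma hom_zero:
  assumes "ring S" "subring M R" "h \<in> ring_hom (R\<lparr>carrier := M\<rparr>) S"
  shows "h \<zero> = \<zero>\<^bsub>S\<^esub>"
  using hom_eval[OF assms, of "[]" \<one>] subringE(3)[OF assms(2)] ring.eval.simps(1)[OF assms(1)] by simp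

text \<open>A homomorphism maps \<open>p(x)\<close> to \<open>p\<^sup>h(z)\<close>; this is well defined because a polynomial that
  vanishes at \<open>x\<close> is a multiple of the minimal polynomial.\<close>

theorem hom_extends_to_simple_extension:
  assumes S: "field S" and K: "subfield K R" and h: "h \<in> ring_hom (R\<lparr>carrier := K\<rparr>) S"
    and x: "x \<in> carrier R" "(algebraic over K) x"
    and z: "z \<in> carrier S" "ring.eval S (map h (Irr K x)) z = \<zero>\<^bsub>S\<^esub>"
  obtains h' where "h' \<in> ring_hom (R\<lparr>carrier := simple_extension K x\<rparr>) S"
    "\<And>k. k \<in> K \<Longrightarrow> h' k = h k" "h' x = z"
proof -
  interpret S: field S by fact
  note K' = subfieldE(1)[OF K]
  interpret UPK: domain "K[X]" using univ_poly_is_domain[OF K'] .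
  interpret UPS: domain "poly_ring S" using S.univ_poly_is_domain[OF S.carrier_is_subring] .
  let ?\<phi> = "\<lambda>p. S.eval (map h p) z"
  have "(\<lambda>p. S.eval p z) \<circ> map h \<in> ring_hom (K[X]) S"
    using ring_hom_trans[OF map_poly_hom[OF S K h] S.eval_is_hom[OF S.carrier_is_subring z(1)]] .
  then have \<phi>: "?\<phi> \<in> ring_hom (K[X]) S" by (simp add: comp_def)
  interpret \<phi>: ring_hom_ring "K[X]" S ?\<phi>
    by (rule ring_hom_ringI2[OF UPK.ring_axioms S.ring_axioms \<phi>])
  interpret E: ring_hom_ring "K[X]" R "\<lambda>p. eval p x"
    using eval_ring_hom[OF K' x(1)] .
  have ker: "?\<phi> p = \<zero>\<^bsub>S\<^esub>" if p: "p \<in> carrier (K[X])" "eval p x = \<zero>" for p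
  proof -
    have "Irr K x pdivides p" using Irr_minimal[OF K x p] .
    then have "Irr K x divides\<^bsub>K[X]\<^esub> p" using pdivides_iff_shell[OF K IrrE(1)[OF K x] p(1)] by simp
    then obtain q where q: "q \<in> carrier (K[X])" "p = Irr K x \<otimes>\<^bsub>K[X]\<^esub> q"
      by (auto simp: factor_def)
    show ?thesis
      using \<phi>.hom_mult[OF IrrE(1)[OF K x] q(1)] z(2) \<phi>.hom_closed[OF q(1)] q(2) by simp
  qed
  define h' where "h' y = ?\<phi> (SOME p. p \<in> carrier (K[X]) \<and> eval p x = y)" for y
  have h': "h' (eval p x) = ?\<phi> p" if p: "p \<in> carrier (K[X])" for p
  proof -
    let ?q = "SOME q. q \<in> carrier (K[X]) \<and> eval q x = eval p x"
    have q: "?q \<in> carrier (K[X]) \<and> eval ?q x = eval p x"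
      by (rule someI[of "\<lambda>q. q \<in> carrier (K[X]) \<and> eval q x = eval p x" p]) (use p in simp)
    have "eval (?q \<ominus>\<^bsub>K[X]\<^esub> p) x = \<zero>"
      using q p E.hom_closed[OF p] by (simp add: a_minus_def r_neg)
    then have "?\<phi> (?q \<ominus>\<^bsub>K[X]\<^esub> p) = \<zero>\<^bsub>S\<^esub>"
      using ker q p by blast
    then have "?\<phi> ?q \<ominus>\<^bsub>S\<^esub> ?\<phi> p = \<zero>\<^bsub>S\<^esub>"
      using q p by (simp add: a_minus_def)
    then show ?thesis
      using q p \<phi>.hom_closed[of ?q] \<phi>.hom_closed[of p] by (simp add: h'_def)
  qed
  have img: "simple_extension K x = (\<lambda>p. eval p x) ` carrier (K[X])"
    using simple_extension_as_eval_img[OF subringE(1)[OF K'] x(1)] .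
  have "h' \<in> ring_hom (R\<lparr>carrier := simple_extension K x\<rparr>) S"
  proof (rule ring_hom_memI)
    fix u v
    assume "u \<in> carrier (R\<lparr>carrier := simple_extension K x\<rparr>)"
      and "v \<in> carrier (R\<lparr>carrier := simple_extension K x\<rparr>)"
    then obtain p q where pq: "p \<in> carrier (K[X])" "u = eval p x" "q \<in> carrier (K[X])" "v = eval q x"
      unfolding img by auto
    show "h' (u \<otimes>\<^bsub>R\<lparr>carrier := simple_extension K x\<rparr>\<^esub> v) = h' u \<otimes>\<^bsub>S\<^esub> h' v"
      using h'[OF UPK.m_closed[OF pq(1,3)]] h' pq by simp
    show "h' (u \<oplus>\<^bsub>R\<lparr>carrier := simple_extension K x\<rparr>\<^esub> v) = h' u \<oplus>\<^bsub>S\<^esub> h' v"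
      using h'[OF UPK.a_closed[OF pq(1,3)]] h' pq by simp
  next
    fix u assume "u \<in> carrier (R\<lparr>carrier := simple_extension K x\<rparr>)"
    then show "h' u \<in> carrier S" unfolding img using h' \<phi>.hom_closed by auto
  next
    show "h' \<one>\<^bsub>R\<lparr>carrier := simple_extension K x\<rparr>\<^esub> = \<one>\<^bsub>S\<^esub>"
      using h'[OF UPK.one_closed] by simp
  qed
  moreover have "h' k = h k" if k: "k \<in> K" for k
  proof (cases "k = \<zero>")
    case True
    have "h' \<zero> = \<zero>\<^bsub>S\<^esub>" using h'[OF UPK.zero_closed] by (simp add: univ_poly_zero)
    then show ?thesis using True hom_zero[OF S.ring_axioms K' h] by simp
  next
    case False
    then have p: "[k] \<in> carrier (K[X])" using k by (simp add: univ_poly_carrier[symmetric] polynomial_def)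
    have "k \<in> carrier R" "h k \<in> carrier S"
      using k subringE(1)[OF K'] ring_hom_memE(1)[OF h] by auto
    then show ?thesis using h'[OF p] x z by simp
  qed
  moreover have "h' x = z"
  proof -
    have p: "[\<one>, \<zero>] \<in> carrier (K[X])"
      using subringE(2,3)[OF K'] by (simp add: univ_poly_carrier[symmetric] polynomial_def)
    have "h \<one> = \<one>\<^bsub>S\<^esub>" using ring_hom_memE(4)[OF h] by simp
    then show ?thesis using h'[OF p] x z hom_zero[OF S.ring_axioms K' h] by simp
  qed
  ultimately show ?thesis using that by blast
qed

lemma hom_root:
  assumes "ring S" "subring M R" "h \<in> ring_hom (R\<lparr>carrier := M\<rparr>) S"
    and "set p \<subseteq> M" "x \<in> M" "eval p x = \<zero>"
  shows "ring.eval S (map h p) (h x) = \<zero>\<^bsub>S\<^esub>"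
  using hom_eval[OF assms(1-5)] assms(6) hom_zero[OF assms(1-3)] by simp

lemma fixing_hom_root:
  assumes "subring M R" "h \<in> ring_hom (R\<lparr>carrier := M\<rparr>) R" "\<And>k. k \<in> K \<Longrightarrow> h k = k"
    and "K \<subseteq> M" "set p \<subseteq> K" "x \<in> M" "eval p x = \<zero>"
  shows "eval p (h x) = \<zero>"
proof -
  have "map h p = p" using assms(3,5) by (intro map_idI) auto
  then show ?thesis using hom_root[OF ring_axioms assms(1,2) _ assms(6,7)] assms(4,5) by auto
qed

lemma hom_determined_on_simple_extension:
  assumes S: "ring S" and K: "subring K R" and x: "x \<in> carrier R"
    and g: "g \<in> ring_hom (R\<lparr>carrier := simple_extension K x\<rparr>) S"
    and h: "h \<in> ring_hom (R\<lparr>carrier := simple_extension K x\<rparr>) S"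
    and eq: "\<And>k. k \<in> K \<Longrightarrow> g k = h k" "g x = h x" and y: "y \<in> simple_extension K x"
  shows "g y = h y"
proof -
  obtain p where p: "set p \<subseteq> K" "y = eval p x"
    using simple_extension_obtain_list[OF K x y] .
  note M = simple_extension_is_subring[OF K x] simple_extension_mem[OF K x]
  have s: "set p \<subseteq> simple_extension K x"
    using p(1) simple_extension_incl[OF subringE(1)[OF K] x] by auto
  have "map g p = map h p" using eq(1) p(1) by auto
  then show ?thesis
    using hom_eval[OF S M(1) g s M(2)] hom_eval[OF S M(1) h s M(2)] p(2) eq(2) by metis
qed

lemma Irr_splits_simply_over:
  assumes K: "subfield K R" and K1: "subfield K1 R" "K \<subseteq> K1"
    and x: "x \<in> carrier R" "(algebraic over K) x" and s: "splits_simply (Irr K x)"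
  shows "splits_simply (Irr K1 x)" "zeros (Irr K1 x) \<subseteq> zeros (Irr K x)"
proof -
  have x1: "(algebraic over K1) x" using algebraic_mono[OF K1(2)] x(2) by (simp add: over_def)
  have "Irr K x \<in> carrier (K1[X])"
    using IrrE(1)[OF K x] K1(2) by (auto simp: univ_poly_carrier[symmetric] polynomial_def)
  then have "Irr K1 x pdivides Irr K x"
    using Irr_minimal[OF K1(1) x(1) x1] IrrE(4)[OF K x] by simp
  moreover have "Irr K1 x \<in> carrier (poly_ring R)"
    using IrrE(1)[OF K1(1) x(1) x1] carrier_polynomial_shell[OF subfieldE(1)[OF K1(1)]] by simp
  ultimately show "splits_simply (Irr K1 x)" "zeros (Irr K1 x) \<subseteq> zeros (Irr K x)"
    using splits_simply_divisor[OF s] by auto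
qed

text \<open>A homomorphism over \<open>K\<close> maps the minimal polynomial over \<open>K\<^sub>1\<close> to a divisor of the one over \<open>K\<close>,
  which has all its roots in the field; a root of the image is where \<open>x\<close> can be sent.\<close>

lemma hom_extends_to_splitting_element:
  assumes K: "subfield K R" and K1: "subfield K1 R" "K \<subseteq> K1"
    and x: "x \<in> carrier R" "(algebraic over K) x" and s: "splits_simply (Irr K x)"
    and h: "h \<in> ring_hom (R\<lparr>carrier := K1\<rparr>) R" "\<And>k. k \<in> K \<Longrightarrow> h k = k"
  obtains h' where "h' \<in> ring_hom (R\<lparr>carrier := simple_extension K1 x\<rparr>) R"
    "\<And>k. k \<in> K1 \<Longrightarrow> h' k = h k"
proof -
  have x1: "(algebraic over K1) x" using algebraic_mono[OF K1(2)] x(2) by (simp add: over_def)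
  let ?m = "Irr K1 x" and ?f = "Irr K x"
  note m = IrrE[OF K1(1) x(1) x1]
  have f: "?f \<in> carrier (K1[X])"
    using IrrE(1)[OF K x] K1(2) by (auto simp: univ_poly_carrier[symmetric] polynomial_def)
  have "?m pdivides ?f" using Irr_minimal[OF K1(1) x(1) x1 f] IrrE(4)[OF K x] by simp
  then have "?m divides\<^bsub>K1[X]\<^esub> ?f" using pdivides_iff_shell[OF K1(1) m(1) f] by simp
  then obtain q where q: "q \<in> carrier (K1[X])" "?f = ?m \<otimes>\<^bsub>K1[X]\<^esub> q" by (auto simp: factor_def)
  note H = map_poly_hom[OF field_axioms K1(1) h(1)]
  have "map h ?f = ?f" using h(2) set_poly_subset[OF IrrE(1)[OF K x]] by (intro map_idI) auto
  then have "?f = map h ?m \<otimes>\<^bsub>poly_ring R\<^esub> map h q"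
    using ring_hom_memE(2)[OF H m(1) q(1)] q(2) by simp
  moreover have mc: "map h ?m \<in> carrier (poly_ring R)" "map h q \<in> carrier (poly_ring R)"
    using ring_hom_memE(1)[OF H] m(1) q(1) by auto
  ultimately have "map h ?m pdivides ?f" by (auto simp: pdivides_def factor_def)
  then have "splits_simply (map h ?m)" using splits_simply_divisor(1)[OF s mc(1)] by simp
  then have "card (zeros (map h ?m)) = degree ?m" by (simp add: splits_simply_def)
  moreover have "degree ?m \<ge> 1" using pirreducible_degree[OF K1(1) m(1,2)] .
  ultimately have "zeros (map h ?m) \<noteq> {}" by auto
  then obtain z where "z \<in> carrier R" "eval (map h ?m) z = \<zero>" by (auto simp: zeros_def)
  then show ?thesis
    using hom_extends_to_simple_extension[OF field_axioms K1(1) h(1) x(1) x1] that by metis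
qed

lemma Irr_degree_one_imp_mem:
  assumes K: "subfield K R" and b: "b \<in> carrier R" "(algebraic over K) b"
    and deg: "degree (Irr K b) = 1"
  shows "b \<in> K"
proof -
  note m = IrrE[OF K b]
  obtain k l where kl: "k \<in> K" "l \<in> K" "Irr K b = [k, l]"
    using degree_oneE[OF m(1) deg] by metis
  have klR: "k \<in> carrier R" "l \<in> carrier R" using kl subfieldE(3)[OF K] by auto
  have "k = \<one>" using m(3) kl(3) by simp
  then have "b \<oplus> l = \<zero>" using m(4) kl(3) b(1) klR by simp
  then have "b = \<ominus> l" using b(1) klR by (metis minus_equality minus_minus)
  then show ?thesis using kl(2) subringE(5)[OF subfieldE(1)[OF K]] by simp
qed

section \<open>The primitive element theorem\<close>

text \<open>The usual \<open>\<theta> = a + cb\<close>. If \<open>b\<close> were not in \<open>K(\<theta>)\<close>, it would have another conjugate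
  \<open>w\<close> over \<open>K(\<theta>)\<close>, and the homomorphism over \<open>K(\<theta>)\<close> with \<open>b \<mapsto> w\<close> would map
  \<open>a = \<theta> - cb\<close> to the conjugate \<open>\<theta> - cw\<close> of \<open>a\<close>; only finitely many \<open>c\<close> allow that.\<close>

lemma primitive_element_of_two:
  assumes K: "subfield K R" "infinite K"
    and a: "a \<in> carrier R" "(algebraic over K) a" and b: "b \<in> carrier R" "(algebraic over K) b"
    and s: "splits_simply (Irr K b)"
  shows "\<exists>c \<in> K. a \<in> simple_extension K (a \<oplus> c \<otimes> b) \<and> b \<in> simple_extension K (a \<oplus> c \<otimes> b)"
proof -
  note K' = subfieldE(1)[OF K(1)]
  have KR: "\<And>k. k \<in> K \<Longrightarrow> k \<in> carrier R" using subringE(1)[OF K'] by auto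
  note Ia = IrrE[OF K(1) a] and Ib = IrrE[OF K(1) b]
  have Ia': "Irr K a \<in> carrier (poly_ring R)" "Irr K a \<noteq> []"
    using carrier_polynomial_shell[OF K' Ia(1)] pirreducibleE(1)[OF K' Ia(1,2)] by auto
  have fin: "finite (zeros (Irr K a))" "finite (zeros (Irr K b))"
    using finite_zeros(1)[OF Ia'] finite_zeros(1) s by (auto simp: splits_simply_def)
  \<comment> \<open>the \<open>c\<close> for which \<open>a + cb - cw\<close> is a conjugate \<open>u\<close> of \<open>a\<close>\<close>
  define Bad where "Bad = (\<lambda>(u, w). (u \<ominus> a) \<otimes> inv (b \<ominus> w)) ` (zeros (Irr K a) \<times> zeros (Irr K b))"
  have "finite Bad" unfolding Bad_def using fin by simp
  then obtain c where c: "c \<in> K" "c \<notin> Bad" using K(2) by (meson finite_subset subsetI)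
  note cR = KR[OF c(1)]
  define \<theta> where "\<theta> = a \<oplus> c \<otimes> b"
  have \<theta>: "\<theta> \<in> carrier R" using a b cR by (simp add: \<theta>_def)
  have "subfield {x \<in> carrier R. (algebraic over K) x} R" using subfield_of_algebraics[OF K(1)] .
  then have "subring {x \<in> carrier R. (algebraic over K) x} R" by (rule subfieldE(1))
  note alg = subringE(6,7)[OF this]
  have "c \<in> {x \<in> carrier R. (algebraic over K) x}" using algebraic_self[OF K' c(1)] cR by (simp add: over_def)
  then have \<theta>a: "(algebraic over K) \<theta>"
    using alg(1)[of c b] alg(2)[of a "c \<otimes> b"] a b by (simp add: \<theta>_def)
  let ?K1 = "simple_extension K \<theta>"
  have K1: "subfield ?K1 R" using simple_extension_is_subfield[OF K(1) \<theta>] \<theta>a by simp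
  note K1' = subfieldE(1)[OF K1]
  have KK1: "K \<subseteq> ?K1" using simple_extension_incl[OF subringE(1)[OF K'] \<theta>] .
  have \<theta>1: "\<theta> \<in> ?K1" using simple_extension_mem[OF K' \<theta>] .
  have b1: "(algebraic over ?K1) b" using algebraic_mono[OF KK1] b(2) by (simp add: over_def)
  note m = IrrE[OF K1 b(1) b1]
  note sm = Irr_splits_simply_over[OF K(1) K1 KK1 b s]
  have deg: "degree (Irr ?K1 b) = 1"
  proof (rule ccontr)
    assume "degree (Irr ?K1 b) \<noteq> 1"
    then have "card (zeros (Irr ?K1 b)) \<ge> 2"
      using pirreducible_degree[OF K1 m(1,2)] sm(1) by (simp add: splits_simply_def)
    then have "\<not> zeros (Irr ?K1 b) \<subseteq> {b}"
      using card_mono[of "{b}" "zeros (Irr ?K1 b)"] by auto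
    then obtain w where w: "w \<in> zeros (Irr ?K1 b)" "w \<noteq> b" by auto
    have wR: "w \<in> carrier R" "eval (Irr ?K1 b) w = \<zero>" using w by (auto simp: zeros_def)
    have id: "id \<in> ring_hom (R\<lparr>carrier := ?K1\<rparr>) R"
      using subringE(1)[OF K1'] by (auto intro!: ring_hom_memI)
    obtain h where h: "h \<in> ring_hom (R\<lparr>carrier := simple_extension ?K1 b\<rparr>) R"
      "\<And>k. k \<in> ?K1 \<Longrightarrow> h k = k" "h b = w"
      using hom_extends_to_simple_extension[OF field_axioms K1 id b(1) b1 wR(1)] wR(2) by auto
    let ?N = "simple_extension ?K1 b"
    note N = simple_extension_is_subring[OF K1' b(1)]
    have K1N: "?K1 \<subseteq> ?N" and bN: "b \<in> ?N"
      using simple_extension_incl[OF subringE(1)[OF K1'] b(1)] simple_extension_mem[OF K1' b(1)] by auto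
    have a\<theta>: "a = \<theta> \<oplus> (\<ominus> c) \<otimes> b" using a b cR by (simp add: \<theta>_def a_assoc l_minus r_neg)
    have mem: "\<theta> \<in> ?N" "\<ominus> c \<in> ?K1" "\<ominus> c \<in> ?N"
      using \<theta>1 K1N KK1 c(1) subringE(5)[OF K1'] by auto
    then have aN: "a \<in> ?N" unfolding a\<theta> using subringE(6,7)[OF N] bN by auto
    have "h a = h \<theta> \<oplus> h ((\<ominus> c) \<otimes> b)"
      using ring_hom_memE(3)[OF h(1), of \<theta> "(\<ominus> c) \<otimes> b"] mem bN subringE(6)[OF N] a\<theta> by simp
    also have "h ((\<ominus> c) \<otimes> b) = (\<ominus> c) \<otimes> w"
      using ring_hom_memE(2)[OF h(1), of "\<ominus> c" b] mem bN h(2)[OF mem(2)] h(3) by simp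
    finally have ha: "h a = \<theta> \<oplus> (\<ominus> c) \<otimes> w" using h(2)[OF \<theta>1] by simp
    have "eval (Irr K a) (h a) = \<zero>"
      using fixing_hom_root[OF N h(1) _ _ set_poly_subset[OF Ia(1)] aN Ia(4)] h(2) KK1 K1N by auto
    then have u: "h a \<in> zeros (Irr K a)"
      using ha \<theta> cR wR by (simp add: zeros_def)
    have "h a \<ominus> a = c \<otimes> (b \<ominus> w)"
      unfolding ha \<theta>_def using a b cR wR by (simp add: a_minus_def r_distr l_minus r_minus a_ac r_neg2)
    moreover have nz: "b \<ominus> w \<noteq> \<zero>" "b \<ominus> w \<in> carrier R" using w(2) b wR by auto
    ultimately have "c = (h a \<ominus> a) \<otimes> inv (b \<ominus> w)"
      using cR by (simp add: m_assoc field_Units)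
    moreover have "w \<in> zeros (Irr K b)" using sm(2) w(1) by auto
    ultimately show False using c(2) u unfolding Bad_def by force
  qed
  have bK1: "b \<in> ?K1" using Irr_degree_one_imp_mem[OF K1 b(1) b1 deg] .
  have "a = \<theta> \<oplus> \<ominus> (c \<otimes> b)" using a b cR by (simp add: \<theta>_def a_assoc r_neg)
  moreover have "c \<otimes> b \<in> ?K1" using subringE(6)[OF K1'] bK1 c(1) KK1 by auto
  ultimately have "a \<in> ?K1" using subringE(5,7)[OF K1'] \<theta>1 by auto
  then show ?thesis using bK1 c(1) unfolding \<theta>_def by blast
qed

text \<open>The multiplicative group of a finite field is cyclic, and a generator is primitive.\<close>

lemma finite_field_primitive_element:
  assumes K: "subring K R" and L: "subfield L R" "K \<subseteq> L" "finite L"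
  shows "\<exists>\<theta> \<in> L. L = simple_extension K \<theta>"
proof -
  note L' = subfieldE(1)[OF L(1)]
  interpret L: field "R\<lparr>carrier := L\<rparr>" using subfield_iff(2)[OF L(1)] .
  obtain g where g: "g \<in> carrier (mult_of (R\<lparr>carrier := L\<rparr>))"
    "carrier (mult_of (R\<lparr>carrier := L\<rparr>)) = {g [^]\<^bsub>R\<lparr>carrier := L\<rparr>\<^esub> i | i::nat. i \<in> UNIV}"
    using L.finite_field_mult_group_has_gen L(3) by auto
  have gL: "g \<in> L" using g(1) by simp
  then have gR: "g \<in> carrier R" using subringE(1)[OF L'] by auto
  let ?N = "simple_extension K g"
  note N = simple_extension_is_subring[OF K gR]
  have gp: "g [^] (i::nat) \<in> ?N" for i
    by (induct i) (use subringE(3,6)[OF N] simple_extension_mem[OF K gR] in auto)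
  have "L \<subseteq> ?N"
  proof
    fix y assume y: "y \<in> L"
    show "y \<in> ?N"
    proof (cases "y = \<zero>")
      case False
      then have "y \<in> carrier (mult_of (R\<lparr>carrier := L\<rparr>))" using y by simp
      then obtain i :: nat where "y = g [^]\<^bsub>R\<lparr>carrier := L\<rparr>\<^esub> i" unfolding g(2) by auto
      then show ?thesis using gp nat_pow_consistent by metis
    qed (use subringE(2)[OF N] in simp)
  qed
  moreover have "?N \<subseteq> L" using simple_extension_subring_incl[OF L' L(2) gL] .
  ultimately show ?thesis using gL by blast
qed

text \<open>Over an infinite \<open>K\<close>, an element of maximal degree is primitive: combining it with any \<open>b\<close>
  gives an element of the same degree, hence the same field.\<close>

theorem primitive_element:
  assumes K: "subfield K R" and L: "subfield L R" "K \<subseteq> L" and fd: "finite_dimension K L"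
    and s: "\<And>x. x \<in> L \<Longrightarrow> splits_simply (Irr K x)"
  shows "\<exists>\<theta> \<in> L. L = simple_extension K \<theta>"
proof (cases "finite K")
  case True
  obtain n where n: "dimension n K L" using fd by auto
  obtain Us where Us: "set Us \<subseteq> carrier R" "Span K Us = L"
    using exists_base[OF K n] by auto
  have "L \<subseteq> (\<lambda>Ks. combine Ks Us) ` {Ks. set Ks \<subseteq> K \<and> length Ks = length Us}"
    using Span_eq_combine_set_length_version[OF K Us(1)] Us(2) by auto
  then have "finite L"
    using finite_lists_length_eq[OF True] by (rule finite_subset[OF _ finite_imageI])
  then show ?thesis using finite_field_primitive_element[OF subfieldE(1)[OF K] L] by simp
next
  case False
  note K' = subfieldE(1)[OF K] and L' = subfieldE(1)[OF L(1)]
  have LR: "\<And>x. x \<in> L \<Longrightarrow> x \<in> carrier R" using subringE(1)[OF L'] by auto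
  have alg: "(algebraic over K) x" if "x \<in> L" for x
    using finite_dimension_imp_algebraic[OF K L' fd that] .
  obtain n where n: "dimension n K L" using fd by auto
  have base: "\<exists>Us. independent K Us \<and> length Us = degree (Irr K x) \<and> Span K Us = simple_extension K x
      \<and> set Us \<subseteq> simple_extension K x" if "x \<in> L" for x
    using exists_base[OF K dimension_simple_extension[OF K LR[OF that] alg[OF that]]]
      Span_base_incl[OF K] by metis
  have sub: "simple_extension K x \<subseteq> L" if "x \<in> L" for x
    using simple_extension_subring_incl[OF L' L(2) that] .
  have bound: "degree (Irr K x) < Suc n" if "x \<in> L" for x
    using base[OF that] sub[OF that] independent_length_le_dimension[OF K n] by fastforce
  obtain \<theta> where \<theta>: "\<theta> \<in> L" "\<And>x. x \<in> L \<Longrightarrow> degree (Irr K x) \<le> degree (Irr K \<theta>)"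
    using ex_has_greatest_nat[of "\<lambda>x. x \<in> L" \<one> "\<lambda>x. degree (Irr K x)" "Suc n"] bound subringE(3)[OF L'] 
    by (metis less_imp_le)
  have "b \<in> simple_extension K \<theta>" if b: "b \<in> L" for b
  proof -
    obtain c where c: "c \<in> K" "\<theta> \<in> simple_extension K (\<theta> \<oplus> c \<otimes> b)" "b \<in> simple_extension K (\<theta> \<oplus> c \<otimes> b)"
      using primitive_element_of_two[OF K False LR[OF \<theta>(1)] alg[OF \<theta>(1)] LR[OF b] alg[OF b] s[OF b]]
      by blast
    let ?t = "\<theta> \<oplus> c \<otimes> b"
    have t: "?t \<in> L" using subringE(6,7)[OF L'] c(1) L(2) b \<theta>(1) by auto
    have incl: "simple_extension K \<theta> \<subseteq> simple_extension K ?t"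
      using simple_extension_subring_incl[OF simple_extension_is_subring[OF K' LR[OF t]] _ c(2)]
        simple_extension_incl[OF subringE(1)[OF K'] LR[OF t]] by auto
    obtain Us where Us: "independent K Us" "length Us = degree (Irr K \<theta>)"
      "Span K Us = simple_extension K \<theta>" "set Us \<subseteq> simple_extension K \<theta>" using base[OF \<theta>(1)] by auto
    note dt = dimension_simple_extension[OF K LR[OF t] alg[OF t]]
    have "set Us \<subseteq> simple_extension K ?t" using Us(4) incl by auto
    moreover have "length Us = degree (Irr K ?t)"
      using independent_length_le_dimension[OF K dt Us(1)] calculation \<theta>(2)[OF t] Us(2) by simp
    ultimately show ?thesis
      using independent_length_eq_dimension[OF K dt Us(1)] Us(3) c(3) by simp
  qed
  then show ?thesis using \<theta>(1) sub[OF \<theta>(1)] by blast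
qed

end

section \<open>Galois groups and the Galois closure\<close>

text \<open>The functions are undefined outside \<open>M\<close>, so that automorphisms that agree on \<open>M\<close> are equal and
  can be counted.\<close>

definition (in ring) gal :: "'a set \<Rightarrow> 'a set \<Rightarrow> ('a \<Rightarrow> 'a) set" where
  "gal K M = {g \<in> ring_hom (R\<lparr>carrier := M\<rparr>) (R\<lparr>carrier := M\<rparr>) \<inter> extensional M. \<forall>k \<in> K. g k = k}"

context field
begin

lemma restrict_mem_gal:
  assumes M: "subring M R" "K \<subseteq> M" and h: "h \<in> ring_hom (R\<lparr>carrier := M\<rparr>) R"
    and "\<And>k. k \<in> K \<Longrightarrow> h k = k" "\<And>x. x \<in> M \<Longrightarrow> h x \<in> M"
  shows "restrict h M \<in> gal K M"
  using assms ring_hom_memE[OF h] subringE(3,6,7)[OF M(1)]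
  by (auto simp: gal_def intro!: ring_hom_memI)

lemma gal_imp_hom:
  assumes "g \<in> gal K M" "subring M R"
  shows "g \<in> ring_hom (R\<lparr>carrier := M\<rparr>) R"
proof -
  have g: "g \<in> ring_hom (R\<lparr>carrier := M\<rparr>) (R\<lparr>carrier := M\<rparr>)" using assms(1) by (simp add: gal_def)
  show ?thesis
    by (rule ring_hom_memI) (use ring_hom_memE[OF g] subringE(1)[OF assms(2)] in auto)
qed

text \<open>If \<open>x = p(\<theta>)\<close> is fixed by the Galois group, where \<open>deg p < n = [K(\<theta>) : K]\<close>, then
  \<open>p\<close> takes the value \<open>x\<close> at all \<open>n\<close> conjugates of \<open>\<theta>\<close>, and so it is constant.\<close>

theorem gal_simple_extension:
  assumes K: "subfield K R" and \<theta>: "\<theta> \<in> carrier R" "(algebraic over K) \<theta>"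
    and s: "splits_simply (Irr K \<theta>)" and M: "M = simple_extension K \<theta>"
    and z: "zeros (Irr K \<theta>) \<subseteq> M"
  shows "finite (gal K M)"
    and "\<And>x. \<lbrakk>x \<in> M; \<And>g. g \<in> gal K M \<Longrightarrow> g x = x\<rbrakk> \<Longrightarrow> x \<in> K"
proof -
  note K' = subfieldE(1)[OF K]
  note I = IrrE[OF K \<theta>]
  have MS: "subring M R" "K \<subseteq> M" "\<theta> \<in> M"
    using simple_extension_is_subring[OF K' \<theta>(1)] simple_extension_incl[OF subringE(1)[OF K'] \<theta>(1)]
      simple_extension_mem[OF K' \<theta>(1)] M by auto
  have fz: "finite (zeros (Irr K \<theta>))" using finite_zeros(1) s by (auto simp: splits_simply_def)
  have inj: "inj_on (\<lambda>g. g \<theta>) (gal K M)"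
  proof (rule inj_onI)
    fix g h assume gh: "g \<in> gal K M" "h \<in> gal K M" "g \<theta> = h \<theta>"
    show "g = h"
    proof (rule extensionalityI[of _ M])
      show "g \<in> extensional M" "h \<in> extensional M" using gh by (auto simp: gal_def)
      fix y assume y: "y \<in> M"
      show "g y = h y"
        by (rule hom_determined_on_simple_extension[OF ring_axioms K' \<theta>(1)
              gal_imp_hom[OF gh(1) MS(1), unfolded M] gal_imp_hom[OF gh(2) MS(1), unfolded M] _ gh(3)])
          (use gh y M in \<open>auto simp: gal_def\<close>)
    qed
  qed
  have "(\<lambda>g. g \<theta>) ` gal K M \<subseteq> zeros (Irr K \<theta>)"
  proof
    fix y assume "y \<in> (\<lambda>g. g \<theta>) ` gal K M"
    then obtain g where g: "g \<in> gal K M" "y = g \<theta>" by auto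
    have "eval (Irr K \<theta>) (g \<theta>) = \<zero>"
      by (rule fixing_hom_root[OF MS(1) gal_imp_hom[OF g(1) MS(1)] _ MS(2) set_poly_subset[OF I(1)] MS(3) I(4)])
        (use g in \<open>auto simp: gal_def\<close>)
    moreover have "g \<theta> \<in> carrier R" using ring_hom_memE(1)[OF gal_imp_hom[OF g(1) MS(1)]] MS(3) by simp
    ultimately show "y \<in> zeros (Irr K \<theta>)" using g(2) by (simp add: zeros_def)
  qed
  then show "finite (gal K M)" using inj fz finite_imageD finite_subset by blast
  fix x assume x: "x \<in> M" "\<And>g. g \<in> gal K M \<Longrightarrow> g x = x"
  have xR: "x \<in> carrier R" using x(1) subringE(1)[OF MS(1)] by auto
  let ?n = "degree (Irr K \<theta>)"
  have "x \<in> (\<lambda>p. eval p \<theta>) ` {p \<in> carrier (K[X]). length p \<le> ?n}"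
    using x(1) Span_exp_base[OF K \<theta>] Span_eq_eval_img[OF K \<theta>(1), of ?n] M by simp
  then obtain p where p: "p \<in> carrier (K[X])" "length p \<le> ?n" "x = eval p \<theta>" by auto
  have pK: "set p \<subseteq> K" using set_poly_subset[OF p(1)] .
  have val: "eval p y = x" if y: "y \<in> zeros (Irr K \<theta>)" for y
  proof -
    have yR: "y \<in> carrier R" "eval (Irr K \<theta>) y = \<zero>" using y by (auto simp: zeros_def)
    have id: "id \<in> ring_hom (R\<lparr>carrier := K\<rparr>) R"
      using subringE(1)[OF K'] by (auto intro!: ring_hom_memI)
    obtain h where h: "h \<in> ring_hom (R\<lparr>carrier := M\<rparr>) R" "\<And>k. k \<in> K \<Longrightarrow> h k = k" "h \<theta> = y"
      using hom_extends_to_simple_extension[OF field_axioms K id \<theta> yR(1)] yR(2) M by auto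
    have ev: "h (eval q \<theta>) = eval q y" if "set q \<subseteq> K" for q
    proof -
      have "map h q = q" using h(2) that by (intro map_idI) auto
      then show ?thesis using hom_eval[OF ring_axioms MS(1) h(1) _ MS(3), of q] that MS(2) h(3) by auto
    qed
    have "h w \<in> M" if w: "w \<in> M" for w
    proof -
      obtain q where q: "set q \<subseteq> K" "w = eval q \<theta>"
        using simple_extension_obtain_list[OF K' \<theta>(1)] w M by blast
      show ?thesis using ev[OF q(1)] eval_mem_subring[OF MS(1), of q y] q MS(2) y z by auto
    qed
    then have "restrict h M \<in> gal K M" using restrict_mem_gal[OF MS(1,2) h(1,2)] by blast
    then have "h x = x" using x by fastforce
    then show ?thesis using ev[OF pK] p(3) by simp
  qed
  show "x \<in> K"
  proof (cases "length p \<le> 1")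
    case True
    then consider "p = []" | k where "p = [k]" by (metis One_nat_def length_0_conv le_Suc_eq length_Suc_conv le_zero_eq)
    then show ?thesis
    proof cases
      case 1 then show ?thesis using p(3) subringE(2)[OF K'] by simp
    next
      case 2
      then have "k \<in> K" "k \<in> carrier R" using pK subringE(1)[OF K'] by auto
      then show ?thesis using p(3) 2 \<theta>(1) by simp
    qed
  next
    case False
    then have pne: "p \<noteq> []" by auto
    then obtain q b where qb: "p = q @ [b]" by (metis rev_exhaust)
    have q0: "q \<noteq> []" using False qb by auto
    have qR: "set q \<subseteq> carrier R" "b \<in> carrier R" using pK qb subringE(1)[OF K'] by auto
    let ?q = "q @ [b \<ominus> x]"
    have "hd p \<noteq> \<zero>" using p(1) pne by (simp add: univ_poly_carrier[symmetric] polynomial_def)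
    then have "hd ?q \<noteq> \<zero>" using q0 qb by simp
    then have qc: "?q \<in> carrier (poly_ring R)"
      using qR xR by (auto simp: univ_poly_carrier[symmetric] polynomial_def)
    have "zeros (Irr K \<theta>) \<subseteq> zeros ?q"
    proof
      fix y assume y: "y \<in> zeros (Irr K \<theta>)"
      then have yR: "y \<in> carrier R" by (simp add: zeros_def)
      have e: "eval q y \<in> carrier R" using eval_in_carrier qR yR by auto
      have "eval ?q y = (eval q y \<otimes> y \<oplus> b) \<ominus> x"
        using eval_append_aux[OF qR(1) _ yR, of "b \<ominus> x"] e qR xR yR by (simp add: a_minus_def a_assoc)
      also have "\<dots> = x \<ominus> x" using val[OF y] eval_append_aux[OF qR yR] qb by simp
      finally show "y \<in> zeros ?q" using yR xR by (simp add: zeros_def)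
    qed
    then have "card (zeros (Irr K \<theta>)) \<le> degree ?q"
      using finite_zeros[OF qc] card_mono[of "zeros ?q"] by (meson append_is_Nil_conv le_trans not_Cons_self2)
    moreover have "card (zeros (Irr K \<theta>)) = ?n" using s by (simp add: splits_simply_def)
    ultimately show ?thesis using p(2) qb q0 by (cases q) auto
  qed
qed

text \<open>The minimal polynomial of \<open>y\<close> over \<open>N\<close> is an irreducible factor of \<open>f\<close>, hence linear.\<close>

lemma splitted_imp_roots_mem:
  assumes N: "subfield N R" and f: "f \<in> carrier (N[X])" "f \<noteq> []"
    and spl: "ring.splitted (R\<lparr>carrier := N\<rparr>) f" and y: "y \<in> carrier R" "eval f y = \<zero>"
  shows "y \<in> N"
proof -
  have ya: "(algebraic over N) y" using algebraicI[OF f y(2)] by (simp add: over_def)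
  interpret N: field "R\<lparr>carrier := N\<rparr>" using subfield_iff(2)[OF N] .
  note I = IrrE[OF N y(1) ya]
  have UP: "univ_poly (R\<lparr>carrier := N\<rparr>) N = N[X]" using univ_poly_consistent[OF subfieldE(1)[OF N]] by simp
  have "Irr N y pdivides f" using Irr_minimal[OF N y(1) ya f(1) y(2)] .
  then have "Irr N y divides\<^bsub>N[X]\<^esub> f" using pdivides_iff_shell[OF N I(1) f(1)] by simp
  then have "Irr N y pdivides\<^bsub>R\<lparr>carrier := N\<rparr>\<^esub> f" by (simp add: pdivides_def UP)
  then have "degree (Irr N y) = 1"
    using N.splitted_imp_trivial_factors[of f "Irr N y"] f spl I(1,2) UP by simp
  then show ?thesis using Irr_degree_one_imp_mem[OF N y(1) ya] by simp
qed

end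

text \<open>A separable polynomial has simple roots since it is coprime to its derivative, and it splits over
  a separably closed field. Together these are what the Galois theory of such a field rests on.\<close>

locale separable_closure = field R for R (structure) +
  fixes K
  assumes base: "subfield K R"
    and algebraic: "x \<in> carrier R \<Longrightarrow> (algebraic over K) x"
    and Irr_splits_simply: "x \<in> carrier R \<Longrightarrow> splits_simply (Irr K x)"

lemma separable_closure_ofD:
  assumes "separable_closure_of F K"
  shows "separable_closure F K"
proof -
  interpret field F using assms by (simp add: separable_closure_of_def)
  have K: "subfield K F" and sep: "separable_extension F K (carrier F)" and c: "separably_closed F"
    using assms by (auto simp: separable_closure_of_def)
  have alg: "(algebraic over K) x" and sp: "separable_poly F K (Irr K x)" if "x \<in> carrier F" for x
    using sep that by (auto simp: separable_extension_def over_def)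
  show ?thesis
  proof (intro separable_closure.intro separable_closure_axioms.intro field_axioms)
    fix x assume x: "x \<in> carrier F"
    show "(algebraic over K) x" using alg[OF x] .
    show "splits_simply (Irr K x)"
      using separably_closed_splits_simply[OF c subfieldE(1)[OF K] sp[OF x]]
        pirreducibleE(1)[OF subfieldE(1)[OF K]] IrrE[OF K x alg[OF x]] by blast
  qed (rule K)
qed

context separable_closure
begin

lemma K_subring: "subring K R" using subfieldE(1)[OF base] .

lemma Irr_poly: "x \<in> carrier R \<Longrightarrow> Irr K x \<in> carrier (K[X])"
  and Irr_root: "x \<in> carrier R \<Longrightarrow> eval (Irr K x) x = \<zero>"
  and Irr_nonzero: "x \<in> carrier R \<Longrightarrow> Irr K x \<noteq> []"
  using IrrE[OF base _ algebraic] pirreducibleE(1)[OF K_subring] by blast+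

lemma zeros_list:
  assumes x: "x \<in> carrier R"
  obtains zs where "set zs = zeros (Irr K x)" "set zs \<subseteq> carrier R"
proof -
  have "finite (zeros (Irr K x))"
    using finite_zeros(1) Irr_splits_simply[OF x] by (auto simp: splits_simply_def)
  then show ?thesis using that finite_list[of "zeros (Irr K x)"] by (auto simp: zeros_def)
qed

text \<open>The field generated by all conjugates of an element is normal: a homomorphism over \<open>K\<close>
  permutes these conjugates.\<close>

lemma conjugate_field_normal:
  assumes a: "a \<in> carrier R" and zs: "set zs = zeros (Irr K a)" and N: "N = finite_extension K zs"
    and x: "x \<in> N" and y: "y \<in> zeros (Irr K x)"
  shows "\<exists>g \<in> gal K N. g x = y"
proof -
  have zsR: "set zs \<subseteq> carrier R" using zs by (auto simp: zeros_def)
  have Nf: "subfield N R" "finite_dimension K N"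
    using finite_extension_is_subfield[OF base zsR] finite_extension_finite_dimension(1)[OF base zsR]
      algebraic zsR N by auto
  note N' = subfieldE(1)[OF Nf(1)]
  have KN: "K \<subseteq> N" "set zs \<subseteq> N"
    using finite_extension_incl[OF subringE(1)[OF K_subring] zsR] finite_extension_mem[OF K_subring zsR] N by auto
  have NR: "\<And>u. u \<in> N \<Longrightarrow> u \<in> carrier R" using subringE(1)[OF N'] by auto
  obtain \<eta> where \<eta>: "\<eta> \<in> N" "N = simple_extension K \<eta>"
    using primitive_element[OF base Nf(1) KN(1) Nf(2)] Irr_splits_simply NR by blast
  note xR = NR[OF x]
  let ?K1 = "simple_extension K x"
  have K1: "subfield ?K1 R" using simple_extension_is_subfield[OF base xR] algebraic[OF xR] by simp
  have KK1: "K \<subseteq> ?K1" "x \<in> ?K1" "?K1 \<subseteq> N"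
    using simple_extension_incl[OF subringE(1)[OF K_subring] xR] simple_extension_mem[OF K_subring xR]
      simple_extension_subring_incl[OF N' KN(1) x] by auto
  have id: "id \<in> ring_hom (R\<lparr>carrier := K\<rparr>) R"
    using subringE(1)[OF K_subring] by (auto intro!: ring_hom_memI)
  have yR: "y \<in> carrier R" "eval (Irr K x) y = \<zero>" using y by (auto simp: zeros_def)
  obtain h1 where h1: "h1 \<in> ring_hom (R\<lparr>carrier := ?K1\<rparr>) R" "\<And>k. k \<in> K \<Longrightarrow> h1 k = k" "h1 x = y"
    using hom_extends_to_simple_extension[OF field_axioms base id xR algebraic[OF xR] yR(1)] yR(2) by auto
  have "simple_extension ?K1 \<eta> = N"
    using simple_extension_subring_incl[OF N' KK1(3) \<eta>(1)] mono_simple_extension[OF KK1(1), of \<eta>] \<eta>(2) by auto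
  then obtain h where h: "h \<in> ring_hom (R\<lparr>carrier := N\<rparr>) R" "\<And>k. k \<in> ?K1 \<Longrightarrow> h k = h1 k"
    using hom_extends_to_splitting_element[OF base K1 KK1(1) NR[OF \<eta>(1)] algebraic[OF NR[OF \<eta>(1)]]
        Irr_splits_simply[OF NR[OF \<eta>(1)]] h1(1,2)] by metis
  have hK: "h k = k" if "k \<in> K" for k using h(2) h1(2) that KK1(1) by auto
  note hE = ring_hom_memE[OF h(1)]
  have "subring {u \<in> N. h u \<in> N} R"
  proof (rule subringI)
    show "{u \<in> N. h u \<in> N} \<subseteq> carrier R" using NR by auto
    show "\<one> \<in> {u \<in> N. h u \<in> N}" using hE(4) subringE(3)[OF N'] by simp
    have m1: "\<ominus> \<one> \<in> K" using subringE(3,5)[OF K_subring] by auto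
    fix u v assume uv: "u \<in> {u \<in> N. h u \<in> N}" "v \<in> {u \<in> N. h u \<in> N}"
    show "u \<otimes> v \<in> {u \<in> N. h u \<in> N}" "u \<oplus> v \<in> {u \<in> N. h u \<in> N}"
      using hE(2,3)[of u v] uv subringE(6,7)[OF N'] by auto
  next
    fix u assume u: "u \<in> {u \<in> N. h u \<in> N}"
    have m1: "\<ominus> \<one> \<in> K" using subringE(3,5)[OF K_subring] by auto
    have "h (\<ominus> \<one> \<otimes> u) = \<ominus> \<one> \<otimes> h u"
      using hE(2)[of "\<ominus> \<one>" u] hK[OF m1] u m1 KN(1) by auto
    then have "h (\<ominus> u) = \<ominus> h u" using u NR by (simp add: l_minus)
    then show "\<ominus> u \<in> {u \<in> N. h u \<in> N}" using u subringE(5)[OF N'] by auto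
  qed
  moreover have "K \<subseteq> {u \<in> N. h u \<in> N}" using hK KN(1) by auto
  moreover have "set zs \<subseteq> {u \<in> N. h u \<in> N}"
  proof
    fix u assume u: "u \<in> set zs"
    have "eval (Irr K a) (h u) = \<zero>"
      by (rule fixing_hom_root[OF N' h(1) hK KN(1) set_poly_subset[OF Irr_poly[OF a]]])
        (use u KN(2) zs in \<open>auto simp: zeros_def\<close>)
    moreover have "h u \<in> carrier R" using hE(1) u KN(2) by auto
    ultimately have "h u \<in> set zs" using zs by (simp add: zeros_def)
    then show "u \<in> {u \<in> N. h u \<in> N}" using u KN(2) by auto
  qed
  ultimately have "N \<subseteq> {u \<in> N. h u \<in> N}"
    using finite_extension_subring_incl N by blast
  then have "restrict h N \<in> gal K N" using restrict_mem_gal[OF N' KN(1) h(1) hK] by auto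
  moreover have "restrict h N x = y" using h(2)[OF KK1(2)] h1(3) x by simp
  ultimately show ?thesis by blast
qed

lemma splitted_in_subfield:
  assumes N: "subfield N R" and f: "f \<in> carrier (N[X])" "splits_simply f" "zeros f \<subseteq> N"
  shows "ring.splitted (R\<lparr>carrier := N\<rparr>) f"
proof -
  interpret N: field "R\<lparr>carrier := N\<rparr>" using subfield_iff(2)[OF N] .
  have UP: "univ_poly (R\<lparr>carrier := N\<rparr>) N = N[X]" using univ_poly_consistent[OF subfieldE(1)[OF N]] by simp
  have "N.zeros f = zeros f"
    using f(3) subfieldE(3)[OF N] eval_consistent[OF subfieldE(1)[OF N]] by (auto simp: zeros_def N.zeros_def)
  then have "N.splits_simply f" using f UP by (simp add: splits_simply_def N.splits_simply_def)
  then show ?thesis using N.splits_simply_iff[of f] by (auto simp: N.splits_simply_def)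
qed

end

text \<open>So the Galois closure of \<open>L = K(a)\<close> is generated by the conjugates of \<open>a\<close>: this field is
  one of the Galois extensions in the intersection, and it is contained in all the others.\<close>

theorem galois_closure_eq_conjugate_field:
  assumes sc: "separable_closure_of F K" and L: "finite_separable_extension F K L"
  obtains a zs where "a \<in> L" "L = ring.simple_extension F K a" "set zs = ring.zeros F (ring.Irr F K a)"
    "galois_closure F K L = ring.finite_extension F K zs"
proof -
  interpret separable_closure F K using separable_closure_ofD[OF sc] .
  have Lf: "subfield L F" "finite_dimension K L" "K \<subseteq> L"
    using L by (auto simp: finite_separable_extension_def separable_extension_def)
  have LR: "\<And>u. u \<in> L \<Longrightarrow> u \<in> carrier F" using subfieldE(3)[OF Lf(1)] by auto
  obtain a where a: "a \<in> L" "L = simple_extension K a"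
    using primitive_element[OF base Lf(1,3,2)] Irr_splits_simply LR by blast
  note aR = LR[OF a(1)]
  obtain zs where zs: "set zs = zeros (Irr K a)" "set zs \<subseteq> carrier F" using zeros_list[OF aR] .
  define N where "N = finite_extension K zs"
  have Nf: "subfield N F" "finite_dimension K N"
    using finite_extension_is_subfield[OF base zs(2)] finite_extension_finite_dimension(1)[OF base zs(2)]
      algebraic zs(2) N_def by auto
  note N' = subfieldE(1)[OF Nf(1)]
  have KN: "K \<subseteq> N" "set zs \<subseteq> N"
    using finite_extension_incl[OF subringE(1)[OF K_subring] zs(2)] finite_extension_mem[OF K_subring zs(2)]
      N_def by auto
  have NR: "\<And>u. u \<in> N \<Longrightarrow> u \<in> carrier F" using subringE(1)[OF N'] by auto
  have "a \<in> N" using zs(1) KN(2) Irr_root[OF aR] aR by (auto simp: zeros_def)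
  then have LN: "L \<subseteq> N" using simple_extension_subring_incl[OF N' KN(1)] a(2) by simp
  have "ring.splitted (F\<lparr>carrier := N\<rparr>) (Irr K x)" if x: "x \<in> N" for x
  proof (rule splitted_in_subfield[OF Nf(1)])
    show "Irr K x \<in> carrier (N[X]\<^bsub>F\<^esub>)"
      using Irr_poly[OF NR[OF x]] KN(1) by (auto simp: univ_poly_carrier[symmetric] polynomial_def)
    show "splits_simply (Irr K x)" using Irr_splits_simply[OF NR[OF x]] .
    show "zeros (Irr K x) \<subseteq> N"
    proof
      fix y assume y: "y \<in> zeros (Irr K x)"
      obtain g where "g \<in> gal K N" "g x = y" using conjugate_field_normal[OF aR zs(1) N_def x y] by blast
      then show "y \<in> N" using x by (auto simp: gal_def dest: ring_hom_memE(1))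
    qed
  qed
  moreover have "separable_extension F K N"
    using sc NR KN(1) by (auto simp: separable_closure_of_def separable_extension_def)
  ultimately have "finite_galois_extension F K N"
    using base Nf by (auto simp: finite_galois_extension_def finite_separable_extension_def)
  then have 1: "galois_closure F K L \<subseteq> N" using LN by (auto simp: galois_closure_def)
  have "N \<subseteq> N'" if N': "finite_galois_extension F K N'" "L \<subseteq> N'" for N'
  proof -
    have f: "subfield N' F" "K \<subseteq> N'" "ring.splitted (F\<lparr>carrier := N'\<rparr>) (Irr K a)"
      using N' a(1) by (auto simp: finite_galois_extension_def finite_separable_extension_def separable_extension_def)
    have p: "Irr K a \<in> carrier (N'[X]\<^bsub>F\<^esub>)"
      using Irr_poly[OF aR] f(2) by (auto simp: univ_poly_carrier[symmetric] polynomial_def)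
    have "set zs \<subseteq> N'"
      using splitted_imp_roots_mem[OF f(1) p Irr_nonzero[OF aR] f(3)] zs(1) by (auto simp: zeros_def)
    then show ?thesis
      using finite_extension_subring_incl[OF subfieldE(1)[OF f(1)] f(2)] N_def by simp
  qed
  then have "N \<subseteq> galois_closure F K L" by (auto simp: galois_closure_def)
  then show ?thesis using that[OF a zs(1)] 1 N_def by auto
qed

section \<open>Sums, products and primes in subrings\<close>

context abelian_monoid
begin

lemma finsum_group:
  assumes A: "finite A" and Y: "finite Y" "r ` A \<subseteq> Y" and f: "\<And>a. a \<in> A \<Longrightarrow> f a \<in> carrier G"
  shows "finsum G f A = (\<Oplus>y \<in> Y. finsum G f {a \<in> A. r a = y})"
proof -
  have "finsum G f {a \<in> A. r a \<in> Y} = (\<Oplus>y \<in> Y. finsum G f {a \<in> A. r a = y})"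
    using Y(1)
  proof (induct Y)
    case (insert y Y)
    have "{a \<in> A. r a \<in> insert y Y} = {a \<in> A. r a = y} \<union> {a \<in> A. r a \<in> Y}" by auto
    moreover have "{a \<in> A. r a = y} \<inter> {a \<in> A. r a \<in> Y} = {}" using insert.hyps(2) by auto
    ultimately have "finsum G f {a \<in> A. r a \<in> insert y Y}
        = finsum G f {a \<in> A. r a = y} \<oplus> finsum G f {a \<in> A. r a \<in> Y}"
      using A f by (simp add: finsum_Un_disjoint Pi_def)
    then show ?case
      using insert f by (simp add: finsum_insert finsum_closed Pi_def)
  qed simp
  moreover have "{a \<in> A. r a \<in> Y} = A" using Y(2) by auto
  ultimately show ?thesis by simp
qed

lemma finsum_mem:
  assumes "\<zero> \<in> P" "\<And>x y. x \<in> P \<Longrightarrow> y \<in> P \<Longrightarrow> x \<oplus> y \<in> P" "P \<subseteq> carrier G"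
    and f: "\<And>i. i \<in> I \<Longrightarrow> f i \<in> P"
  shows "finsum G f I \<in> P"
  using f
proof (induct I rule: infinite_finite_induct)
  case (insert i I)
  then have "finsum G f (insert i I) = f i \<oplus> finsum G f I"
    using assms(3) by (intro finsum_insert) auto
  then show ?case using insert assms(2) by simp
qed (use assms(1) in \<open>auto simp: finsum_infinite\<close>)

end

context comm_monoid
begin

lemma finprod_mem:
  assumes "\<one> \<in> P" "\<And>x y. x \<in> P \<Longrightarrow> y \<in> P \<Longrightarrow> x \<otimes> y \<in> P" "P \<subseteq> carrier G"
    and f: "\<And>i. i \<in> I \<Longrightarrow> f i \<in> P"
  shows "finprod G f I \<in> P"
  using f
proof (induct I rule: infinite_finite_induct)
  case (insert i I)
  then have "finprod G f (insert i I) = f i \<otimes> finprod G f I"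
    using assms(3) by (intro finprod_insert) auto
  then show ?case using insert assms(2) by simp
qed (use assms(1) in auto)

end

text \<open>Primality of an ideal \<open>P\<close> of the subring \<open>T\<close>, expressed in the ambient ring.\<close>

definition (in ring) prime_in :: "'a set \<Rightarrow> 'a set \<Rightarrow> bool" where
  "prime_in T P \<longleftrightarrow> P \<subseteq> T \<and> \<zero> \<in> P \<and> \<one> \<notin> P \<and> (\<forall>x \<in> P. \<forall>y \<in> P. x \<oplus> y \<in> P)
     \<and> (\<forall>t \<in> T. \<forall>x \<in> P. t \<otimes> x \<in> P) \<and> (\<forall>x \<in> T. \<forall>y \<in> T. x \<otimes> y \<in> P \<longrightarrow> x \<in> P \<or> y \<in> P)"

context cring
begin

lemma prime_in_iff:
  assumes T: "subring T R"
  shows "primeideal P (R\<lparr>carrier := T\<rparr>) \<longleftrightarrow> prime_in T P"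
proof
  note TE = subringE[OF T]
  assume "primeideal P (R\<lparr>carrier := T\<rparr>)"
  then interpret P: primeideal P "R\<lparr>carrier := T\<rparr>" .
  have sub: "P \<subseteq> T" using P.a_subset by simp
  have "\<one> \<notin> P"
  proof
    assume "\<one> \<in> P"
    then have "t \<in> P" if "t \<in> T" for t
      using P.I_r_closed[of \<one> t] that TE(1) by auto
    then show False using P.I_notcarr sub by auto
  qed
  then show "prime_in T P"
    using sub additive_subgroup.zero_closed[OF P.additive_subgroup_axioms]
      additive_subgroup.a_closed[OF P.additive_subgroup_axioms] P.I_l_closed P.I_prime
    by (simp add: prime_in_def)
next
  note TE = subringE[OF T]
  assume P: "prime_in T P"
  have cr: "cring (R\<lparr>carrier := T\<rparr>)"
    using subcringI[OF T] TE(1) m_comm subcring_iff[OF TE(1)] by blast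
  interpret T: cring "R\<lparr>carrier := T\<rparr>" by (rule cr)
  have neg: "\<ominus> x = (\<ominus> \<one>) \<otimes> x" if "x \<in> P" for x
    using that P TE(1) by (auto simp: prime_in_def l_minus)
  have "subgroup P (add_monoid (R\<lparr>carrier := T\<rparr>))"
  proof (rule T.add.subgroupI)
    show "P \<subseteq> carrier (R\<lparr>carrier := T\<rparr>)" "P \<noteq> {}" using P by (auto simp: prime_in_def)
    fix x assume x: "x \<in> P"
    have "\<ominus>\<^bsub>R\<lparr>carrier := T\<rparr>\<^esub> x = \<ominus> x"
    proof (rule T.minus_equality)
      show "\<ominus> x \<oplus>\<^bsub>R\<lparr>carrier := T\<rparr>\<^esub> x = \<zero>\<^bsub>R\<lparr>carrier := T\<rparr>\<^esub>"
        using x P TE(1) by (auto simp: prime_in_def l_neg)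
    qed (use x P TE(5) in \<open>auto simp: prime_in_def\<close>)
    moreover have "\<ominus> x \<in> P" using neg[OF x] x P TE(3,5) by (auto simp: prime_in_def)
    ultimately show "\<ominus>\<^bsub>R\<lparr>carrier := T\<rparr>\<^esub> x \<in> P" by simp
  qed (use P in \<open>auto simp: prime_in_def\<close>)
  then have "ideal P (R\<lparr>carrier := T\<rparr>)"
  proof (rule idealI[OF T.ring_axioms])
    fix a x assume ax: "a \<in> P" "x \<in> carrier (R\<lparr>carrier := T\<rparr>)"
    then have "a \<otimes> x = x \<otimes> a" using P TE(1) by (intro m_comm) (auto simp: prime_in_def)
    then show "x \<otimes>\<^bsub>R\<lparr>carrier := T\<rparr>\<^esub> a \<in> P" "a \<otimes>\<^bsub>R\<lparr>carrier := T\<rparr>\<^esub> x \<in> P"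
      using ax P by (auto simp: prime_in_def)
  qed
  then show "primeideal P (R\<lparr>carrier := T\<rparr>)"
  proof (rule primeidealI[OF _ cr])
    show "carrier (R\<lparr>carrier := T\<rparr>) \<noteq> P" using P TE(3) by (auto simp: prime_in_def)
  qed (use P in \<open>auto simp: prime_in_def\<close>)
qed

end

locale subring_prime = domain R for R (structure) +
  fixes T P
  assumes T: "subring T R" and P: "prime_in T P"
begin

lemmas TE = subringE[OF T]

lemma T_carrier: "x \<in> T \<Longrightarrow> x \<in> carrier R" using TE(1) by auto

lemma P_T: "x \<in> P \<Longrightarrow> x \<in> T"
  and P_zero: "\<zero> \<in> P"
  and P_one: "\<one> \<notin> P"
  and P_add: "x \<in> P \<Longrightarrow> y \<in> P \<Longrightarrow> x \<oplus> y \<in> P"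
  and P_mult: "t \<in> T \<Longrightarrow> x \<in> P \<Longrightarrow> t \<otimes> x \<in> P"
  and P_prime: "x \<in> T \<Longrightarrow> y \<in> T \<Longrightarrow> x \<otimes> y \<in> P \<Longrightarrow> x \<in> P \<or> y \<in> P"
  using P by (auto simp: prime_in_def)

lemma P_carrier: "x \<in> P \<Longrightarrow> x \<in> carrier R" using P_T T_carrier by auto

lemma P_mult': "x \<in> P \<Longrightarrow> t \<in> T \<Longrightarrow> x \<otimes> t \<in> P"
  using P_mult m_comm P_carrier T_carrier by metis

lemma P_neg: "x \<in> P \<Longrightarrow> \<ominus> x \<in> P"
  using P_mult[of "\<ominus> \<one>" x] TE(3,5) P_carrier[of x] by (simp add: l_minus)

lemma P_minus: "x \<in> P \<Longrightarrow> y \<in> P \<Longrightarrow> x \<ominus> y \<in> P"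
  using P_add P_neg by (simp add: a_minus_def)

lemma T_minus: "x \<in> T \<Longrightarrow> y \<in> T \<Longrightarrow> x \<ominus> y \<in> T"
  using TE(5,7) by (simp add: a_minus_def)

lemma P_sum: "(\<And>i. i \<in> I \<Longrightarrow> f i \<in> P) \<Longrightarrow> finsum R f I \<in> P"
  using finsum_mem[of P I f] P_zero P_add P_carrier by blast

lemma T_sum: "(\<And>i. i \<in> I \<Longrightarrow> f i \<in> T) \<Longrightarrow> finsum R f I \<in> T"
  using finsum_mem[of T I f] TE by blast

lemma T_prod: "(\<And>i. i \<in> I \<Longrightarrow> f i \<in> T) \<Longrightarrow> finprod R f I \<in> T"
  using finprod_mem[of T I f] TE by blast

lemma T_pow: "x \<in> T \<Longrightarrow> x [^] (n::nat) \<in> T"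
  by (induct n) (use TE in auto)

lemma P_pow: "x \<in> T \<Longrightarrow> x [^] (n::nat) \<in> P \<Longrightarrow> x \<in> P"
proof (induct n)
  case (Suc n)
  then show ?case using P_prime[of "x [^] n" x] T_pow by auto
qed (use P_one in simp)

lemma diff_trans:
  assumes "x \<ominus> y \<in> P" "y \<ominus> z \<in> P" "x \<in> T" "y \<in> T" "z \<in> T"
  shows "x \<ominus> z \<in> P"
proof -
  have "x \<ominus> z = (x \<ominus> y) \<oplus> (y \<ominus> z)"
    using assms T_carrier by (simp add: a_minus_def a_assoc r_neg1)
  then show ?thesis using P_add assms(1,2) by simp
qed

lemma diff_sym: "x \<ominus> y \<in> P \<Longrightarrow> x \<in> T \<Longrightarrow> y \<in> T \<Longrightarrow> y \<ominus> x \<in> P"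
  using P_neg[of "x \<ominus> y"] T_carrier by (simp add: a_minus_def minus_add a_comm)

lemma diff_mem_iff: "x \<ominus> y \<in> P \<Longrightarrow> x \<in> T \<Longrightarrow> y \<in> T \<Longrightarrow> x \<in> P \<longleftrightarrow> y \<in> P"
proof -
  assume a: "x \<ominus> y \<in> P" "x \<in> T" "y \<in> T"
  have "x = (x \<ominus> y) \<oplus> y" using a T_carrier by (simp add: a_minus_def a_assoc l_neg)
  moreover have "y = x \<ominus> (x \<ominus> y)" using a T_carrier by (simp add: a_minus_def minus_add r_neg2)
  ultimately show ?thesis using a(1) P_add P_minus by metis
qed

lemma diff_sum:
  assumes "\<And>i. i \<in> I \<Longrightarrow> f i \<in> T" "\<And>i. i \<in> I \<Longrightarrow> g i \<in> T" "\<And>i. i \<in> I \<Longrightarrow> f i \<ominus> g i \<in> P"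
  shows "finsum R f I \<ominus> finsum R g I \<in> P"
  using assms
proof (induct I rule: infinite_finite_induct)
  case (insert i I)
  have c: "f i \<in> carrier R" "g i \<in> carrier R" "finsum R f I \<in> carrier R" "finsum R g I \<in> carrier R"
    using insert.prems T_carrier by (auto intro!: finsum_closed)
  have "finsum R f (insert i I) \<ominus> finsum R g (insert i I)
      = (f i \<ominus> g i) \<oplus> (finsum R f I \<ominus> finsum R g I)"
    using insert c T_carrier by (simp add: finsum_insert Pi_def a_minus_def minus_add a_ac)
  then show ?case using insert P_add by simp
qed (use P_zero in \<open>auto simp: finsum_infinite a_minus_def\<close>)

text \<open>Dedekind's linear independence of characters, over \<open>T/P\<close>. A relation at \<open>ab\<close> minus \<open>\<psi>(b)\<close> times
  the relation at \<open>a\<close> eliminates \<open>\<psi>\<close>, and \<open>b\<close> can be chosen with \<open>\<chi>(b) \<noteq> \<psi>(b)\<close> in \<open>T/P\<close> for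
  any other given \<open>\<chi>\<close>.\<close>

theorem dedekind_independence:
  assumes fin: "finite C"
    and A: "e \<in> A" "\<And>a b. a \<in> A \<Longrightarrow> b \<in> A \<Longrightarrow> mul a b \<in> A"
    and C: "\<And>\<chi> a. \<chi> \<in> C \<Longrightarrow> a \<in> A \<Longrightarrow> \<chi> a \<in> T" "\<And>\<chi>. \<chi> \<in> C \<Longrightarrow> \<chi> e = \<one>"
      "\<And>\<chi> a b. \<chi> \<in> C \<Longrightarrow> a \<in> A \<Longrightarrow> b \<in> A \<Longrightarrow> \<chi> (mul a b) = \<chi> a \<otimes> \<chi> b"
    and sep: "\<And>\<chi> \<psi>. \<chi> \<in> C \<Longrightarrow> \<psi> \<in> C \<Longrightarrow> \<chi> \<noteq> \<psi> \<Longrightarrow> \<exists>a \<in> A. \<chi> a \<ominus> \<psi> a \<notin> P"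
    and c: "\<And>\<chi>. \<chi> \<in> C \<Longrightarrow> c \<chi> \<in> T" "\<And>a. a \<in> A \<Longrightarrow> (\<Oplus>\<chi> \<in> C. c \<chi> \<otimes> \<chi> a) \<in> P"
  shows "\<forall>\<chi> \<in> C. c \<chi> \<in> P"
  using fin C sep c
proof (induct C arbitrary: c)
  case (insert \<psi> C)
  note C = insert.prems(1-3) and sep = insert.prems(4) and c = insert.prems(5,6)
  have old: "c \<chi> \<in> P" if \<chi>: "\<chi> \<in> C" for \<chi>
  proof -
    obtain b where b: "b \<in> A" "\<chi> b \<ominus> \<psi> b \<notin> P"
      using sep[of \<chi> \<psi>] \<chi> insert.hyps(2) by auto
    define d where "d \<phi> = c \<phi> \<otimes> (\<phi> b \<ominus> \<psi> b)" for \<phi>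
    have dT: "d \<phi> \<in> T" if "\<phi> \<in> C" for \<phi>
      unfolding d_def using TE(6) T_minus c(1) C(1) b(1) that by auto
    have "(\<Oplus>\<phi> \<in> C. d \<phi> \<otimes> \<phi> a) \<in> P" if a: "a \<in> A" for a
    proof -
      have cl: "\<phi> a \<in> carrier R" "\<phi> b \<in> carrier R" "c \<phi> \<in> carrier R" if "\<phi> \<in> insert \<psi> C" for \<phi>
        using T_carrier C(1) c(1) a b(1) that by auto
      have cm: "\<phi> (mul a b) \<in> carrier R" if "\<phi> \<in> insert \<psi> C" for \<phi>
        using T_carrier C(1)[OF that A(2)[OF a b(1)]] .
      let ?s = "\<lambda>a. \<Oplus>\<phi> \<in> insert \<psi> C. c \<phi> \<otimes> \<phi> a"
      have "?s (mul a b) \<oplus> (\<ominus> \<psi> b) \<otimes> ?s a \<in> P"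
        using P_add P_mult TE(5) C(1) b(1) a c(2) A(2) by auto
      moreover have "(\<Oplus>\<phi> \<in> C. d \<phi> \<otimes> \<phi> a) = ?s (mul a b) \<oplus> (\<ominus> \<psi> b) \<otimes> ?s a"
      proof -
        have tm: "c \<phi> \<otimes> \<phi> (mul a b) \<oplus> (\<ominus> \<psi> b) \<otimes> (c \<phi> \<otimes> \<phi> a) = d \<phi> \<otimes> \<phi> a"
          if "\<phi> \<in> insert \<psi> C" for \<phi>
          using that cl[OF that] cl(2)[of \<psi>] C(3)[OF that a b(1)]
          by (simp add: d_def a_minus_def l_distr r_distr l_minus r_minus m_ac)
        have "?s (mul a b) \<oplus> (\<ominus> \<psi> b) \<otimes> ?s a
            = (\<Oplus>\<phi> \<in> insert \<psi> C. c \<phi> \<otimes> \<phi> (mul a b) \<oplus> (\<ominus> \<psi> b) \<otimes> (c \<phi> \<otimes> \<phi> a))"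
          using insert.hyps(1) cl cm cl(2)[of \<psi>]
          by (subst finsum_addf) (auto simp: finsum_rdistr)
        also have "\<dots> = (\<Oplus>\<phi> \<in> insert \<psi> C. d \<phi> \<otimes> \<phi> a)"
          using tm cl by (intro finsum_cong') (auto simp: d_def)
        also have "\<dots> = d \<psi> \<otimes> \<psi> a \<oplus> (\<Oplus>\<phi> \<in> C. d \<phi> \<otimes> \<phi> a)"
          using insert.hyps cl by (intro finsum_insert) (auto simp: d_def)
        also have "d \<psi> \<otimes> \<psi> a = \<zero>" using cl[of \<psi>] by (simp add: d_def a_minus_def r_neg)
        finally show ?thesis using cl by (auto simp: d_def)
      qed
      ultimately show ?thesis by simp
    qed
    then have "\<forall>\<phi> \<in> C. d \<phi> \<in> P"
      using insert.hyps(3)[of d] C sep dT by auto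
    then have "c \<chi> \<otimes> (\<chi> b \<ominus> \<psi> b) \<in> P" using \<chi> by (simp add: d_def)
    then show ?thesis using P_prime[of "c \<chi>" "\<chi> b \<ominus> \<psi> b"] b c(1) C(1) \<chi> T_minus by auto
  qed
  have "c \<phi> \<otimes> \<phi> e \<in> T" if "\<phi> \<in> insert \<psi> C" for \<phi> using that c(1) C(1)[of \<phi> e] A(1) TE(6) by auto
  then have "c \<psi> \<otimes> \<psi> e \<oplus> (\<Oplus>\<phi> \<in> C. c \<phi> \<otimes> \<phi> e) \<in> P"
    using c(2)[OF A(1)] insert.hyps T_carrier by (simp add: finsum_insert Pi_def)
  moreover have "(\<Oplus>\<phi> \<in> C. c \<phi> \<otimes> \<phi> e) \<in> P"
    using old P_mult' C(1) A(1) by (intro P_sum) auto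
  ultimately have "(c \<psi> \<otimes> \<psi> e \<oplus> (\<Oplus>\<phi> \<in> C. c \<phi> \<otimes> \<phi> e)) \<ominus> (\<Oplus>\<phi> \<in> C. c \<phi> \<otimes> \<phi> e) \<in> P"
    by (rule P_minus)
  moreover have "(\<Oplus>\<phi> \<in> C. c \<phi> \<otimes> \<phi> e) \<in> carrier R" "c \<psi> \<in> carrier R" "\<psi> e = \<one>"
    using \<open>(\<Oplus>\<phi> \<in> C. c \<phi> \<otimes> \<phi> e) \<in> P\<close> P_carrier c(1) T_carrier C(2) by auto
  ultimately have "c \<psi> \<in> P" by (simp add: a_minus_def a_assoc r_neg)
  then show ?case using old by auto
qed simp

end

section \<open>Finite groups of field automorphisms and their primes\<close>

text \<open>Inverses exist, because a finite set of injective maps that is closed under composition is a group.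
  The elements are undefined outside \<open>M\<close>, as in \<^const>\<open>ring.gal\<close>.\<close>

locale aut_group = field R for R (structure) +
  fixes M G
  assumes M: "subfield M R" and fin: "finite G"
    and hom: "g \<in> G \<Longrightarrow> g \<in> ring_hom (R\<lparr>carrier := M\<rparr>) (R\<lparr>carrier := M\<rparr>)"
    and ext: "G \<subseteq> extensional M"
    and one: "(\<lambda>x \<in> M. x) \<in> G"
    and comp: "g \<in> G \<Longrightarrow> h \<in> G \<Longrightarrow> compose M g h \<in> G"
begin

lemmas ME = subringE[OF subfieldE(1)[OF M]]

lemma M_carrier: "x \<in> M \<Longrightarrow> x \<in> carrier R" using ME(1) by auto

lemma act_closed: "g \<in> G \<Longrightarrow> x \<in> M \<Longrightarrow> g x \<in> M"
  and act_mult: "g \<in> G \<Longrightarrow> x \<in> M \<Longrightarrow> y \<in> M \<Longrightarrow> g (x \<otimes> y) = g x \<otimes> g y"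
  and act_add: "g \<in> G \<Longrightarrow> x \<in> M \<Longrightarrow> y \<in> M \<Longrightarrow> g (x \<oplus> y) = g x \<oplus> g y"
  and act_one: "g \<in> G \<Longrightarrow> g \<one> = \<one>"
  using ring_hom_memE[OF hom] by auto

lemma act_hom: "g \<in> G \<Longrightarrow> g \<in> ring_hom (R\<lparr>carrier := M\<rparr>) R"
  by (rule ring_hom_memI) (auto simp: act_closed act_mult act_add act_one M_carrier)

lemma act_zero: "g \<in> G \<Longrightarrow> g \<zero> = \<zero>"
  using hom_zero[OF ring_axioms subfieldE(1)[OF M] act_hom] .

lemma act_neg: "g \<in> G \<Longrightarrow> x \<in> M \<Longrightarrow> g (\<ominus> x) = \<ominus> g x"
  using act_add[of g "\<ominus> x" x] act_zero[of g] ME(5) M_carrier act_closed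
  by (metis l_neg minus_equality a_inv_closed)

lemma act_minus: "g \<in> G \<Longrightarrow> x \<in> M \<Longrightarrow> y \<in> M \<Longrightarrow> g (x \<ominus> y) = g x \<ominus> g y"
  using act_add act_neg ME(5) by (simp add: a_minus_def)

lemma act_inj: "g \<in> G \<Longrightarrow> x \<in> M \<Longrightarrow> y \<in> M \<Longrightarrow> g x = g y \<Longrightarrow> x = y"
  using non_trivial_field_hom_is_inj[OF hom] subfield_iff(2)[OF M] by (auto simp: inj_on_def)

lemma G_ext: "g \<in> G \<Longrightarrow> h \<in> G \<Longrightarrow> (\<And>x. x \<in> M \<Longrightarrow> g x = h x) \<Longrightarrow> g = h"
  using ext by (meson extensionalityI subset_iff)

lemma left_mult_bij:
  assumes h: "h \<in> G"
  shows "inj_on (compose M h) G" "compose M h ` G = G"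
proof -
  show inj: "inj_on (compose M h) G"
  proof (rule inj_onI)
    fix g k assume gk: "g \<in> G" "k \<in> G" "compose M h g = compose M h k"
    show "g = k"
    proof (rule G_ext[OF gk(1,2)])
      fix x assume x: "x \<in> M"
      then have "h (g x) = h (k x)" using fun_cong[OF gk(3), of x] by (simp add: compose_eq)
      then show "g x = k x" using act_inj[OF h] act_closed gk x by auto
    qed
  qed
  show "compose M h ` G = G"
    using endo_inj_surj[OF fin _ inj] comp[OF h] by auto
qed

lemma act_inverse:
  assumes h: "h \<in> G"
  obtains k where "k \<in> G" "\<And>x. x \<in> M \<Longrightarrow> h (k x) = x" "\<And>x. x \<in> M \<Longrightarrow> k (h x) = x"
proof -
  obtain k where k: "k \<in> G" "compose M h k = (\<lambda>x \<in> M. x)"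
    using left_mult_bij(2)[OF h] one by (metis imageE)
  have 1: "h (k x) = x" if "x \<in> M" for x
    using fun_cong[OF k(2), of x] that by (simp add: compose_eq)
  moreover have "k (h x) = x" if x: "x \<in> M" for x
    using act_inj[OF h, of "k (h x)" x] 1[of "h x"] act_closed h k(1) x by auto
  ultimately show ?thesis using that k(1) by blast
qed

lemma right_mult_inj:
  assumes h: "h \<in> G"
  shows "inj_on (\<lambda>g. compose M g h) G"
proof (rule inj_onI)
  fix g k assume gk: "g \<in> G" "k \<in> G" "compose M g h = compose M k h"
  obtain l where l: "l \<in> G" "\<And>x. x \<in> M \<Longrightarrow> h (l x) = x" using act_inverse[OF h] by metis
  show "g = k"
  proof (rule G_ext[OF gk(1,2)])
    fix x assume x: "x \<in> M"
    show "g x = k x"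
      using fun_cong[OF gk(3), of "l x"] act_closed[OF l(1) x] l(2)[OF x] by (simp add: compose_eq)
  qed
qed

lemma act_sum:
  assumes g: "g \<in> G" and f: "\<And>i. i \<in> I \<Longrightarrow> f i \<in> M"
  shows "g (finsum R f I) = (\<Oplus>i \<in> I. g (f i))"
  using f
proof (induct I rule: infinite_finite_induct)
  case (insert i I)
  have "finsum R f I \<in> M" using insert.prems finsum_mem[of M I f] ME by blast
  then show ?case
    using insert g act_add[OF g, of "f i" "finsum R f I"] M_carrier act_closed[OF g]
    by (simp add: finsum_insert Pi_def)
qed (use g in \<open>auto simp: finsum_infinite act_zero\<close>)

lemma act_prod:
  assumes g: "g \<in> G" and f: "\<And>i. i \<in> I \<Longrightarrow> f i \<in> M"
  shows "g (finprod R f I) = (\<Otimes>i \<in> I. g (f i))"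
  using f
proof (induct I rule: infinite_finite_induct)
  case (insert i I)
  have "finprod R f I \<in> M" using insert.prems finprod_mem[of M I f] ME by blast
  then show ?case
    using insert g act_mult[OF g, of "f i" "finprod R f I"] M_carrier act_closed[OF g]
    by (simp add: Pi_def)
qed (use g in \<open>auto simp: act_one\<close>)

definition trace_sum :: "'a \<Rightarrow> 'a" where
  "trace_sum x = (\<Oplus>g \<in> G. g x)"

lemma trace_sum_fixed:
  assumes h: "h \<in> G" and x: "x \<in> M"
  shows "h (trace_sum x) = trace_sum x"
proof -
  have cl: "g x \<in> carrier R" if "g \<in> G" for g using that act_closed x M_carrier by auto
  have "h (trace_sum x) = (\<Oplus>g \<in> G. h (g x))"
    unfolding trace_sum_def by (rule act_sum[OF h]) (use act_closed x in auto)
  also have "\<dots> = (\<Oplus>g \<in> G. compose M h g x)"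
    using x by (simp add: compose_eq)
  also have "\<dots> = (\<Oplus>g \<in> compose M h ` G. g x)"
    by (rule finsum_reindex[symmetric]) (use cl left_mult_bij[OF h] in auto)
  finally show ?thesis using left_mult_bij(2)[OF h] by (simp add: trace_sum_def)
qed

end

lemma (in cring) finprod_add_expand:
  assumes "finite I" "\<And>i. i \<in> I \<Longrightarrow> a i \<in> carrier R" and z: "z \<in> carrier R"
  shows "(\<Otimes>i \<in> I. z \<oplus> a i) = (\<Oplus>B \<in> Pow I. (\<Otimes>i \<in> B. a i) \<otimes> z [^] (card I - card B))"
  using assms(1,2)
proof (induct I)
  case empty
  then show ?case using z by (simp add: finsum_singleton finsum_insert)
next
  case (insert j I)
  let ?t = "\<lambda>n B. (\<Otimes>i \<in> B. a i) \<otimes> z [^] (n - card B)"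
  have aR: "a i \<in> carrier R" if "i \<in> insert j I" for i using insert.prems that by auto
  have pR: "(\<Otimes>i \<in> B. a i) \<in> carrier R" if "B \<subseteq> insert j I" for B
    using aR that by (intro finprod_closed) auto
  have tR: "?t n B \<in> carrier R" if "B \<subseteq> insert j I" for n B using pR[OF that] z by simp
  have tR3: "?t n B \<in> carrier R" if "B \<subseteq> I" for n B
    using tR that by blast
  have tR2: "?t n (insert j B) \<in> carrier R" if "B \<subseteq> I" for n B
    using tR[OF insert_mono[OF that]] .
  have finB: "finite B" "card B \<le> card I" if "B \<in> Pow I" for B
    using that insert.hyps(1) finite_subset card_mono by auto
  have inj: "inj_on (insert j) (Pow I)" 
  proof (rule inj_onI)
    fix B C assume "B \<in> Pow I" "C \<in> Pow I" "insert j B = insert j C"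
    then show "B = C" using insert_ident[of j B C] insert.hyps(2) by auto
  qed
  have c: "card (insert j I) = Suc (card I)" using insert.hyps by simp
  have S: "(\<Oplus>B \<in> Pow I. ?t (card I) B) \<in> carrier R" using tR by (intro finsum_closed) auto
  have 1: "(\<Oplus>B \<in> Pow I. ?t (Suc (card I)) B) = z \<otimes> (\<Oplus>B \<in> Pow I. ?t (card I) B)"
  proof -
    have "z \<otimes> (\<Oplus>B \<in> Pow I. ?t (card I) B) = (\<Oplus>B \<in> Pow I. z \<otimes> ?t (card I) B)"
      using tR insert.hyps(1) z by (intro finsum_rdistr) auto
    also have "\<dots> = (\<Oplus>B \<in> Pow I. ?t (Suc (card I)) B)"
    proof (rule finsum_cong')
      fix B assume B: "B \<in> Pow I"
      have "z [^] (Suc (card I) - card B) = z [^] (card I - card B) \<otimes> z"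
        using finB(2)[OF B] by (simp add: Suc_diff_le)
      then show "z \<otimes> ?t (card I) B = ?t (Suc (card I)) B"
        using pR[OF subset_trans[OF _ subset_insertI]] B z by (auto simp: m_ac)
    qed (use tR in auto)
    finally show ?thesis by simp
  qed
  have 2: "(\<Oplus>B \<in> insert j ` Pow I. ?t (Suc (card I)) B) = a j \<otimes> (\<Oplus>B \<in> Pow I. ?t (card I) B)"
  proof -
    have "(\<Oplus>B \<in> insert j ` Pow I. ?t (Suc (card I)) B) = (\<Oplus>B \<in> Pow I. ?t (Suc (card I)) (insert j B))"
      by (rule finsum_reindex[OF _ inj]) (use tR2 in auto)
    also have "\<dots> = (\<Oplus>B \<in> Pow I. a j \<otimes> ?t (card I) B)"
    proof (rule finsum_cong')
      fix B assume B: "B \<in> Pow I"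
      have jB: "j \<notin> B" using B insert.hyps(2) by auto
      have "(\<Otimes>i \<in> insert j B. a i) = a j \<otimes> (\<Otimes>i \<in> B. a i)"
        using finB(1)[OF B] jB aR B by (intro finprod_insert) auto
      then show "?t (Suc (card I)) (insert j B) = a j \<otimes> ?t (card I) B"
        using finB(1)[OF B] jB pR[OF subset_trans[OF _ subset_insertI]] B z aR[of j]
        by (auto simp: m_assoc)
    qed (use tR3 aR in auto)
    also have "\<dots> = a j \<otimes> (\<Oplus>B \<in> Pow I. ?t (card I) B)"
      using tR3 insert.hyps(1) aR by (intro finsum_rdistr[symmetric]) auto
    finally show ?thesis .
  qed
  have "(\<Oplus>B \<in> Pow (insert j I). ?t (card (insert j I)) B)
      = (\<Oplus>B \<in> Pow I. ?t (Suc (card I)) B) \<oplus> (\<Oplus>B \<in> insert j ` Pow I. ?t (Suc (card I)) B)"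
    unfolding Pow_insert c using insert.hyps tR2 tR3 by (intro finsum_Un_disjoint) auto
  also have "\<dots> = (z \<oplus> a j) \<otimes> (\<Oplus>B \<in> Pow I. ?t (card I) B)"
    unfolding 1 2 using S z aR by (simp add: l_distr)
  also have "\<dots> = (z \<oplus> a j) \<otimes> (\<Otimes>i \<in> I. z \<oplus> a i)"
    using insert by simp
  also have "\<dots> = (\<Otimes>i \<in> insert j I. z \<oplus> a i)"
    using insert.hyps aR z by (intro finprod_insert[symmetric]) auto
  finally show ?case by simp
qed

context aut_group
begin

text \<open>The coefficient of \<open>X\<^sup>i\<close> in \<open>\<Prod>\<^sub>g (X - g x)\<close>, for \<open>i \<le> |G|\<close>.\<close>

definition norm_coeff :: "'a \<Rightarrow> nat \<Rightarrow> 'a" where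
  "norm_coeff x i = (\<Oplus>B \<in> {B. B \<subseteq> G \<and> card B = card G - i}. \<Otimes>g \<in> B. \<ominus> (g x))"

text \<open>The product \<open>\<Prod>\<^sub>g (x - g x)\<close> vanishes because of the factor of the identity.\<close>

lemma norm_equation:
  assumes x: "x \<in> M"
  shows "x [^] card G \<oplus> (\<Oplus>i \<in> {..<card G}. norm_coeff x i \<otimes> x [^] i) = \<zero>"
proof -
  let ?n = "card G"
  have xR: "x \<in> carrier R" using x M_carrier by simp
  have gR: "\<ominus> (g x) \<in> carrier R" if "g \<in> G" for g using that act_closed x M_carrier by auto
  have pR: "(\<Otimes>g \<in> B. \<ominus> (g x)) \<in> carrier R" if "B \<subseteq> G" for B
    using gR that by (intro finprod_closed) auto
  let ?t = "\<lambda>B. (\<Otimes>g \<in> B. \<ominus> (g x)) \<otimes> x [^] (?n - card B)"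
  have tR: "?t B \<in> carrier R" if "B \<subseteq> G" for B using pR[OF that] xR by simp
  have cR: "norm_coeff x i \<in> carrier R" for i
    unfolding norm_coeff_def using pR by (intro finsum_closed) auto
  have finB: "finite {B. B \<subseteq> G \<and> card B = k}" for k
    by (rule finite_subset[of _ "Pow G"]) (use fin in auto)
  have "(\<Otimes>g \<in> G. x \<oplus> \<ominus> (g x)) = \<zero>"
  proof -
    let ?e = "\<lambda>x \<in> M. x"
    have "G = insert ?e (G - {?e})" using one by auto
    then have "(\<Otimes>g \<in> G. x \<oplus> \<ominus> (g x)) = (\<Otimes>g \<in> insert ?e (G - {?e}). x \<oplus> \<ominus> (g x))" by simp
    also have "\<dots> = (x \<oplus> \<ominus> (?e x)) \<otimes> (\<Otimes>g \<in> G - {?e}. x \<oplus> \<ominus> (g x))"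
      by (rule finprod_insert) (use fin gR xR x in \<open>auto\<close>)
    also have "\<dots> = \<zero>"
    proof -
      have "(\<Otimes>g \<in> G - {?e}. x \<oplus> \<ominus> (g x)) \<in> carrier R"
        using gR xR by (intro finprod_closed) auto
      then show ?thesis using x xR by (simp add: r_neg)
    qed
    finally show ?thesis .
  qed
  then have "\<zero> = (\<Oplus>B \<in> Pow G. ?t B)"
    using finprod_add_expand[OF fin, of "\<lambda>g. \<ominus> (g x)" x] gR xR by simp
  also have "\<dots> = (\<Oplus>i \<in> {..?n}. finsum R ?t {B \<in> Pow G. ?n - card B = i})"
    by (rule finsum_group) (use fin tR in auto)
  also have "\<dots> = (\<Oplus>i \<in> {..?n}. norm_coeff x i \<otimes> x [^] i)"
  proof (rule finsum_cong')
    fix i assume i: "i \<in> {..?n}"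
    have "{B \<in> Pow G. ?n - card B = i} = {B. B \<subseteq> G \<and> card B = ?n - i}"
      using i card_mono[OF fin] by (auto; force)
    then have "finsum R ?t {B \<in> Pow G. ?n - card B = i}
        = (\<Oplus>B \<in> {B. B \<subseteq> G \<and> card B = ?n - i}. (\<Otimes>g \<in> B. \<ominus> (g x)) \<otimes> x [^] i)"
      using i pR xR by (intro finsum_cong') auto
    also have "\<dots> = norm_coeff x i \<otimes> x [^] i"
      unfolding norm_coeff_def using pR xR finB by (intro finsum_ldistr[symmetric]) auto
    finally show "finsum R ?t {B \<in> Pow G. ?n - card B = i} = norm_coeff x i \<otimes> x [^] i" .
  qed (use cR xR in auto)
  also have "{..?n} = insert ?n {..<?n}" by auto
  also have "(\<Oplus>i \<in> insert ?n {..<?n}. norm_coeff x i \<otimes> x [^] i)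
      = norm_coeff x ?n \<otimes> x [^] ?n \<oplus> (\<Oplus>i \<in> {..<?n}. norm_coeff x i \<otimes> x [^] i)"
    using cR xR by (intro finsum_insert) auto
  also have "norm_coeff x ?n = \<one>"
  proof -
    have "{B. B \<subseteq> G \<and> card B = ?n - ?n} = {{}}"
      using finite_subset[OF _ fin] by auto
    then show ?thesis by (simp add: norm_coeff_def finsum_insert)
  qed
  finally show ?thesis using xR by simp
qed

lemma norm_coeff_fixed:
  assumes h: "h \<in> G" and x: "x \<in> M"
  shows "h (norm_coeff x i) = norm_coeff x i"
proof -
  let ?S = "{B. B \<subseteq> G \<and> card B = card G - i}"
  have gM: "\<ominus> (g x) \<in> M" if "g \<in> G" for g using that act_closed x ME(5) by auto
  have pM: "(\<Otimes>g \<in> B. \<ominus> (g x)) \<in> M" if "B \<subseteq> G" for B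
    using gM that finprod_mem[of M B "\<lambda>g. \<ominus> (g x)"] ME by blast
  have img: "(\<Otimes>g \<in> B. h (\<ominus> (g x))) = (\<Otimes>g \<in> compose M h ` B. \<ominus> (g x))" if B: "B \<subseteq> G" for B
  proof -
    have "(\<Otimes>g \<in> compose M h ` B. \<ominus> (g x)) = (\<Otimes>g \<in> B. \<ominus> (compose M h g x))"
      by (rule finprod_reindex)
        (use B gM M_carrier comp[OF h] inj_on_subset[OF left_mult_bij(1)[OF h]] in \<open>auto simp: Pi_def subset_iff\<close>)
    also have "\<dots> = (\<Otimes>g \<in> B. h (\<ominus> (g x)))"
      using B x act_neg[OF h] act_closed M_carrier h ME(5)
      by (intro finprod_cong') (auto simp: compose_eq subset_iff)
    finally show ?thesis by simp
  qed
  have inj: "inj_on ((`) (compose M h)) ?S"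
    by (rule inj_on_subset[OF inj_on_image_Pow[OF left_mult_bij(1)[OF h]]]) auto
  have "(`) (compose M h) ` ?S \<subseteq> ?S"
  proof
    fix C assume "C \<in> (`) (compose M h) ` ?S"
    then obtain B where B: "B \<subseteq> G" "card B = card G - i" "C = compose M h ` B" by auto
    have "card C = card B" unfolding B(3)
      using card_image[OF inj_on_subset[OF left_mult_bij(1)[OF h] B(1)]] .
    then show "C \<in> ?S" using B comp[OF h] by auto
  qed
  then have surj: "(`) (compose M h) ` ?S = ?S"
    using endo_inj_surj[OF _ _ inj] finite_subset[of ?S "Pow G"] fin by auto
  have "h (norm_coeff x i) = (\<Oplus>B \<in> ?S. h (\<Otimes>g \<in> B. \<ominus> (g x)))"
    unfolding norm_coeff_def by (rule act_sum[OF h]) (use pM in auto)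
  also have "\<dots> = (\<Oplus>B \<in> ?S. \<Otimes>g \<in> compose M h ` B. \<ominus> (g x))"
  proof (rule finsum_cong')
    fix B assume B: "B \<in> ?S"
    show "h (\<Otimes>g \<in> B. \<ominus> (g x)) = (\<Otimes>g \<in> compose M h ` B. \<ominus> (g x))"
      using act_prod[OF h, of B "\<lambda>g. \<ominus> (g x)"] img[of B] B gM by auto
  next
    show "(\<lambda>B. \<Otimes>g \<in> compose M h ` B. \<ominus> (g x)) \<in> ?S \<rightarrow> carrier R"
    proof
      fix B assume "B \<in> ?S"
      then have "compose M h ` B \<subseteq> G" using comp[OF h] by auto
      then show "(\<Otimes>g \<in> compose M h ` B. \<ominus> (g x)) \<in> carrier R" using pM M_carrier by blast
    qed
  qed simp
  also have "\<dots> = (\<Oplus>B \<in> (`) (compose M h) ` ?S. \<Otimes>g \<in> B. \<ominus> (g x))"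
    by (rule finsum_reindex[symmetric, OF _ inj]) (use surj pM M_carrier in auto)
  finally show ?thesis unfolding surj by (simp add: norm_coeff_def)
qed

text \<open>Lying over: take an ideal \<open>P\<close> of \<open>T\<close> maximal among those that meet the fixed ring
  only inside \<open>q\<close>. It is prime; and if \<open>c \<in> q\<close> were not in it, some \<open>r = x + ct\<close> with
  \<open>x \<in> P\<close> would be a fixed element outside \<open>q\<close>. The norm of \<open>x = r - ct\<close> is in \<open>P\<close>, fixed, and
  congruent to a power of \<open>r\<close> modulo \<open>c\<close>, which is absurd.\<close>

theorem lying_over:
  assumes T: "subring T R" "T \<subseteq> M" and stab: "\<And>g t. g \<in> G \<Longrightarrow> t \<in> T \<Longrightarrow> g t \<in> T"
    and R0: "R0 = {t \<in> T. \<forall>g \<in> G. g t = t}" and q: "prime_in R0 q"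
  shows "\<exists>P. prime_in T P \<and> P \<inter> R0 = q"
proof -
  note TE = subringE[OF T(1)]
  have TM: "\<And>t. t \<in> T \<Longrightarrow> t \<in> M" using T(2) by auto
  have TR: "\<And>t. t \<in> T \<Longrightarrow> t \<in> carrier R" using TE(1) by auto
  have R0T: "\<And>t. t \<in> R0 \<Longrightarrow> t \<in> T" using R0 by auto
  have R0s: "subring R0 R"
  proof (rule subringI)
    show "R0 \<subseteq> carrier R" using R0T TR by auto
    show "\<one> \<in> R0" using TE(3) act_one by (auto simp: R0)
    fix a b assume ab: "a \<in> R0" "b \<in> R0"
    have "g (a \<otimes> b) = a \<otimes> b \<and> g (a \<oplus> b) = a \<oplus> b" if "g \<in> G" for g
    proof -
      have "g a = a" "g b = b" "a \<in> M" "b \<in> M" using ab that TM by (auto simp: R0)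
      then show ?thesis using act_mult[of g a b] act_add[of g a b] that by simp
    qed
    then show "a \<otimes> b \<in> R0" "a \<oplus> b \<in> R0"
      using TE(6,7) ab by (auto simp: R0)
  next
    fix a assume a: "a \<in> R0"
    have "g (\<ominus> a) = \<ominus> a" if "g \<in> G" for g
    proof -
      have "g a = a" "a \<in> M" using a that TM by (auto simp: R0)
      then show ?thesis using act_neg[of g a] that by simp
    qed
    then show "\<ominus> a \<in> R0" using TE(5) a by (auto simp: R0)
  qed
  interpret q: subring_prime R R0 q
    by (intro subring_prime.intro subring_prime_axioms.intro domain_axioms R0s q)
  define \<J> where "\<J> = {J. J \<subseteq> T \<and> \<zero> \<in> J \<and> (\<forall>x \<in> J. \<forall>y \<in> J. x \<oplus> y \<in> J) \<and>
    (\<forall>t \<in> T. \<forall>x \<in> J. t \<otimes> x \<in> J) \<and> J \<inter> R0 \<subseteq> q}"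
  have "\<exists>P\<in>\<J>. \<forall>J\<in>\<J>. P \<subseteq> J \<longrightarrow> J = P"
  proof (rule subset_Zorn_nonempty)
    have "{\<zero>} \<in> \<J>" using TE(2) TR q.P_zero by (auto simp: \<J>_def)
    then show "\<J> \<noteq> {}" by auto
    fix C assume C: "C \<noteq> {}" "subset.chain \<J> C"
    then have CJ: "C \<subseteq> \<J>" and lin: "\<And>a b. a \<in> C \<Longrightarrow> b \<in> C \<Longrightarrow> a \<subseteq> b \<or> b \<subseteq> a"
      by (auto simp: subset.chain_def)
    obtain J0 where J0: "J0 \<in> C" using C by auto
    have J: "J \<subseteq> T" "\<zero> \<in> J" "\<And>x y. x \<in> J \<Longrightarrow> y \<in> J \<Longrightarrow> x \<oplus> y \<in> J"
      "\<And>t x. t \<in> T \<Longrightarrow> x \<in> J \<Longrightarrow> t \<otimes> x \<in> J" "J \<inter> R0 \<subseteq> q" if "J \<in> C" for J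
      using CJ that by (auto simp: \<J>_def)
    have "x \<oplus> y \<in> \<Union>C" if xy: "x \<in> \<Union>C" "y \<in> \<Union>C" for x y
    proof -
      obtain J where "J \<in> C" "x \<in> J" "y \<in> J" using xy lin by blast
      then show ?thesis using J(3) by auto
    qed
    moreover have "\<Union>C \<subseteq> T" using J(1) by blast
    moreover have "\<zero> \<in> \<Union>C" using J(2)[OF J0] J0 by blast
    moreover have "t \<otimes> x \<in> \<Union>C" if tx: "t \<in> T" "x \<in> \<Union>C" for t x
    proof -
      obtain J where "J \<in> C" "x \<in> J" using tx(2) by blast
      then show ?thesis using J(4)[of J t x] tx(1) by blast
    qed
    moreover have "\<Union>C \<inter> R0 \<subseteq> q" using J(5) by blast
    ultimately show "\<Union>C \<in> \<J>" unfolding \<J>_def by (intro CollectI conjI ballI)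
  qed
  then obtain P where P: "P \<in> \<J>" "\<And>J. J \<in> \<J> \<Longrightarrow> P \<subseteq> J \<Longrightarrow> J = P" by blast
  have PT: "\<And>x. x \<in> P \<Longrightarrow> x \<in> T" and P0: "\<zero> \<in> P"
    and Padd: "\<And>x y. x \<in> P \<Longrightarrow> y \<in> P \<Longrightarrow> x \<oplus> y \<in> P"
    and Pmult: "\<And>t x. t \<in> T \<Longrightarrow> x \<in> P \<Longrightarrow> t \<otimes> x \<in> P" and PR0: "\<And>x. x \<in> P \<Longrightarrow> x \<in> R0 \<Longrightarrow> x \<in> q"
    using P(1) by (auto simp: \<J>_def)
  have Pmult': "x \<otimes> t \<in> P" if "x \<in> P" "t \<in> T" for x t
    using Pmult[OF that(2,1)] m_comm[of x t] that PT TR by auto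
  have bigger: "\<exists>x \<in> P. \<exists>t \<in> T. x \<oplus> c \<otimes> t \<in> R0 \<and> x \<oplus> c \<otimes> t \<notin> q" if c: "c \<in> T" "c \<notin> P" for c
  proof (rule ccontr)
    assume n: "\<not> ?thesis"
    define J where "J = {x \<oplus> c \<otimes> t | x t. x \<in> P \<and> t \<in> T}"
    have JI: "x \<oplus> c \<otimes> t \<in> J" if "x \<in> P" "t \<in> T" for x t using that by (auto simp: J_def)
    have "J \<in> \<J>" unfolding \<J>_def
    proof (intro CollectI conjI ballI)
      show "J \<subseteq> T" unfolding J_def using PT c TE(6,7) by auto
      show "\<zero> \<in> J" using JI[OF P0 TE(2)] TR[OF c(1)] by simp
      show "J \<inter> R0 \<subseteq> q" unfolding J_def using n by auto
    next
      fix u v assume "u \<in> J" "v \<in> J"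
      then obtain x t y s where *: "u = x \<oplus> c \<otimes> t" "v = y \<oplus> c \<otimes> s" "x \<in> P" "y \<in> P" "t \<in> T" "s \<in> T"
        unfolding J_def by auto
      have "u \<oplus> v = (x \<oplus> y) \<oplus> c \<otimes> (t \<oplus> s)"
        unfolding *(1,2) using * PT TR c by (simp add: r_distr a_ac)
      then show "u \<oplus> v \<in> J" using JI[of "x \<oplus> y" "t \<oplus> s"] Padd TE(7) * by simp
    next
      fix s u assume s: "s \<in> T" "u \<in> J"
      then obtain x t where *: "u = x \<oplus> c \<otimes> t" "x \<in> P" "t \<in> T" unfolding J_def by auto
      have "s \<otimes> u = s \<otimes> x \<oplus> c \<otimes> (s \<otimes> t)"
        unfolding *(1) using * PT TR c s by (simp add: r_distr m_ac)
      then show "s \<otimes> u \<in> J" using JI[of "s \<otimes> x" "s \<otimes> t"] Pmult TE(6) * s by simp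
    qed
    moreover have "P \<subseteq> J"
    proof
      fix x assume x: "x \<in> P"
      show "x \<in> J" using JI[OF x TE(2)] TR[OF c(1)] TR[OF PT[OF x]] by simp
    qed
    moreover have "c \<in> J" using JI[OF P0 TE(3)] TR[OF c(1)] by simp
    ultimately show False using P(2) c(2) by blast
  qed
  have prime: "x \<in> P \<or> y \<in> P" if xy: "x \<in> T" "y \<in> T" "x \<otimes> y \<in> P" for x y
  proof (rule ccontr)
    assume "\<not> ?thesis"
    then obtain a s b t where *: "a \<in> P" "s \<in> T" "a \<oplus> x \<otimes> s \<in> R0" "a \<oplus> x \<otimes> s \<notin> q"
      "b \<in> P" "t \<in> T" "b \<oplus> y \<otimes> t \<in> R0" "b \<oplus> y \<otimes> t \<notin> q"
      using bigger xy by meson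
    have "(a \<oplus> x \<otimes> s) \<otimes> (b \<oplus> y \<otimes> t) = a \<otimes> (b \<oplus> y \<otimes> t) \<oplus> ((x \<otimes> s) \<otimes> b \<oplus> (s \<otimes> t) \<otimes> (x \<otimes> y))"
      using * PT TR xy by (simp add: l_distr r_distr m_ac a_ac)
    also have "\<dots> \<in> P"
    proof -
      have "a \<otimes> (b \<oplus> y \<otimes> t) \<in> P" "(x \<otimes> s) \<otimes> b \<in> P" "(s \<otimes> t) \<otimes> (x \<otimes> y) \<in> P"
        using Pmult'[OF *(1) R0T[OF *(7)]] Pmult[OF TE(6)[OF xy(1) *(2)] *(5)]
          Pmult[OF TE(6)[OF *(2,6)] xy(3)] by auto
      then show ?thesis using Padd by blast
    qed
    finally have "(a \<oplus> x \<otimes> s) \<otimes> (b \<oplus> y \<otimes> t) \<in> q"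
      using PR0 subringE(6)[OF R0s] * by blast
    then show False using q.P_prime * by blast
  qed
  have one: "\<one> \<notin> P" using PR0 subringE(3)[OF R0s] q.P_one by auto
  have Pp: "prime_in T P"
    using PT P0 Padd Pmult prime one by (auto simp: prime_in_def)
  interpret P: subring_prime R T P
    by (intro subring_prime.intro subring_prime_axioms.intro domain_axioms T(1) Pp)
  have "q \<subseteq> P"
  proof
    fix c assume c: "c \<in> q"
    show "c \<in> P"
    proof (rule ccontr)
      assume nc: "c \<notin> P"
      have cR0: "c \<in> R0" using c q.P_T by simp
      have cT: "c \<in> T" using R0T[OF cR0] .
      obtain x t where xt: "x \<in> P" "t \<in> T" "x \<oplus> c \<otimes> t \<in> R0" "x \<oplus> c \<otimes> t \<notin> q"
        using bigger[OF cT nc] by blast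
      define r where "r = x \<oplus> c \<otimes> t"
      have rT: "r \<in> T" "r \<in> R0" using xt R0T by (auto simp: r_def)
      have xr: "x = r \<ominus> c \<otimes> t" using xt PT TR cT by (simp add: r_def a_minus_def a_assoc r_neg)
      have fT: "r \<ominus> c \<otimes> g t \<in> T" if "g \<in> G" for g
        using P.T_minus rT(1) TE(6)[OF cT stab[OF that xt(2)]] by simp
      \<comment> \<open>the norm of \<open>x\<close>, congruent to \<open>r\<^sup>n\<close> modulo \<open>c\<close>\<close>
      have expand: "\<exists>w \<in> T. (\<Otimes>g \<in> H. r \<ominus> c \<otimes> g t) = r [^] card H \<oplus> c \<otimes> w"
        if "finite H" "H \<subseteq> G" for H
        using that
      proof (induct H)
        case empty
        then show ?case using TE(2) TR cT by (intro bexI[of _ \<zero>]) auto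
      next
        case (insert g H)
        then obtain w where w: "w \<in> T" "(\<Otimes>g \<in> H. r \<ominus> c \<otimes> g t) = r [^] card H \<oplus> c \<otimes> w" by auto
        have gt: "g t \<in> T" using stab insert.prems xt(2) by auto
        have "(\<Otimes>g \<in> insert g H. r \<ominus> c \<otimes> g t) = (r \<ominus> c \<otimes> g t) \<otimes> (\<Otimes>g \<in> H. r \<ominus> c \<otimes> g t)"
          by (rule finprod_insert) (use insert fT TR in auto)
        also have "\<dots> = (r \<oplus> \<ominus> (c \<otimes> g t)) \<otimes> (r [^] card H \<oplus> c \<otimes> w)"
          unfolding w(2) by (simp add: a_minus_def)
        also have "\<dots> = r [^] card (insert g H) \<oplus> c \<otimes> (r \<otimes> w \<oplus> \<ominus> (g t) \<otimes> (r [^] card H \<oplus> c \<otimes> w))"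
          using w(1) gt cT rT TR insert.hyps
          by (simp add: l_distr r_distr l_minus r_minus m_ac a_ac minus_add)
        finally show ?case
          by (intro bexI[of _ "r \<otimes> w \<oplus> \<ominus> (g t) \<otimes> (r [^] card H \<oplus> c \<otimes> w)"])
            (use TE(5,6,7) w(1) gt cT rT P.T_pow in auto)
      qed
      obtain w where w: "w \<in> T" "(\<Otimes>g \<in> G. r \<ominus> c \<otimes> g t) = r [^] card G \<oplus> c \<otimes> w"
        using expand[OF fin] by auto
      define n where "n = (\<Otimes>g \<in> G. r \<ominus> c \<otimes> g t)"
      have nT: "n \<in> T" unfolding n_def by (rule P.T_prod) (use fT in auto)
      have "n \<in> P"
      proof -
        let ?e = "\<lambda>x \<in> M. x"
        have "n = (\<Otimes>g \<in> insert ?e (G - {?e}). r \<ominus> c \<otimes> g t)"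
          unfolding n_def using one insert_Diff[of ?e G] aut_group.one[OF aut_group_axioms] by simp
        also have "\<dots> = (r \<ominus> c \<otimes> ?e t) \<otimes> (\<Otimes>g \<in> G - {?e}. r \<ominus> c \<otimes> g t)"
        proof (rule finprod_insert)
          show "(\<lambda>g. r \<ominus> c \<otimes> g t) \<in> G - {?e} \<rightarrow> carrier R" using fT TR by auto
          show "r \<ominus> c \<otimes> ?e t \<in> carrier R"
            using TR[OF fT[OF aut_group.one[OF aut_group_axioms]]] .
        qed (use fin in auto)
        also have "\<dots> \<in> P"
          by (rule Pmult') (use xr xt TM fT in \<open>auto intro: P.T_prod\<close>)
        finally show ?thesis .
      qed
      moreover have "n \<in> R0"
      proof -
        have "h n = n" if h: "h \<in> G" for h
        proof -
          have "h n = (\<Otimes>g \<in> G. h (r \<ominus> c \<otimes> g t))"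
            unfolding n_def by (rule act_prod[OF h]) (use fT TM in auto)
          also have "\<dots> = (\<Otimes>g \<in> G. r \<ominus> c \<otimes> compose M h g t)"
          proof (rule finprod_cong')
            fix g assume g: "g \<in> G"
            have "h r = r" "h c = c" using rT(2) cR0 h by (auto simp: R0)
            then show "h (r \<ominus> c \<otimes> g t) = r \<ominus> c \<otimes> compose M h g t"
              using act_minus[OF h] act_mult[OF h] TM rT(1) cT stab[OF g xt(2)] ME(6) TM[OF xt(2)]
              by (simp add: compose_eq)
          qed (use fT comp[OF h] TR in auto)
          also have "\<dots> = (\<Otimes>g \<in> compose M h ` G. r \<ominus> c \<otimes> g t)"
            by (rule finprod_reindex[symmetric]) (use fT TR left_mult_bij[OF h] in auto)
          finally show ?thesis using left_mult_bij(2)[OF h] by (simp add: n_def)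
        qed
        then show ?thesis using nT by (simp add: R0)
      qed
      ultimately have nq: "n \<in> q" using PR0 by simp
      have rp: "r [^] card G \<in> R0" using rT(2) q.T_pow by simp
      have cw: "c \<otimes> w = n \<ominus> r [^] card G"
        using w cT rT(1) TR P.T_pow by (simp add: n_def a_minus_def a_comm[of "r [^] card G"] a_assoc r_neg)
      then have cwR0: "c \<otimes> w \<in> R0" using \<open>n \<in> R0\<close> rp q.T_minus by simp
      have "g w = w" if g: "g \<in> G" for g
      proof -
        have "c \<otimes> g w = c \<otimes> w"
        proof -
          have "g (c \<otimes> w) = c \<otimes> w" "g c = c" using cwR0 cR0 g by (auto simp: R0)
          then show ?thesis using act_mult[OF g TM[OF cT] TM[OF w(1)]] by simp
        qed
        moreover have "c \<noteq> \<zero>" using nc P0 by auto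
        ultimately show ?thesis using TR cT w(1) stab[OF g w(1)] m_lcancel by simp
      qed
      then have "w \<in> R0" using w(1) by (simp add: R0)
      then have "c \<otimes> w \<in> q" using q.P_mult' c by simp
      moreover have "r [^] card G = n \<ominus> c \<otimes> w"
        unfolding n_def w(2) using cT w(1) rT(1) TR P.T_pow by (simp add: a_minus_def a_assoc r_neg)
      ultimately have "r [^] card G \<in> q" using nq q.P_minus by simp
      then have "r \<in> q" using q.P_pow rT(2) by blast
      then show False using xt(4) by (simp add: r_def)
    qed
  qed
  then have "P \<inter> R0 = q" using PR0 q.P_T by auto
  then show ?thesis using Pp by blast
qed

end

locale aut_group_prime = aut_group R M G + subring_prime R T P
  for R (structure) and M G T P +
  assumes T_M: "T \<subseteq> M" and stable: "g \<in> G \<Longrightarrow> t \<in> T \<Longrightarrow> g t \<in> T"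
begin

lemma norm_coeff_mem:
  assumes x: "x \<in> T" and gx: "\<And>g. g \<in> G \<Longrightarrow> g x \<in> P" and i: "i < card G"
  shows "norm_coeff x i \<in> P"
  unfolding norm_coeff_def
proof (rule P_sum)
  fix B assume "B \<in> {B. B \<subseteq> G \<and> card B = card G - i}"
  then have B: "B \<subseteq> G" "card B \<noteq> 0" using i by auto
  then obtain g where g: "g \<in> B" "finite B" using card_eq_0_iff[of B] by auto
  have t: "\<ominus> (h x) \<in> T" if "h \<in> B" for h using stable x B that TE(5) by auto
  have "(\<Otimes>h \<in> B. \<ominus> (h x)) = (\<Otimes>h \<in> insert g (B - {g}). \<ominus> (h x))"
    using g by (simp add: insert_absorb)
  also have "\<dots> = \<ominus> (g x) \<otimes> (\<Otimes>h \<in> B - {g}. \<ominus> (h x))"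
    by (rule finprod_insert) (use g t T_carrier in auto)
  also have "\<dots> \<in> P"
    by (rule P_mult') (use gx g B P_neg t in \<open>auto intro: T_prod\<close>)
  finally show "(\<Otimes>h \<in> B. \<ominus> (h x)) \<in> P" .
qed

definition inertia :: "('a \<Rightarrow> 'a) set" where
  "inertia = {g \<in> G. \<forall>t \<in> T. g t \<ominus> t \<in> P}"

lemma T_in_M: "t \<in> T \<Longrightarrow> t \<in> M" using T_M by auto

lemma inertia_aut_group: "aut_group R M inertia"
proof (intro aut_group.intro aut_group_axioms.intro field_axioms)
  show "subfield M R" by (rule M)
  show "finite inertia" using fin by (simp add: inertia_def)
  show "inertia \<subseteq> extensional M" using ext by (auto simp: inertia_def)
  show "(\<lambda>x \<in> M. x) \<in> inertia"
    using one T_in_M T_carrier P_zero by (auto simp: inertia_def a_minus_def r_neg)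
  fix g assume g: "g \<in> inertia"
  show "g \<in> ring_hom (R\<lparr>carrier := M\<rparr>) (R\<lparr>carrier := M\<rparr>)" using hom g by (simp add: inertia_def)
  fix h assume h: "h \<in> inertia"
  have gh: "g \<in> G" "h \<in> G" using g h by (auto simp: inertia_def)
  have "compose M g h t \<ominus> t \<in> P" if t: "t \<in> T" for t
    using diff_trans[of "g (h t)" "h t" t] g h t stable[OF gh(2) t] stable[OF gh(1)] T_in_M
    by (auto simp: inertia_def compose_eq)
  then show "compose M g h \<in> inertia" using comp[OF gh] by (simp add: inertia_def)
qed

text \<open>Two elements of the group act in the same way modulo \<open>P\<close> iff they lie in the same right
  coset of the inertia group.\<close>

lemma card_congruent:
  assumes h: "h \<in> G"
  shows "card {g \<in> G. \<forall>t \<in> T. g t \<ominus> h t \<in> P} = card inertia"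
proof -
  have "{g \<in> G. \<forall>t \<in> T. g t \<ominus> h t \<in> P} = (\<lambda>i. compose M i h) ` inertia"
  proof (intro equalityI subsetI)
    fix g assume g: "g \<in> {g \<in> G. \<forall>t \<in> T. g t \<ominus> h t \<in> P}"
    obtain k where k: "k \<in> G" "\<And>x. x \<in> M \<Longrightarrow> h (k x) = x" "\<And>x. x \<in> M \<Longrightarrow> k (h x) = x"
      using act_inverse[OF h] by metis
    have "compose M g k t \<ominus> t \<in> P" if t: "t \<in> T" for t
      using g stable[OF k(1) t] k(2)[OF T_in_M[OF t]] T_in_M[OF t] by (auto simp: compose_eq)
    then have "compose M g k \<in> inertia" using comp g k(1) by (simp add: inertia_def)
    moreover have "g = compose M (compose M g k) h"
      by (rule G_ext) (use g h k comp act_closed in \<open>auto simp: compose_eq\<close>)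
    ultimately show "g \<in> (\<lambda>i. compose M i h) ` inertia" by blast
  next
    fix g assume "g \<in> (\<lambda>i. compose M i h) ` inertia"
    then obtain i where i: "i \<in> G" "\<And>t. t \<in> T \<Longrightarrow> i t \<ominus> t \<in> P" "g = compose M i h"
      by (auto simp: inertia_def)
    then show "g \<in> {g \<in> G. \<forall>t \<in> T. g t \<ominus> h t \<in> P}"
      using comp h stable[OF h] T_in_M by (auto simp: compose_eq)
  qed
  moreover have "inj_on (\<lambda>i. compose M i h) inertia"
    using inj_on_subset[OF right_mult_inj[OF h]] by (auto simp: inertia_def)
  ultimately show ?thesis using card_image by metis
qed

text \<open>Each character \<open>T \<rightarrow> T/P\<close> that \<open>G\<close> induces comes from \<open>|I|\<close> elements of \<open>G\<close>, and \<open>C\<close> contains one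
  of them for each character.\<close>

lemma trace_mod_prime:
  "\<exists>C \<subseteq> G. (\<forall>g \<in> G. \<exists>c \<in> C. \<forall>t \<in> T. g t \<ominus> c t \<in> P)
    \<and> (\<forall>c \<in> C. \<forall>d \<in> C. c \<noteq> d \<longrightarrow> (\<exists>t \<in> T. c t \<ominus> d t \<notin> P))
    \<and> (\<forall>t \<in> T. trace_sum t \<ominus> (\<Oplus>c \<in> C. ([card inertia] \<cdot> \<one>) \<otimes> c t) \<in> P)"
proof -
  define cls where "cls g = {h \<in> G. \<forall>t \<in> T. h t \<ominus> g t \<in> P}" for g
  define \<rho> where "\<rho> g = (SOME h. h \<in> cls g)" for g
  have refl: "g \<in> cls g" if "g \<in> G" for g
    using that stable T_carrier P_zero by (auto simp: cls_def a_minus_def r_neg)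
  have \<rho>: "\<rho> g \<in> cls g" if "g \<in> G" for g unfolding \<rho>_def using someI[of "\<lambda>h. h \<in> cls g" g] refl[OF that] by blast
  have cls_eq: "cls g = cls h" if "g \<in> G" "h \<in> G" "\<forall>t \<in> T. g t \<ominus> h t \<in> P" for g h
  proof -
    have t: "k t \<ominus> g t \<in> P \<longleftrightarrow> k t \<ominus> h t \<in> P" if "k \<in> G" "t \<in> T" for k t
      using diff_trans[of "k t" "g t" "h t"] diff_trans[of "k t" "h t" "g t"] diff_sym[of "g t" "h t"]
        \<open>g \<in> G\<close> \<open>h \<in> G\<close> \<open>\<forall>t \<in> T. g t \<ominus> h t \<in> P\<close> stable that by blast
    show ?thesis unfolding cls_def using t by blast
  qed
  have \<rho>G: "\<rho> g \<in> G" if "g \<in> G" for g using \<rho>[OF that] by (simp add: cls_def)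
  have \<rho>\<rho>: "\<rho> g = \<rho> h" if "g \<in> G" "h \<in> G" "\<forall>t \<in> T. g t \<ominus> h t \<in> P" for g h
    using cls_eq[OF that] by (simp add: \<rho>_def)
  have cong: "g t \<ominus> \<rho> g t \<in> P" if "g \<in> G" "t \<in> T" for g t
    using \<rho>[OF that(1)] that diff_sym stable by (auto simp: cls_def)
  let ?C = "\<rho> ` G"
  have fib: "{g \<in> G. \<rho> g = c} = cls c" if c: "c \<in> ?C" for c
  proof (intro equalityI subsetI)
    obtain h where h: "h \<in> G" "c = \<rho> h" using c by auto
    have cG: "c \<in> G" "\<rho> c = c" using h \<rho>G \<rho>\<rho>[OF h(1) \<rho>G[OF h(1)]] cong by auto
    fix g assume "g \<in> cls c"
    then show "g \<in> {g \<in> G. \<rho> g = c}" using \<rho>\<rho>[of g c] cG by (auto simp: cls_def)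
  next
    fix g assume "g \<in> {g \<in> G. \<rho> g = c}"
    then show "g \<in> cls c" using cong by (auto simp: cls_def)
  qed
  show ?thesis
  proof (intro exI[of _ ?C] conjI ballI impI)
    show "?C \<subseteq> G" using \<rho>G by auto
    show "\<exists>c \<in> ?C. \<forall>t \<in> T. g t \<ominus> c t \<in> P" if "g \<in> G" for g using cong that by blast
    show "\<exists>t \<in> T. c t \<ominus> d t \<notin> P" if cd: "c \<in> ?C" "d \<in> ?C" "c \<noteq> d" for c d
    proof (rule ccontr)
      assume n: "\<not> ?thesis"
      obtain g h where gh: "g \<in> G" "c = \<rho> g" "h \<in> G" "d = \<rho> h" using cd by auto
      have "\<rho> c = \<rho> d" using \<rho>\<rho>[of c d] n gh \<rho>G by auto
      moreover have "\<rho> c = c" "\<rho> d = d"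
        using gh \<rho>\<rho>[OF gh(1) \<rho>G[OF gh(1)]] \<rho>\<rho>[OF gh(3) \<rho>G[OF gh(3)]] cong by auto
      ultimately show False using cd(3) by simp
    qed
    fix t assume t: "t \<in> T"
    have gT: "g t \<in> T" if "g \<in> G" for g using stable that t by simp
    have gR: "g t \<in> carrier R" if "g \<in> G" for g using gT T_carrier that by simp
    have "trace_sum t = (\<Oplus>c \<in> ?C. \<Oplus>g \<in> {g \<in> G. \<rho> g = c}. g t)"
      unfolding trace_sum_def by (rule finsum_group) (use fin gR in auto)
    moreover have "(\<Oplus>c \<in> ?C. \<Oplus>g \<in> {g \<in> G. \<rho> g = c}. g t)
        \<ominus> (\<Oplus>c \<in> ?C. ([card inertia] \<cdot> \<one>) \<otimes> c t) \<in> P"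
    proof (rule diff_sum)
      fix c assume c: "c \<in> ?C"
      have cG: "c \<in> G" using c \<rho>G by auto
      have "(\<Oplus>g \<in> cls c. c t) = [card (cls c)] \<cdot> c t"
        by (rule add.finprod_const) (use gR[OF cG] in auto)
      also have "card (cls c) = card inertia" using card_congruent[OF cG] by (simp add: cls_def)
      also have "[card inertia] \<cdot> c t = ([card inertia] \<cdot> \<one>) \<otimes> c t"
        using gR[OF cG] by (simp add: add_pow_ldistr)
      finally have eq: "(\<Oplus>g \<in> cls c. c t) = ([card inertia] \<cdot> \<one>) \<otimes> c t" .
      show "(\<Oplus>g \<in> {g \<in> G. \<rho> g = c}. g t) \<ominus> ([card inertia] \<cdot> \<one>) \<otimes> c t \<in> P"
        unfolding fib[OF c] eq[symmetric]
        by (rule diff_sum) (use gT cG t in \<open>auto simp: cls_def\<close>)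
      show "(\<Oplus>g \<in> {g \<in> G. \<rho> g = c}. g t) \<in> T" by (rule T_sum) (use gT in auto)
      show "([card inertia] \<cdot> \<one>) \<otimes> c t \<in> T"
        unfolding eq[symmetric] by (rule T_sum) (use gT[OF cG] in auto)
    qed
    ultimately show "trace_sum t \<ominus> (\<Oplus>c \<in> ?C. ([card inertia] \<cdot> \<one>) \<otimes> c t) \<in> P" by simp
  qed
qed

lemma nat_mem: "[(n::nat)] \<cdot> \<one> \<in> T"
proof (induct n)
  case 0
  show ?case using TE(2) by simp
next
  case (Suc n)
  then show ?case using TE(7)[OF Suc TE(3)] by simp
qed

text \<open>By the congruence above, \<open>|I| \<in> P\<close> would put all traces into \<open>P\<close>.\<close>

theorem trace_nonzero_imp_inertia_invertible:
  assumes t: "t \<in> T" "trace_sum t \<notin> P"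
  shows "[card inertia] \<cdot> \<one> \<notin> P"
proof
  assume n: "[card inertia] \<cdot> \<one> \<in> P"
  obtain C where C: "C \<subseteq> G" "trace_sum t \<ominus> (\<Oplus>c \<in> C. ([card inertia] \<cdot> \<one>) \<otimes> c t) \<in> P"
    using trace_mod_prime t(1) by blast
  have "(\<Oplus>c \<in> C. ([card inertia] \<cdot> \<one>) \<otimes> c t) \<in> P"
    by (rule P_sum) (use C n P_mult' stable t in auto)
  moreover have "trace_sum t \<in> T" unfolding trace_sum_def by (rule T_sum) (use stable t in auto)
  ultimately show False using diff_mem_iff[OF C(2)] P_T t(2) by auto
qed

text \<open>\<open>Tr(st) \<equiv> \<Sum> |I| c(s) c(t)\<close> is a linear relation between distinct characters, so all its
  coefficients \<open>|I| c(s)\<close> are in \<open>P\<close>.\<close>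

theorem inertia_invertible_imp_trace_form_nondegenerate:
  assumes n: "[card inertia] \<cdot> \<one> \<notin> P" and s: "s \<in> T"
    and tr: "\<And>t. t \<in> T \<Longrightarrow> trace_sum (s \<otimes> t) \<in> P" and g: "g \<in> G"
  shows "g s \<in> P"
proof -
  obtain C where C: "C \<subseteq> G" "\<forall>g \<in> G. \<exists>c \<in> C. \<forall>t \<in> T. g t \<ominus> c t \<in> P"
    "\<forall>c \<in> C. \<forall>d \<in> C. c \<noteq> d \<longrightarrow> (\<exists>t \<in> T. c t \<ominus> d t \<notin> P)"
    "\<forall>t \<in> T. trace_sum t \<ominus> (\<Oplus>c \<in> C. ([card inertia] \<cdot> \<one>) \<otimes> c t) \<in> P"
    using trace_mod_prime by blast
  have CG: "\<And>c. c \<in> C \<Longrightarrow> c \<in> G" using C(1) by auto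
  have "\<forall>c \<in> C. ([card inertia] \<cdot> \<one>) \<otimes> c s \<in> P"
  proof (rule dedekind_independence[where A = T and e = \<one> and mul = "(\<otimes>)"])
    show "finite C" using C(1) fin finite_subset by auto
    fix t assume t: "t \<in> T"
    have st: "s \<otimes> t \<in> T" using TE(6) s t by simp
    have eq: "([card inertia] \<cdot> \<one>) \<otimes> c (s \<otimes> t) = ([card inertia] \<cdot> \<one>) \<otimes> c s \<otimes> c t" if "c \<in> C" for c
      using act_mult[OF CG[OF that] T_in_M[OF s] T_in_M[OF t]] stable[OF CG[OF that]] s t T_carrier nat_mem
      by (simp add: m_assoc)
    have cT: "([card inertia] \<cdot> \<one>) \<otimes> c (s \<otimes> t) \<in> T" if "c \<in> C" for c
      using TE(6)[OF nat_mem stable[OF CG[OF that] st]] .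
    have "(\<Oplus>c \<in> C. ([card inertia] \<cdot> \<one>) \<otimes> c (s \<otimes> t)) \<in> P"
      using diff_mem_iff[OF bspec[OF C(4) st] P_T[OF tr[OF t]]] tr[OF t]
        T_sum[of C "\<lambda>c. ([card inertia] \<cdot> \<one>) \<otimes> c (s \<otimes> t)"] cT by blast
    moreover have "(\<Oplus>c \<in> C. ([card inertia] \<cdot> \<one>) \<otimes> c (s \<otimes> t))
        = (\<Oplus>c \<in> C. ([card inertia] \<cdot> \<one>) \<otimes> c s \<otimes> c t)"
      by (rule finsum_cong') (use eq cT T_carrier in \<open>auto simp: Pi_def simp flip: eq\<close>)
    ultimately show "(\<Oplus>c \<in> C. ([card inertia] \<cdot> \<one>) \<otimes> c s \<otimes> c t) \<in> P" by simp
  next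
    show "([card inertia] \<cdot> \<one>) \<otimes> c s \<in> T" if "c \<in> C" for c
      using TE(6)[OF nat_mem stable[OF CG[OF that] s]] .
    show "\<exists>t \<in> T. c t \<ominus> d t \<notin> P" if "c \<in> C" "d \<in> C" "c \<noteq> d" for c d
      using C(3) that by blast
  qed (use TE(3,6) CG stable act_mult act_one T_in_M in blast)+
  then have cs: "\<And>c. c \<in> C \<Longrightarrow> c s \<in> P"
    using P_prime[OF nat_mem stable[OF CG s]] n by blast
  obtain c where c: "c \<in> C" "g s \<ominus> c s \<in> P" using bspec[OF C(2) g] s by blast
  then show ?thesis using cs[OF c(1)] diff_mem_iff[OF c(2)] stable g CG s by auto
qed

end

section \<open>The trace as a sum of conjugates\<close>

lemma (in abelian_monoid) finsum_swap:
  assumes "finite A" "finite B" "\<And>a b. a \<in> A \<Longrightarrow> b \<in> B \<Longrightarrow> f a b \<in> carrier G"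
  shows "(\<Oplus>a \<in> A. \<Oplus>b \<in> B. f a b) = (\<Oplus>b \<in> B. \<Oplus>a \<in> A. f a b)"
  using assms(1,3)
proof (induct A)
  case (insert a A)
  have "(\<Oplus>a \<in> insert a A. \<Oplus>b \<in> B. f a b) = (\<Oplus>b \<in> B. f a b) \<oplus> (\<Oplus>a \<in> A. \<Oplus>b \<in> B. f a b)"
    using insert by (intro finsum_insert) (auto intro!: finsum_closed)
  also have "\<dots> = (\<Oplus>b \<in> B. f a b \<oplus> (\<Oplus>a \<in> A. f a b))"
    using insert by (subst finsum_addf) (auto intro!: finsum_closed)
  also have "\<dots> = (\<Oplus>b \<in> B. \<Oplus>a \<in> insert a A. f a b)"
    using insert by (intro finsum_cong') (auto intro!: finsum_insert[symmetric] finsum_closed)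
  finally show ?case .
qed (use assms(2) in simp)

lemma (in ring) combine_eq_finsum:
  assumes "length Ks = length Us" "set Ks \<subseteq> carrier R" "set Us \<subseteq> carrier R"
  shows "combine Ks Us = (\<Oplus>i \<in> {..<length Us}. Ks ! i \<otimes> Us ! i)"
  using assms
proof (induct Ks Us rule: list_induct2)
  case (Cons k Ks u Us)
  have cl: "Ks ! i \<otimes> Us ! i \<in> carrier R" if "i < length Us" for i
    using Cons that by (metis insert_subset list.simps(15) m_closed nth_mem subsetD)
  have "(\<Oplus>i \<in> {..<length (u # Us)}. (k # Ks) ! i \<otimes> (u # Us) ! i)
      = (\<Oplus>i \<in> insert 0 (Suc ` {..<length Us}). (k # Ks) ! i \<otimes> (u # Us) ! i)"
    by (simp add: lessThan_Suc_eq_insert_0)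
  also have "\<dots> = k \<otimes> u \<oplus> (\<Oplus>i \<in> Suc ` {..<length Us}. (k # Ks) ! i \<otimes> (u # Us) ! i)"
    using Cons.prems cl by (subst finsum_insert) auto
  also have "(\<Oplus>i \<in> Suc ` {..<length Us}. (k # Ks) ! i \<otimes> (u # Us) ! i)
      = (\<Oplus>i \<in> {..<length Us}. Ks ! i \<otimes> Us ! i)"
    using cl by (subst finsum_reindex) auto
  finally show ?case using Cons by simp
qed simp

text \<open>Nondegeneracy is easy to prove for a sum of conjugates, but not for the trace of a matrix. So the
  dual basis is taken for a functional \<open>t\<close> that only later turns out to be the trace.\<close>

locale nondegenerate_functional = field R for R (structure) +
  fixes K L t
  assumes K: "subfield K R" and L: "subfield L R" and KL: "K \<subseteq> L"
    and t_closed: "x \<in> L \<Longrightarrow> t x \<in> K"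
    and t_add: "x \<in> L \<Longrightarrow> y \<in> L \<Longrightarrow> t (x \<oplus> y) = t x \<oplus> t y"
    and t_scale: "k \<in> K \<Longrightarrow> x \<in> L \<Longrightarrow> t (k \<otimes> x) = k \<otimes> t x"
    and nondegenerate: "x \<in> L \<Longrightarrow> x \<noteq> \<zero> \<Longrightarrow> \<exists>y \<in> L. t (x \<otimes> y) \<noteq> \<zero>"
begin

lemmas LE = subringE[OF subfieldE(1)[OF L]]
lemmas KE = subringE[OF subfieldE(1)[OF K]]

lemma L_carrier: "x \<in> L \<Longrightarrow> x \<in> carrier R" using LE(1) by auto
lemma K_carrier: "x \<in> K \<Longrightarrow> x \<in> carrier R" using KE(1) by auto
lemma K_L: "x \<in> K \<Longrightarrow> x \<in> L" using KL by auto
lemma t_carrier: "x \<in> L \<Longrightarrow> t x \<in> carrier R" using t_closed K_carrier by auto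

lemma L_sum: "(\<And>i. i \<in> I \<Longrightarrow> f i \<in> L) \<Longrightarrow> finsum R f I \<in> L"
  using finsum_mem[of L I f] LE by blast

lemma t_combination:
  assumes "finite I" "\<And>i. i \<in> I \<Longrightarrow> k i \<in> K" "\<And>i. i \<in> I \<Longrightarrow> f i \<in> L" "y \<in> L"
  shows "t ((\<Oplus>i \<in> I. k i \<otimes> f i) \<otimes> y) = (\<Oplus>i \<in> I. k i \<otimes> t (f i \<otimes> y))"
  using assms(1-3)
proof (induct I)
  case empty
  have "t (\<zero> \<otimes> \<zero>) = \<zero> \<otimes> t \<zero>" using t_scale KE(2) LE(2) by blast
  then show ?case using assms(4) L_carrier t_carrier[OF LE(2)] by simp
next
  case (insert i I)
  let ?s = "\<Oplus>i \<in> I. k i \<otimes> f i"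
  have m: "k j \<otimes> f j \<in> L" "f j \<otimes> y \<in> L" if "j \<in> insert i I" for j
    using insert.prems that K_L LE(6) assms(4) by auto
  have s: "?s \<in> L" using m by (intro L_sum) auto
  have "(\<Oplus>j \<in> insert i I. k j \<otimes> f j) = k i \<otimes> f i \<oplus> ?s"
    using insert.hyps m L_carrier by (intro finsum_insert) auto
  moreover have "(k i \<otimes> f i \<oplus> ?s) \<otimes> y = k i \<otimes> (f i \<otimes> y) \<oplus> ?s \<otimes> y"
    using insert.prems s assms(4) L_carrier K_carrier by (simp add: l_distr m_assoc)
  ultimately have "t ((\<Oplus>j \<in> insert i I. k j \<otimes> f j) \<otimes> y) = k i \<otimes> t (f i \<otimes> y) \<oplus> t (?s \<otimes> y)"
    using t_add[of "k i \<otimes> (f i \<otimes> y)" "?s \<otimes> y"] t_scale[of "k i" "f i \<otimes> y"] insert.prems m s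
      LE(6) assms(4) K_L by simp
  also have "\<dots> = (\<Oplus>j \<in> insert i I. k j \<otimes> t (f j \<otimes> y))"
    using insert m t_carrier K_carrier by (subst finsum_insert) auto
  finally show ?case .
qed

lemma t_neg: "x \<in> L \<Longrightarrow> t (\<ominus> x) = \<ominus> t x"
  using t_scale[of "\<ominus> \<one>" x] KE(3,5) L_carrier t_carrier[of x] by (simp add: l_minus)

lemma t_minus_combination:
  assumes "finite I" "\<And>i. i \<in> I \<Longrightarrow> k i \<in> K" "\<And>i. i \<in> I \<Longrightarrow> f i \<in> L" "x \<in> L" "y \<in> L"
  shows "t ((x \<ominus> (\<Oplus>i \<in> I. k i \<otimes> f i)) \<otimes> y) = t (x \<otimes> y) \<ominus> (\<Oplus>i \<in> I. k i \<otimes> t (f i \<otimes> y))"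
    and "t (y \<otimes> (x \<ominus> (\<Oplus>i \<in> I. k i \<otimes> f i))) = t (y \<otimes> x) \<ominus> (\<Oplus>i \<in> I. k i \<otimes> t (y \<otimes> f i))"
proof -
  let ?s = "\<Oplus>i \<in> I. k i \<otimes> f i"
  have s: "?s \<in> L" using assms K_L LE(6) by (intro L_sum) auto
  have eq: "(x \<ominus> ?s) \<otimes> y = x \<otimes> y \<oplus> \<ominus> (?s \<otimes> y)"
    using assms(4,5) s L_carrier by (simp add: a_minus_def l_distr l_minus)
  show 1: "t ((x \<ominus> ?s) \<otimes> y) = t (x \<otimes> y) \<ominus> (\<Oplus>i \<in> I. k i \<otimes> t (f i \<otimes> y))"
    unfolding eq using t_add[of "x \<otimes> y" "\<ominus> (?s \<otimes> y)"] t_neg[of "?s \<otimes> y"] LE(5,6) s assms(4,5)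
      t_combination[OF assms(1-3,5)] by (simp add: a_minus_def)
  have "y \<otimes> (x \<ominus> ?s) = (x \<ominus> ?s) \<otimes> y" "y \<otimes> x = x \<otimes> y"
    using assms(4,5) s L_carrier m_comm by auto
  moreover have "(\<Oplus>i \<in> I. k i \<otimes> t (y \<otimes> f i)) = (\<Oplus>i \<in> I. k i \<otimes> t (f i \<otimes> y))"
  proof (rule finsum_cong')
    show "k i \<otimes> t (y \<otimes> f i) = k i \<otimes> t (f i \<otimes> y)" if "i \<in> I" for i
      using m_comm[of y "f i"] assms(3)[OF that] assms(5) L_carrier by simp
  qed (use assms LE(6) t_carrier K_carrier in auto)
  ultimately show "t (y \<otimes> (x \<ominus> ?s)) = t (y \<otimes> x) \<ominus> (\<Oplus>i \<in> I. k i \<otimes> t (y \<otimes> f i))"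
    using 1 by simp
qed

lemma sum_delta:
  assumes "j < n" "\<And>i. i < (n::nat) \<Longrightarrow> a i \<in> carrier R" "\<And>i. i < n \<Longrightarrow> d i = (if i = j then \<one> else \<zero>)"
  shows "(\<Oplus>i \<in> {..<n}. a i \<otimes> d i) = a j"
proof -
  have "(\<Oplus>i \<in> {..<n}. a i \<otimes> d i) = (\<Oplus>i \<in> {..<n}. if j = i then a i else \<zero>)"
    by (rule finsum_cong') (use assms in auto)
  also have "\<dots> = a j" using finsum_singleton[of j "{..<n}" a] assms by auto
  finally show ?thesis .
qed

text \<open>Orthogonalization: \<open>v\<close> is the part of the last vector that is orthogonal to the earlier \<open>w\<^sub>i\<close>,
  not zero by independence; a vector \<open>z\<close> with \<open>t(vz) = 1\<close> is then corrected to be orthogonal to the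
  earlier \<open>u\<^sub>i\<close>, and the earlier \<open>w\<^sub>j\<close> are corrected to be orthogonal to the last vector.\<close>

lemma dual_basis:
  fixes n :: nat
  assumes "\<And>i. i < n \<Longrightarrow> u i \<in> L"
    and "\<And>k. (\<And>i. i < n \<Longrightarrow> k i \<in> K) \<Longrightarrow> (\<Oplus>i \<in> {..<n}. k i \<otimes> u i) = \<zero> \<Longrightarrow> \<forall>i<n. k i = \<zero>"
  shows "\<exists>w. \<forall>j<n. w j \<in> L \<and> (\<forall>i<n. t (u i \<otimes> w j) = (if i = j then \<one> else \<zero>))"
  using assms
proof (induct n)
  case (Suc n)
  note u = Suc.prems(1) and ind = Suc.prems(2)
  have uR: "u i \<in> carrier R" if "i < Suc n" for i using u[OF that] L_carrier by simp
  have split: "(\<Oplus>i \<in> {..<Suc n}. f i) = f n \<oplus> (\<Oplus>i \<in> {..<n}. f i)"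
    if "\<And>i. i < Suc n \<Longrightarrow> f i \<in> carrier R" for f
    unfolding lessThan_Suc using that by (intro finsum_insert) auto
  have "\<forall>i<n. k i = \<zero>"
    if k: "\<And>i. i < n \<Longrightarrow> k i \<in> K" "(\<Oplus>i \<in> {..<n}. k i \<otimes> u i) = \<zero>" for k
  proof -
    let ?k = "\<lambda>i. if i < n then k i else \<zero>"
    have kK: "\<And>i. i < Suc n \<Longrightarrow> ?k i \<in> K" using k(1) KE(2) by auto
    have "(\<Oplus>i \<in> {..<Suc n}. ?k i \<otimes> u i) = \<zero> \<otimes> u n \<oplus> (\<Oplus>i \<in> {..<n}. ?k i \<otimes> u i)"
      using split[of "\<lambda>i. ?k i \<otimes> u i"] kK K_carrier uR by auto
    also have "(\<Oplus>i \<in> {..<n}. ?k i \<otimes> u i) = (\<Oplus>i \<in> {..<n}. k i \<otimes> u i)"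
      using k(1) K_carrier uR by (intro finsum_cong') auto
    finally have "(\<Oplus>i \<in> {..<Suc n}. ?k i \<otimes> u i) = \<zero>" using k(2) uR by simp
    then have "\<forall>i<Suc n. ?k i = \<zero>" using ind[of ?k] kK by blast
    then show ?thesis by (metis less_SucI)
  qed
  then have "\<exists>w. \<forall>j<n. w j \<in> L \<and> (\<forall>i<n. t (u i \<otimes> w j) = (if i = j then \<one> else \<zero>))"
    using Suc.hyps[OF u] by simp
  then obtain w where w: "\<And>j. j < n \<Longrightarrow> w j \<in> L"
    "\<And>i j. i < n \<Longrightarrow> j < n \<Longrightarrow> t (u i \<otimes> w j) = (if i = j then \<one> else \<zero>)"
    by blast
  have un: "u n \<in> L" "\<And>i. i < n \<Longrightarrow> u i \<in> L" using u by auto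
  have uw: "t (u n \<otimes> w i) \<in> K" if "i < n" for i using t_closed LE(6) un w(1) that by auto
  define v where "v = u n \<ominus> (\<Oplus>i \<in> {..<n}. t (u n \<otimes> w i) \<otimes> u i)"
  have sL: "(\<Oplus>i \<in> {..<n}. t (u n \<otimes> w i) \<otimes> u i) \<in> L"
    using uw K_L un LE(6) by (intro L_sum) auto
  have vL: "v \<in> L" unfolding v_def a_minus_def using LE(5,7) sL un by auto
  have vw: "t (v \<otimes> w j) = \<zero>" if j: "j < n" for j
  proof -
    have "t (v \<otimes> w j) = t (u n \<otimes> w j) \<ominus> (\<Oplus>i \<in> {..<n}. t (u n \<otimes> w i) \<otimes> t (u i \<otimes> w j))"
      unfolding v_def using t_minus_combination(1)[of "{..<n}" "\<lambda>i. t (u n \<otimes> w i)" u "u n" "w j"]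
        uw un w(1) j by auto
    also have "(\<Oplus>i \<in> {..<n}. t (u n \<otimes> w i) \<otimes> t (u i \<otimes> w j)) = t (u n \<otimes> w j)"
      by (rule sum_delta[OF j]) (use uw K_carrier w(2) j in auto)
    finally show ?thesis using uw[OF j] K_carrier by (simp add: a_minus_def r_neg)
  qed
  have "v \<noteq> \<zero>"
  proof
    assume v0: "v = \<zero>"
    let ?k = "\<lambda>i. if i < n then \<ominus> t (u n \<otimes> w i) else \<one>"
    have kK: "\<And>i. i < Suc n \<Longrightarrow> ?k i \<in> K" using uw KE(3,5) by auto
    have "(\<Oplus>i \<in> {..<Suc n}. ?k i \<otimes> u i) = u n \<oplus> (\<Oplus>i \<in> {..<n}. ?k i \<otimes> u i)"
      using split[of "\<lambda>i. ?k i \<otimes> u i"] kK K_carrier uR by auto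
    also have "(\<Oplus>i \<in> {..<n}. ?k i \<otimes> u i) = (\<Oplus>i \<in> {..<n}. \<ominus> \<one> \<otimes> (t (u n \<otimes> w i) \<otimes> u i))"
      using uw K_carrier uR by (intro finsum_cong') (auto simp: l_minus)
    also have "\<dots> = \<ominus> \<one> \<otimes> (\<Oplus>i \<in> {..<n}. t (u n \<otimes> w i) \<otimes> u i)"
      using uw K_carrier uR by (intro finsum_rdistr[symmetric]) auto
    also have "u n \<oplus> \<dots> = v" using sL L_carrier by (simp add: v_def a_minus_def l_minus)
    finally have "\<forall>i<Suc n. ?k i = \<zero>" using ind[of ?k] kK v0 by blast
    then have "?k n = \<zero>" by blast
    then show False by simp
  qed
  then obtain y where y: "y \<in> L" "t (v \<otimes> y) \<noteq> \<zero>" using nondegenerate[OF vL] by blast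
  define z where "z = inv (t (v \<otimes> y)) \<otimes> y"
  have vyK: "t (v \<otimes> y) \<in> K - {\<zero>}" using t_closed LE(6) vL y by auto
  have iK: "inv (t (v \<otimes> y)) \<in> K" "inv (t (v \<otimes> y)) \<otimes> t (v \<otimes> y) = \<one>"
    using subfield_m_inv[OF K vyK] by auto
  have zL: "z \<in> L" using iK(1) K_L y LE(6) by (simp add: z_def)
  have "v \<otimes> z = inv (t (v \<otimes> y)) \<otimes> (v \<otimes> y)"
    using iK(1) K_carrier vL y L_carrier by (simp add: z_def m_lcomm)
  then have vz: "t (v \<otimes> z) = \<one>"
    using t_scale[OF iK(1), of "v \<otimes> y"] iK(2) LE(6) vL y by simp
  have uz: "t (u i \<otimes> z) \<in> K" if "i < n" for i using t_closed LE(6) un zL that by auto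
  define wn where "wn = z \<ominus> (\<Oplus>i \<in> {..<n}. t (u i \<otimes> z) \<otimes> w i)"
  have s2L: "(\<Oplus>i \<in> {..<n}. t (u i \<otimes> z) \<otimes> w i) \<in> L"
    using uz K_L w(1) LE(6) by (intro L_sum) auto
  have wnL: "wn \<in> L" unfolding wn_def a_minus_def using LE(5,7) s2L zL by auto
  have xwn: "t (x \<otimes> wn) = t (x \<otimes> z) \<ominus> (\<Oplus>i \<in> {..<n}. t (u i \<otimes> z) \<otimes> t (x \<otimes> w i))" if "x \<in> L" for x
    unfolding wn_def using t_minus_combination(2)[of "{..<n}" "\<lambda>i. t (u i \<otimes> z)" w z x] uz w(1) zL that by auto
  have uwn: "t (u j \<otimes> wn) = \<zero>" if j: "j < n" for j
  proof -
    have "(\<Oplus>i \<in> {..<n}. t (u i \<otimes> z) \<otimes> t (u j \<otimes> w i)) = t (u j \<otimes> z)"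
      by (rule sum_delta[OF j]) (use uz K_carrier w(2) j in auto)
    then show ?thesis using xwn[OF un(2)[OF j]] uz[OF j] K_carrier by (simp add: a_minus_def r_neg)
  qed
  have zero_sum: "(\<Oplus>i \<in> {..<n}. a i \<otimes> b i) = \<zero>"
    if "\<And>i. i < n \<Longrightarrow> a i \<in> K" "\<And>i. i < n \<Longrightarrow> b i = \<zero>" for a b
  proof -
    have "(\<Oplus>i \<in> {..<n}. a i \<otimes> b i) = (\<Oplus>i \<in> {..<n}. \<zero>)"
      by (rule finsum_cong') (use that K_carrier in auto)
    then show ?thesis by (simp add: finsum_zero)
  qed
  have "t (v \<otimes> wn) = \<one>"
    using xwn[OF vL] zero_sum[of "\<lambda>i. t (u i \<otimes> z)" "\<lambda>i. t (v \<otimes> w i)"] uz vw vz by (simp add: a_minus_def)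
  moreover have "t (v \<otimes> wn) = t (u n \<otimes> wn) \<ominus> (\<Oplus>i \<in> {..<n}. t (u n \<otimes> w i) \<otimes> t (u i \<otimes> wn))"
    unfolding v_def using t_minus_combination(1)[of "{..<n}" "\<lambda>i. t (u n \<otimes> w i)" u "u n" wn]
      uw un wnL by auto
  ultimately have unwn: "t (u n \<otimes> wn) = \<one>"
    using zero_sum[of "\<lambda>i. t (u n \<otimes> w i)" "\<lambda>i. t (u i \<otimes> wn)"] uw uwn t_carrier[OF LE(6)[OF un(1) wnL]]
    by (simp add: a_minus_def)
  \<comment> \<open>a sum with one summand, so that \<open>t_minus_combination\<close> applies\<close>
  define w' where "w' j = (if j < n then w j \<ominus> (\<Oplus>i \<in> {0::nat}. t (u n \<otimes> w j) \<otimes> wn) else wn)" for j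
  have sing: "(\<Oplus>i \<in> {0::nat}. c) = c" if "c \<in> carrier R" for c
    using that by (simp add: finsum_insert)
  have "w' j \<in> L \<and> (\<forall>i<Suc n. t (u i \<otimes> w' j) = (if i = j then \<one> else \<zero>))" if j: "j < Suc n" for j
  proof (cases "j < n")
    case True
    have cR: "t (u n \<otimes> w j) \<in> K" "t (u n \<otimes> w j) \<otimes> wn \<in> L"
      using uw[OF True] K_L wnL LE(6) by auto
    have "t (u i \<otimes> w' j) = t (u i \<otimes> w j) \<ominus> t (u n \<otimes> w j) \<otimes> t (u i \<otimes> wn)" if i: "i < Suc n" for i
      using t_minus_combination(2)[of "{0::nat}" "\<lambda>_. t (u n \<otimes> w j)" "\<lambda>_. wn" "w j" "u i"]
        cR(1) wnL w(1)[OF True] u[OF i] True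
        sing[of "t (u n \<otimes> w j) \<otimes> t (u i \<otimes> wn)"] K_carrier[OF cR(1)] t_carrier[OF LE(6)[OF u[OF i] wnL]]
      by (simp add: w'_def)
    then have "t (u i \<otimes> w' j) = (if i = j then \<one> else \<zero>)" if i: "i < Suc n" for i
      using i w(2)[OF _ True, of i] uwn[of i] unwn cR(1) K_carrier True
      by (cases "i = n") (auto simp: a_minus_def r_neg)
    moreover have "w' j \<in> L"
      using True sing[OF L_carrier[OF cR(2)]] w(1)[OF True] cR(2) LE(5,7) by (simp add: w'_def a_minus_def)
    ultimately show ?thesis by blast
  next
    case False
    then have "j = n" using j by simp
    then show ?thesis using wnL uwn unwn by (auto simp: w'_def less_Suc_eq)
  qed
  then show ?case by blast
qed auto

text \<open>In dual bases the \<open>i\<close>-th coordinate of \<open>v\<close> is \<open>t(vw\<^sub>i)\<close>; the trace is the sum of the diagonal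
  entries \<open>t(xu\<^sub>iw\<^sub>i)\<close>.\<close>

lemma trace_dual_basis:
  assumes fd: "finite_dimension K L"
  shows "\<exists>(n::nat) u w. (\<forall>i<n. u i \<in> L) \<and> (\<forall>i<n. w i \<in> L)
    \<and> (\<forall>v \<in> L. v = (\<Oplus>i \<in> {..<n}. t (v \<otimes> w i) \<otimes> u i))
    \<and> (\<forall>x \<in> L. field_trace R K L x = (\<Oplus>i \<in> {..<n}. t (x \<otimes> u i \<otimes> w i)))"
proof -
  define Us where "Us = (SOME Us. basis_of R K L Us)"
  obtain d where "dimension d K L" using fd by auto
  then have "\<exists>Us. basis_of R K L Us" using exists_base[OF K] by (auto simp: basis_of_def)
  then have "basis_of R K L Us" unfolding Us_def by (rule someI_ex)
  then have Us: "independent K Us" "Span K Us = L" by (auto simp: basis_of_def)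
  define n where "n = length Us"
  define u where "u i = Us ! i" for i
  have UsR: "set Us \<subseteq> carrier R" using independent_in_carrier[OF Us(1)] .
  have UsL: "set Us \<subseteq> L" using Span_base_incl[OF K UsR] Us(2) by simp
  have uL: "u i \<in> L" if "i < n" for i using UsL that by (auto simp: u_def n_def)
  have ind: "\<forall>i<n. k i = \<zero>"
    if k: "\<And>i. i < n \<Longrightarrow> k i \<in> K" "(\<Oplus>i \<in> {..<n}. k i \<otimes> u i) = \<zero>" for k
  proof -
    let ?Ks = "map k [0..<n]"
    have KsK: "set ?Ks \<subseteq> K" using k(1) by auto
    have "combine ?Ks Us = (\<Oplus>i \<in> {..<n}. ?Ks ! i \<otimes> Us ! i)"
      using combine_eq_finsum[of ?Ks Us] KsK KE(1) UsR by (simp add: n_def)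
    also have "\<dots> = (\<Oplus>i \<in> {..<n}. k i \<otimes> u i)"
      using k(1) K_carrier uL L_carrier by (intro finsum_cong') (auto simp: u_def)
    finally have "combine ?Ks Us = \<zero>" using k(2) by simp
    then have "set (take (length Us) ?Ks) \<subseteq> {\<zero>}"
      using independent_imp_trivial_combine[OF K Us(1) KsK] by simp
    then show ?thesis by (auto simp: n_def image_subset_iff)
  qed
  have "\<exists>w. \<forall>j<n. w j \<in> L \<and> (\<forall>i<n. t (u i \<otimes> w j) = (if i = j then \<one> else \<zero>))"
    by (rule dual_basis) (use uL ind in blast)+
  then obtain w where w: "\<And>j. j < n \<Longrightarrow> w j \<in> L"
    "\<And>i j. i < n \<Longrightarrow> j < n \<Longrightarrow> t (u i \<otimes> w j) = (if i = j then \<one> else \<zero>)"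
    by blast
  have coord: "Ks ! j = t (v \<otimes> w j)"
    if Ks: "length Ks = n" "set Ks \<subseteq> K" "combine Ks Us = v" and j: "j < n" for Ks v j
  proof -
    have KsK: "Ks ! i \<in> K" if "i < n" for i using Ks that by auto
    have "set Ks \<subseteq> carrier R" using Ks(2) KE(1) by blast
    then have "v = (\<Oplus>i \<in> {..<n}. Ks ! i \<otimes> u i)"
      using combine_eq_finsum[of Ks Us] Ks(1,3) UsR by (simp add: n_def u_def)
    then have "t (v \<otimes> w j) = (\<Oplus>i \<in> {..<n}. Ks ! i \<otimes> t (u i \<otimes> w j))"
      using t_combination[of "{..<n}" "(!) Ks" u "w j"] KsK uL w(1)[OF j] by auto
    also have "\<dots> = Ks ! j"
      by (rule sum_delta[OF j]) (use KsK K_carrier w(2) j in auto)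
    finally show ?thesis by simp
  qed
  have ex: "\<exists>Ks. length Ks = n \<and> set Ks \<subseteq> K \<and> combine Ks Us = v" if "v \<in> L" for v
    using Span_mem_iff_length_version[OF K UsR, of v] that Us(2) by (auto simp: n_def)
  have exp: "v = (\<Oplus>i \<in> {..<n}. t (v \<otimes> w i) \<otimes> u i)" if v: "v \<in> L" for v
  proof -
    obtain Ks where Ks: "length Ks = n" "set Ks \<subseteq> K" "combine Ks Us = v" using ex[OF v] by blast
    have "set Ks \<subseteq> carrier R" using Ks(2) KE(1) by blast
    then have "v = (\<Oplus>i \<in> {..<n}. Ks ! i \<otimes> Us ! i)"
      using combine_eq_finsum[of Ks Us] Ks(1,3) UsR by (simp add: n_def)
    also have "\<dots> = (\<Oplus>i \<in> {..<n}. t (v \<otimes> w i) \<otimes> u i)"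
      using coord[OF Ks] t_closed K_carrier uL L_carrier w(1) LE(6) v
      by (intro finsum_cong') (auto simp: u_def)
    finally show ?thesis .
  qed
  have co: "coordinates R K Us v ! j = t (v \<otimes> w j)" if v: "v \<in> L" and j: "j < n" for v j
  proof -
    have "\<exists>!Ks. length Ks = length Us \<and> set Ks \<subseteq> K \<and> combine Ks Us = v"
    proof (rule ex_ex1I)
      show "\<exists>Ks. length Ks = length Us \<and> set Ks \<subseteq> K \<and> combine Ks Us = v" using ex[OF v] by (simp add: n_def)
      fix Ks Ks' assume a: "length Ks = length Us \<and> set Ks \<subseteq> K \<and> combine Ks Us = v"
        "length Ks' = length Us \<and> set Ks' \<subseteq> K \<and> combine Ks' Us = v"
      show "Ks = Ks'"
        by (rule nth_equalityI) (use a coord[of Ks v] coord[of Ks' v] in \<open>auto simp: n_def\<close>)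
    qed
    then have "length (coordinates R K Us v) = length Us \<and> set (coordinates R K Us v) \<subseteq> K
        \<and> combine (coordinates R K Us v) Us = v"
      unfolding coordinates_def by (rule theI')
    then show ?thesis using coord[of "coordinates R K Us v" v j] j by (simp add: n_def)
  qed
  have "field_trace R K L x = (\<Oplus>i \<in> {..<n}. t (x \<otimes> u i \<otimes> w i))" if x: "x \<in> L" for x
  proof -
    have "field_trace R K L x = (\<Oplus>i \<in> {..<n}. coordinates R K Us (x \<otimes> Us ! i) ! i)"
      by (simp add: field_trace_def Us_def n_def Let_def)
    also have "\<dots> = (\<Oplus>i \<in> {..<n}. t (x \<otimes> u i \<otimes> w i))"
    proof (rule finsum_cong')
      fix i assume "i \<in> {..<n}"
      then show "coordinates R K Us (x \<otimes> Us ! i) ! i = t (x \<otimes> u i \<otimes> w i)"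
        using co[of "x \<otimes> Us ! i" i] LE(6) x uL by (auto simp: u_def)
    qed (use t_carrier LE(6) x uL w(1) in auto)
    finally show ?thesis .
  qed
  then show ?thesis using uL w(1) exp by (intro exI[of _ n] exI[of _ u] exI[of _ w]) blast
qed

end

lemma (in domain) zero_prime: "subring_prime R (carrier R) {\<zero>}"
  by (intro subring_prime.intro subring_prime_axioms.intro domain_axioms carrier_is_subring)
    (use integral in \<open>auto simp: prime_in_def\<close>)

text \<open>Let \<open>C\<close> be a set of homomorphisms \<open>L \<rightarrow> S\<close> that agree on \<open>K\<close> and whose sum has its
  values in \<open>K\<close>. By Dedekind's lemma the sum \<open>t\<close> defines a nondegenerate form. With dual bases
  \<open>u\<^sub>i\<close>, \<open>w\<^sub>i\<close> for it, Dedekind's lemma applied to \<open>\<sigma>(v) = \<Sum>\<^sub>i t(vw\<^sub>i) \<sigma>(u\<^sub>i)\<close> gives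
  \<open>\<Sum>\<^sub>i \<sigma>(w\<^sub>i) \<sigma>(u\<^sub>i) = 1\<close>, and so the trace \<open>\<Sum>\<^sub>i t(xu\<^sub>iw\<^sub>i)\<close> equals \<open>t(x)\<close>.\<close>

theorem (in field) field_trace_eq_sum:
  assumes S: "field S" and K: "subfield K R" and L: "subfield L R" and KL: "K \<subseteq> L"
    and fd: "finite_dimension K L" and C: "finite C"
    and hom: "\<And>\<tau>. \<tau> \<in> C \<Longrightarrow> \<tau> \<in> ring_hom (R\<lparr>carrier := L\<rparr>) S"
    and dist: "\<And>\<sigma> \<tau>. \<sigma> \<in> C \<Longrightarrow> \<tau> \<in> C \<Longrightarrow> \<sigma> \<noteq> \<tau> \<Longrightarrow> \<exists>x \<in> L. \<sigma> x \<noteq> \<tau> x"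
    and \<iota>: "\<iota> \<in> C" and agree: "\<And>\<tau> k. \<tau> \<in> C \<Longrightarrow> k \<in> K \<Longrightarrow> \<tau> k = \<iota> k"
    and sum: "\<And>x. x \<in> L \<Longrightarrow> (\<Oplus>\<^bsub>S\<^esub>\<tau> \<in> C. \<tau> x) \<in> \<iota> ` K"
    and x: "x \<in> L"
  shows "field_trace R K L x \<in> K \<and> \<iota> (field_trace R K L x) = (\<Oplus>\<^bsub>S\<^esub>\<tau> \<in> C. \<tau> x)"
proof -
  interpret S: field S by fact
  interpret Z: subring_prime S "carrier S" "{\<zero>\<^bsub>S\<^esub>}" by (rule S.zero_prime)
  note LE = subringE[OF subfieldE(1)[OF L]] and KE = subringE[OF subfieldE(1)[OF K]]
  have LR: "\<And>y. y \<in> L \<Longrightarrow> y \<in> carrier R" and KR: "\<And>y. y \<in> K \<Longrightarrow> y \<in> carrier R" using LE(1) KE(1) by auto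
  have KL': "\<And>y. y \<in> K \<Longrightarrow> y \<in> L" using KL by auto
  have hc: "\<tau> y \<in> carrier S" if "\<tau> \<in> C" "y \<in> L" for \<tau> y using ring_hom_memE(1)[OF hom[OF that(1)]] that(2) by simp
  have hm: "\<tau> (y \<otimes> z) = \<tau> y \<otimes>\<^bsub>S\<^esub> \<tau> z" if "\<tau> \<in> C" "y \<in> L" "z \<in> L" for \<tau> y z
    using ring_hom_memE(2)[OF hom[OF that(1)]] that(2,3) by simp
  have ha: "\<tau> (y \<oplus> z) = \<tau> y \<oplus>\<^bsub>S\<^esub> \<tau> z" if "\<tau> \<in> C" "y \<in> L" "z \<in> L" for \<tau> y z
    using ring_hom_memE(3)[OF hom[OF that(1)]] that(2,3) by simp
  have h1: "\<tau> \<one> = \<one>\<^bsub>S\<^esub>" if "\<tau> \<in> C" for \<tau> using ring_hom_memE(4)[OF hom[OF that]] by simp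
  have h0: "\<tau> \<zero> = \<zero>\<^bsub>S\<^esub>" if "\<tau> \<in> C" for \<tau>
    using hom_zero[OF S.ring_axioms subfieldE(1)[OF L] hom[OF that]] .
  have hsum: "\<tau> (finsum R f I) = (\<Oplus>\<^bsub>S\<^esub>i \<in> I. \<tau> (f i))"
    if \<tau>: "\<tau> \<in> C" and f: "\<And>i. i \<in> I \<Longrightarrow> f i \<in> L" and I: "finite I" for \<tau> f and I :: "nat set"
    using I f
  proof (induct I)
    case (insert i I)
    have "finsum R f I \<in> L" using insert.prems finsum_mem[of L I f] LE by blast
    then show ?case
      using insert ha[OF \<tau>, of "f i" "finsum R f I"] LR hc[OF \<tau>]
      by (simp add: finsum_insert S.finsum_insert Pi_def)
  qed (use h0[OF \<tau>] in simp)
  have inj: "\<iota> y = \<iota> z \<Longrightarrow> y = z" if "y \<in> L" "z \<in> L" for y z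
    using non_trivial_field_hom_is_inj[OF hom[OF \<iota>] subfield_iff(2)[OF L] S] that by (auto simp: inj_on_def)
  have ded: "\<forall>\<tau> \<in> C. c \<tau> = \<zero>\<^bsub>S\<^esub>"
    if c: "\<And>\<tau>. \<tau> \<in> C \<Longrightarrow> c \<tau> \<in> carrier S" "\<And>a. a \<in> L \<Longrightarrow> (\<Oplus>\<^bsub>S\<^esub>\<tau> \<in> C. c \<tau> \<otimes>\<^bsub>S\<^esub> \<tau> a) = \<zero>\<^bsub>S\<^esub>" for c
  proof -
    have "\<forall>\<tau> \<in> C. c \<tau> \<in> {\<zero>\<^bsub>S\<^esub>}"
    proof (rule Z.dedekind_independence[where A = L and e = \<one> and mul = "(\<otimes>)"])
      show "\<exists>a \<in> L. \<sigma> a \<ominus>\<^bsub>S\<^esub> \<tau> a \<notin> {\<zero>\<^bsub>S\<^esub>}" if "\<sigma> \<in> C" "\<tau> \<in> C" "\<sigma> \<noteq> \<tau>" for \<sigma> \<tau>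
        using dist[OF that] hc that by auto
    qed (use C LE c hc hm h1 in auto)
    then show ?thesis by simp
  qed
  define t where "t y = inv_into K \<iota> (\<Oplus>\<^bsub>S\<^esub>\<tau> \<in> C. \<tau> y)" for y
  have tK: "t y \<in> K" and \<iota>t: "\<iota> (t y) = (\<Oplus>\<^bsub>S\<^esub>\<tau> \<in> C. \<tau> y)" if "y \<in> L" for y
    using inv_into_into[OF sum[OF that]] f_inv_into_f[OF sum[OF that]] by (auto simp: t_def)
  have tadd: "t (y \<oplus> z) = t y \<oplus> t z" if yz: "y \<in> L" "z \<in> L" for y z
  proof (rule inj)
    have "\<iota> (t (y \<oplus> z)) = (\<Oplus>\<^bsub>S\<^esub>\<tau> \<in> C. \<tau> y \<oplus>\<^bsub>S\<^esub> \<tau> z)"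
      unfolding \<iota>t[OF LE(7)[OF yz]] using ha hc yz by (intro S.finsum_cong') auto
    also have "\<dots> = (\<Oplus>\<^bsub>S\<^esub>\<tau> \<in> C. \<tau> y) \<oplus>\<^bsub>S\<^esub> (\<Oplus>\<^bsub>S\<^esub>\<tau> \<in> C. \<tau> z)"
      using hc yz by (intro S.finsum_addf) auto
    finally show "\<iota> (t (y \<oplus> z)) = \<iota> (t y \<oplus> t z)"
      using ha[OF \<iota>] tK yz KL' \<iota>t by simp
  qed (use tK yz KL' LE(7) in auto)
  have tscale: "t (k \<otimes> y) = k \<otimes> t y" if k: "k \<in> K" and y: "y \<in> L" for k y
  proof (rule inj)
    have "\<iota> (t (k \<otimes> y)) = (\<Oplus>\<^bsub>S\<^esub>\<tau> \<in> C. \<iota> k \<otimes>\<^bsub>S\<^esub> \<tau> y)"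
      unfolding \<iota>t[OF LE(6)[OF KL'[OF k] y]]
    proof (rule S.finsum_cong')
      show "\<tau> (k \<otimes> y) = \<iota> k \<otimes>\<^bsub>S\<^esub> \<tau> y" if "\<tau> \<in> C" for \<tau>
        using hm[OF that KL'[OF k] y] agree[OF that k] by simp
    qed (use hc[OF \<iota> KL'[OF k]] hc y in auto)
    also have "\<dots> = \<iota> k \<otimes>\<^bsub>S\<^esub> (\<Oplus>\<^bsub>S\<^esub>\<tau> \<in> C. \<tau> y)"
      using hc y \<iota> k KL' C by (intro S.finsum_rdistr[symmetric]) auto
    finally show "\<iota> (t (k \<otimes> y)) = \<iota> (k \<otimes> t y)"
      using hm[OF \<iota>] tK y k KL' \<iota>t by simp
  qed (use tK y k KL' LE(6) in auto)
  have tnd: "\<exists>z \<in> L. t (y \<otimes> z) \<noteq> \<zero>" if y: "y \<in> L" "y \<noteq> \<zero>" for y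
  proof (rule ccontr)
    assume n: "\<not> ?thesis"
    have "\<forall>\<tau> \<in> C. \<tau> y = \<zero>\<^bsub>S\<^esub>"
    proof (rule ded)
      fix a assume a: "a \<in> L"
      have "(\<Oplus>\<^bsub>S\<^esub>\<tau> \<in> C. \<tau> y \<otimes>\<^bsub>S\<^esub> \<tau> a) = \<iota> (t (y \<otimes> a))"
        unfolding \<iota>t[OF LE(6)[OF y(1) a]] using hm hc hc[OF _ LE(6)[OF y(1) a]] y(1) a
        by (intro S.finsum_cong') auto
      then show "(\<Oplus>\<^bsub>S\<^esub>\<tau> \<in> C. \<tau> y \<otimes>\<^bsub>S\<^esub> \<tau> a) = \<zero>\<^bsub>S\<^esub>" using n a h0[OF \<iota>] by auto
    qed (use hc y in auto)
    then have "\<iota> y = \<iota> \<zero>" using \<iota> h0 by auto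
    then show False using inj[OF y(1) LE(2)] y(2) by simp
  qed
  interpret nondegenerate_functional R K L t
    by (intro nondegenerate_functional.intro nondegenerate_functional_axioms.intro field_axioms
        K L KL tK tadd tscale tnd)
  obtain n :: nat and u w where b': "\<forall>i<n. u i \<in> L" "\<forall>i<n. w i \<in> L"
    "\<forall>v \<in> L. v = (\<Oplus>i \<in> {..<n}. t (v \<otimes> w i) \<otimes> u i)"
    "\<forall>x \<in> L. field_trace R K L x = (\<Oplus>i \<in> {..<n}. t (x \<otimes> u i \<otimes> w i))"
    using trace_dual_basis[OF fd] by (elim exE conjE) (rule that)
  note b = b'(1,2)[rule_format] bspec[OF b'(3)] bspec[OF b'(4)]
  \<comment> \<open>\<open>\<Sum>\<^sub>i \<tau>(w\<^sub>i) \<sigma>(u\<^sub>i)\<close> is \<open>1\<close> for \<open>\<tau> = \<sigma>\<close> and \<open>0\<close> otherwise: compare coefficients of the characters\<close>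
  have unit: "(\<Oplus>\<^bsub>S\<^esub>i \<in> {..<n}. \<sigma> (w i) \<otimes>\<^bsub>S\<^esub> \<sigma> (u i)) = \<one>\<^bsub>S\<^esub>" if \<sigma>: "\<sigma> \<in> C" for \<sigma>
  proof -
    let ?e = "\<lambda>\<tau>. \<Oplus>\<^bsub>S\<^esub>i \<in> {..<n}. \<tau> (w i) \<otimes>\<^bsub>S\<^esub> \<sigma> (u i)"
    let ?d = "\<lambda>\<tau>. if \<sigma> = \<tau> then \<one>\<^bsub>S\<^esub> else \<zero>\<^bsub>S\<^esub>"
    have pS: "\<tau> (w i) \<otimes>\<^bsub>S\<^esub> \<sigma> (u i) \<in> carrier S" if "\<tau> \<in> C" "i < n" for \<tau> i using hc \<sigma> b(1,2) that by auto
    have eS: "?e \<tau> \<in> carrier S" if "\<tau> \<in> C" for \<tau> using pS[OF that] by (intro S.finsum_closed) auto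
    have "\<forall>\<tau> \<in> C. ?e \<tau> \<ominus>\<^bsub>S\<^esub> ?d \<tau> = \<zero>\<^bsub>S\<^esub>"
    proof (rule ded)
      show "?e \<tau> \<ominus>\<^bsub>S\<^esub> ?d \<tau> \<in> carrier S" if "\<tau> \<in> C" for \<tau> using eS[OF that] by simp
      fix v assume v: "v \<in> L"
      have vw: "v \<otimes> w i \<in> L" if "i < n" for i using v b(2) LE(6) that by simp
      have "\<sigma> v = \<sigma> (\<Oplus>i \<in> {..<n}. t (v \<otimes> w i) \<otimes> u i)" using b(3)[OF v] by simp
      also have "\<dots> = (\<Oplus>\<^bsub>S\<^esub>i \<in> {..<n}. \<sigma> (t (v \<otimes> w i) \<otimes> u i))"
        by (rule hsum[OF \<sigma>]) (use tK vw KL' b(1) LE(6) in auto)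
      also have "\<dots> = (\<Oplus>\<^bsub>S\<^esub>i \<in> {..<n}. \<Oplus>\<^bsub>S\<^esub>\<tau> \<in> C. \<tau> v \<otimes>\<^bsub>S\<^esub> (\<tau> (w i) \<otimes>\<^bsub>S\<^esub> \<sigma> (u i)))"
      proof (rule S.finsum_cong')
        fix i assume "i \<in> {..<n}"
        then have i: "i < n" by simp
        have "\<sigma> (t (v \<otimes> w i) \<otimes> u i) = \<iota> (t (v \<otimes> w i)) \<otimes>\<^bsub>S\<^esub> \<sigma> (u i)"
          using hm[OF \<sigma> KL'[OF tK[OF vw[OF i]]] b(1)[OF i]] agree[OF \<sigma> tK[OF vw[OF i]]] by simp
        also have "\<dots> = (\<Oplus>\<^bsub>S\<^esub>\<tau> \<in> C. \<tau> (v \<otimes> w i) \<otimes>\<^bsub>S\<^esub> \<sigma> (u i))"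
          unfolding \<iota>t[OF vw[OF i]] using hc vw[OF i] \<sigma> b(1)[OF i] C by (intro S.finsum_ldistr) auto
        also have "\<dots> = (\<Oplus>\<^bsub>S\<^esub>\<tau> \<in> C. \<tau> v \<otimes>\<^bsub>S\<^esub> (\<tau> (w i) \<otimes>\<^bsub>S\<^esub> \<sigma> (u i)))"
        proof (rule S.finsum_cong')
          fix \<tau> assume \<tau>: "\<tau> \<in> C"
          show "\<tau> (v \<otimes> w i) \<otimes>\<^bsub>S\<^esub> \<sigma> (u i) = \<tau> v \<otimes>\<^bsub>S\<^esub> (\<tau> (w i) \<otimes>\<^bsub>S\<^esub> \<sigma> (u i))"
            using hm[OF \<tau> v b(2)[OF i]] hc[OF \<tau> v] hc[OF \<tau> b(2)[OF i]] hc[OF \<sigma> b(1)[OF i]]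
            by (simp add: S.m_assoc)
        qed (use hc v pS i in auto)
        finally show "\<sigma> (t (v \<otimes> w i) \<otimes> u i) = (\<Oplus>\<^bsub>S\<^esub>\<tau> \<in> C. \<tau> v \<otimes>\<^bsub>S\<^esub> (\<tau> (w i) \<otimes>\<^bsub>S\<^esub> \<sigma> (u i)))" .
      qed (use hc v pS in \<open>auto intro!: S.finsum_closed\<close>)
      also have "\<dots> = (\<Oplus>\<^bsub>S\<^esub>\<tau> \<in> C. \<Oplus>\<^bsub>S\<^esub>i \<in> {..<n}. \<tau> v \<otimes>\<^bsub>S\<^esub> (\<tau> (w i) \<otimes>\<^bsub>S\<^esub> \<sigma> (u i)))"
        by (rule S.finsum_swap) (use C hc v pS in auto)
      also have "\<dots> = (\<Oplus>\<^bsub>S\<^esub>\<tau> \<in> C. \<tau> v \<otimes>\<^bsub>S\<^esub> ?e \<tau>)"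
        using hc v pS by (intro S.finsum_cong') (auto intro!: S.finsum_rdistr[symmetric] S.finsum_closed)
      finally have 1: "\<sigma> v = (\<Oplus>\<^bsub>S\<^esub>\<tau> \<in> C. \<tau> v \<otimes>\<^bsub>S\<^esub> ?e \<tau>)" .
      have 2: "(\<Oplus>\<^bsub>S\<^esub>\<tau> \<in> C. if \<sigma> = \<tau> then \<ominus>\<^bsub>S\<^esub> (\<tau> v) else \<zero>\<^bsub>S\<^esub>) = \<ominus>\<^bsub>S\<^esub> (\<sigma> v)"
        by (rule S.finsum_singleton[OF \<sigma> C]) (use hc v in auto)
      have "(\<Oplus>\<^bsub>S\<^esub>\<tau> \<in> C. (?e \<tau> \<ominus>\<^bsub>S\<^esub> ?d \<tau>) \<otimes>\<^bsub>S\<^esub> \<tau> v)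
          = (\<Oplus>\<^bsub>S\<^esub>\<tau> \<in> C. \<tau> v \<otimes>\<^bsub>S\<^esub> ?e \<tau> \<oplus>\<^bsub>S\<^esub> (if \<sigma> = \<tau> then \<ominus>\<^bsub>S\<^esub> (\<tau> v) else \<zero>\<^bsub>S\<^esub>))"
      proof (rule S.finsum_cong')
        fix \<tau> assume \<tau>: "\<tau> \<in> C"
        show "(?e \<tau> \<ominus>\<^bsub>S\<^esub> ?d \<tau>) \<otimes>\<^bsub>S\<^esub> \<tau> v
            = \<tau> v \<otimes>\<^bsub>S\<^esub> ?e \<tau> \<oplus>\<^bsub>S\<^esub> (if \<sigma> = \<tau> then \<ominus>\<^bsub>S\<^esub> (\<tau> v) else \<zero>\<^bsub>S\<^esub>)"
          using eS[OF \<tau>] hc[OF \<tau> v]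
          by (cases "\<sigma> = \<tau>") (auto simp: a_minus_def S.r_distr S.r_minus S.m_comm)
      qed (use eS hc v in auto)
      also have "\<dots> = \<sigma> v \<oplus>\<^bsub>S\<^esub> \<ominus>\<^bsub>S\<^esub> (\<sigma> v)"
        using eS hc v by (subst S.finsum_addf) (auto simp: 1[symmetric] 2)
      finally show "(\<Oplus>\<^bsub>S\<^esub>\<tau> \<in> C. (?e \<tau> \<ominus>\<^bsub>S\<^esub> ?d \<tau>) \<otimes>\<^bsub>S\<^esub> \<tau> v) = \<zero>\<^bsub>S\<^esub>"
        using hc[OF \<sigma> v] by (simp add: S.r_neg)
    qed
    then have "?e \<sigma> \<ominus>\<^bsub>S\<^esub> \<one>\<^bsub>S\<^esub> = \<zero>\<^bsub>S\<^esub>" using \<sigma> by auto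
    then show ?thesis using eS[OF \<sigma>] by simp
  qed
  have uw: "x \<otimes> u i \<otimes> w i \<in> L" if "i < n" for i using x b(1,2) LE(6) that by simp
  have tr: "field_trace R K L x = (\<Oplus>i \<in> {..<n}. t (x \<otimes> u i \<otimes> w i))" using b(4)[OF x] .
  have "field_trace R K L x \<in> K"
    unfolding tr by (rule finsum_mem) (use KE(1,2,7) tK uw in auto)
  moreover have "\<iota> (field_trace R K L x) = (\<Oplus>\<^bsub>S\<^esub>\<tau> \<in> C. \<tau> x)"
  proof -
    have "\<iota> (field_trace R K L x) = (\<Oplus>\<^bsub>S\<^esub>i \<in> {..<n}. \<iota> (t (x \<otimes> u i \<otimes> w i)))"
      unfolding tr by (rule hsum[OF \<iota>]) (use tK uw KL' in auto)
    also have "\<dots> = (\<Oplus>\<^bsub>S\<^esub>i \<in> {..<n}. \<Oplus>\<^bsub>S\<^esub>\<tau> \<in> C. \<tau> x \<otimes>\<^bsub>S\<^esub> (\<tau> (w i) \<otimes>\<^bsub>S\<^esub> \<tau> (u i)))"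
    proof (rule S.finsum_cong')
      fix i assume "i \<in> {..<n}"
      then have i: "i < n" by simp
      show "\<iota> (t (x \<otimes> u i \<otimes> w i)) = (\<Oplus>\<^bsub>S\<^esub>\<tau> \<in> C. \<tau> x \<otimes>\<^bsub>S\<^esub> (\<tau> (w i) \<otimes>\<^bsub>S\<^esub> \<tau> (u i)))"
        unfolding \<iota>t[OF uw[OF i]]
      proof (rule S.finsum_cong')
        fix \<tau> assume \<tau>: "\<tau> \<in> C"
        show "\<tau> (x \<otimes> u i \<otimes> w i) = \<tau> x \<otimes>\<^bsub>S\<^esub> (\<tau> (w i) \<otimes>\<^bsub>S\<^esub> \<tau> (u i))"
          using hm[OF \<tau> LE(6)[OF x b(1)[OF i]] b(2)[OF i]] hm[OF \<tau> x b(1)[OF i]]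
            hc[OF \<tau> x] hc[OF \<tau> b(2)[OF i]] hc[OF \<tau> b(1)[OF i]]
          by (simp add: S.m_ac)
      qed (use hc x b(1,2) i in auto)
    qed (use hc x b(1,2) in \<open>auto intro!: S.finsum_closed\<close>)
    also have "\<dots> = (\<Oplus>\<^bsub>S\<^esub>\<tau> \<in> C. \<Oplus>\<^bsub>S\<^esub>i \<in> {..<n}. \<tau> x \<otimes>\<^bsub>S\<^esub> (\<tau> (w i) \<otimes>\<^bsub>S\<^esub> \<tau> (u i)))"
      by (rule S.finsum_swap) (use C hc x b(1,2) in auto)
    also have "\<dots> = (\<Oplus>\<^bsub>S\<^esub>\<tau> \<in> C. \<tau> x)"
    proof (rule S.finsum_cong')
      fix \<tau> assume \<tau>: "\<tau> \<in> C"
      have "(\<Oplus>\<^bsub>S\<^esub>i \<in> {..<n}. \<tau> x \<otimes>\<^bsub>S\<^esub> (\<tau> (w i) \<otimes>\<^bsub>S\<^esub> \<tau> (u i)))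
          = \<tau> x \<otimes>\<^bsub>S\<^esub> (\<Oplus>\<^bsub>S\<^esub>i \<in> {..<n}. \<tau> (w i) \<otimes>\<^bsub>S\<^esub> \<tau> (u i))"
        using hc \<tau> x b(1,2) by (intro S.finsum_rdistr[symmetric]) auto
      then show "(\<Oplus>\<^bsub>S\<^esub>i \<in> {..<n}. \<tau> x \<otimes>\<^bsub>S\<^esub> (\<tau> (w i) \<otimes>\<^bsub>S\<^esub> \<tau> (u i))) = \<tau> x"
        using unit[OF \<tau>] hc[OF \<tau> x] by simp
    qed (use hc x in auto)
    finally show ?thesis .
  qed
  ultimately show ?thesis by blast
qed

section \<open>Tame ramification and inertia\<close>

context field
begin

lemma integral_image:
  assumes S: "ring S" and N: "subring N R" and h: "h \<in> ring_hom (R\<lparr>carrier := N\<rparr>) S" and B: "B \<subseteq> N"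
    and h0: "\<And>b. b \<in> B \<Longrightarrow> h b = \<zero>\<^bsub>S\<^esub> \<Longrightarrow> b = \<zero>"
    and x: "x \<in> integral_closure R B N" "h x \<in> M"
  shows "h x \<in> integral_closure S (h ` B) M"
proof -
  interpret S: ring S by fact
  obtain f where f: "f \<in> carrier (B[X])" "f \<noteq> []" "lead_coeff f = \<one>" "eval f x = \<zero>" "x \<in> N"
    using x(1) by (auto simp: integral_closure_def)
  have fB: "set f \<subseteq> B" using set_poly_subset[OF f(1)] .
  have "lead_coeff (map h f) = \<one>\<^bsub>S\<^esub>" using f(2,3) ring_hom_memE(4)[OF h] by (simp add: hd_map)
  moreover have "lead_coeff (map h f) \<noteq> \<zero>\<^bsub>S\<^esub>"
  proof -
    have "lead_coeff f \<in> B" using fB hd_in_set[OF f(2)] by blast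
    moreover have "lead_coeff f \<noteq> \<zero>" using f(1,2) by (simp add: univ_poly_carrier[symmetric] polynomial_def)
    ultimately show ?thesis using h0 f(2) by (auto simp: hd_map)
  qed
  then have "map h f \<in> carrier ((h ` B)[X]\<^bsub>S\<^esub>)"
    using fB by (auto simp: univ_poly_carrier[symmetric] polynomial_def)
  moreover have "S.eval (map h f) (h x) = \<zero>\<^bsub>S\<^esub>"
    using hom_root[OF S N h _ f(5,4)] fB B by auto
  ultimately show ?thesis using f(2) x(2) unfolding integral_closure_def
    by (intro CollectI conjI bexI[of _ "map h f"]) auto
qed

lemma integral_preimage:
  assumes S: "ring S" and N: "subring N R" and h: "h \<in> ring_hom (R\<lparr>carrier := N\<rparr>) S" and B: "B \<subseteq> N"
    and inj: "inj_on h N" and one: "\<one> \<in> B"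
    and x: "x \<in> N" "h x \<in> integral_closure S (h ` B) M"
  shows "x \<in> integral_closure R B N"
proof -
  interpret S: ring S by fact
  obtain f where f: "f \<in> carrier ((h ` B)[X]\<^bsub>S\<^esub>)" "f \<noteq> []" "lead_coeff f = \<one>\<^bsub>S\<^esub>" "S.eval f (h x) = \<zero>\<^bsub>S\<^esub>"
    using x(2) by (auto simp: integral_closure_def)
  have "set f \<subseteq> h ` B" using S.polynomial_incl f(1) unfolding univ_poly_carrier[symmetric] by blast
  then have "f = map h (map (inv_into B h) f)" "set (map (inv_into B h) f) \<subseteq> B"
    using f_inv_into_f[of _ h B] inv_into_into[of _ h B] by (auto simp: subset_iff intro!: map_idI[symmetric])
  then obtain p where p: "set p \<subseteq> B" "f = map h p" by metis
  note NE = subringE[OF N]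
  have pne: "p \<noteq> []" using f(2) p(2) by auto
  have "h (lead_coeff p) = h \<one>" using f(3) p(2) pne ring_hom_memE(4)[OF h] by (simp add: hd_map)
  then have lp: "lead_coeff p = \<one>"
    using inj_onD[OF inj, of "lead_coeff p" \<one>] p(1) hd_in_set[OF pne] B NE(3) by blast
  then have "p \<in> carrier (B[X])" using p(1) pne by (simp add: univ_poly_carrier[symmetric] polynomial_def)
  moreover have "eval p x = \<zero>"
  proof -
    have pN: "set p \<subseteq> N" using p(1) B by auto
    have "h (eval p x) = h \<zero>" using hom_eval[OF S N h pN x(1)] f(4) p(2) hom_zero[OF S N h] by simp
    then show ?thesis using inj_onD[OF inj] eval_mem_subring[OF N pN x(1)] NE(2) by blast
  qed
  ultimately show ?thesis using x(1) pne lp by (auto simp: integral_closure_def)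
qed

end

text \<open>The extension \<open>L/K\<close> lives in \<open>E\<close> and is embedded by \<open>\<iota>\<close> into a field \<open>M\<close> with a finite group
  \<open>G\<close> of automorphisms and fixed field \<open>\<iota>(K)\<close>. The rings are
  the integral closures of a common ring \<open>A\<close>, of which \<open>K\<close> need not be the field of fractions.\<close>

locale embedded_extension = E: field E + W: aut_group W M G
  for E (structure) and W (structure) and M G +
  fixes \<iota> K L A
  assumes \<iota>: "\<iota> \<in> ring_hom E W"
    and K: "subfield K E" and L: "subfield L E" and KL: "K \<subseteq> L"
    and fd: "E.finite_dimension K L"
    and \<iota>L: "\<iota> ` L \<subseteq> M"
    and fixK: "g \<in> G \<Longrightarrow> k \<in> K \<Longrightarrow> g (\<iota> k) = \<iota> k"
    and fixed: "x \<in> M \<Longrightarrow> (\<And>g. g \<in> G \<Longrightarrow> g x = x) \<Longrightarrow> x \<in> \<iota> ` K"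
    and A: "subring A E" "A \<subseteq> K"
begin

definition RK where "RK = integral_closure E A K"
definition RL where "RL = integral_closure E A L"
definition T where "T = integral_closure W (\<iota> ` A) M"

lemmas LE = subringE[OF subfieldE(1)[OF L]]

lemma L_carrier: "x \<in> L \<Longrightarrow> x \<in> carrier E" using LE(1) by auto
lemma K_L: "x \<in> K \<Longrightarrow> x \<in> L" using KL by auto
lemma \<iota>_M: "x \<in> L \<Longrightarrow> \<iota> x \<in> M" using \<iota>L by auto
lemma \<iota>_carrier: "x \<in> carrier E \<Longrightarrow> \<iota> x \<in> carrier W" using ring_hom_memE(1)[OF \<iota>] .

lemma \<iota>_restrict: "N \<subseteq> carrier E \<Longrightarrow> \<iota> \<in> ring_hom (E\<lparr>carrier := N\<rparr>) W"
  using ring_hom_memE[OF \<iota>] by (intro ring_hom_memI) (auto simp: subset_iff)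

lemma \<iota>_inj: "inj_on \<iota> (carrier E)"
  using non_trivial_field_hom_is_inj[OF \<iota> E.field_axioms W.field_axioms] .

lemma \<iota>_eq: "x \<in> L \<Longrightarrow> y \<in> L \<Longrightarrow> \<iota> x = \<iota> y \<Longrightarrow> x = y"
  using inj_onD[OF \<iota>_inj] L_carrier by blast

lemma \<iota>_zero: "\<iota> \<zero> = \<zero>\<^bsub>W\<^esub>"
  using E.hom_zero[OF W.ring_axioms E.carrier_is_subring] \<iota> by simp

lemma \<iota>_one: "\<iota> \<one> = \<one>\<^bsub>W\<^esub>" using ring_hom_memE(4)[OF \<iota>] .
lemma \<iota>_add: "x \<in> L \<Longrightarrow> y \<in> L \<Longrightarrow> \<iota> (x \<oplus> y) = \<iota> x \<oplus>\<^bsub>W\<^esub> \<iota> y"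
  and \<iota>_mult: "x \<in> L \<Longrightarrow> y \<in> L \<Longrightarrow> \<iota> (x \<otimes> y) = \<iota> x \<otimes>\<^bsub>W\<^esub> \<iota> y"
  using ring_hom_memE(2,3)[OF \<iota>] L_carrier by auto

lemma A_L: "A \<subseteq> L" using A(2) KL by auto

lemma \<iota>A_subring: "subring (\<iota> ` A) W"
proof -
  interpret H: ring_hom_ring E W \<iota> by (rule ring_hom_ringI2[OF E.ring_axioms W.ring_axioms \<iota>])
  show ?thesis using H.img_is_subring[OF A(1)] .
qed

lemma T_subring: "subring T W"
  unfolding T_def by (rule W.integral_closure_subring[OF \<iota>A_subring subfieldE(1)[OF W.M]])

lemma RL_subring: "subring RL E"
  unfolding RL_def by (rule E.integral_closure_subring[OF A(1) subfieldE(1)[OF L]])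

lemma RK_subring: "subring RK E"
  unfolding RK_def by (rule E.integral_closure_subring[OF A(1) subfieldE(1)[OF K]])

lemma T_M: "T \<subseteq> M" by (auto simp: T_def integral_closure_def)
lemma RL_L: "x \<in> RL \<Longrightarrow> x \<in> L" by (auto simp: RL_def integral_closure_def)
lemma RK_iff: "x \<in> RK \<longleftrightarrow> x \<in> RL \<and> x \<in> K"
  using KL by (auto simp: RL_def RK_def integral_closure_def)

lemma mem_RL_iff: "x \<in> L \<Longrightarrow> x \<in> RL \<longleftrightarrow> \<iota> x \<in> T"
proof
  note h = \<iota>_restrict[OF LE(1)]
  assume x: "x \<in> L"
  show "\<iota> x \<in> T" if "x \<in> RL"
    unfolding T_def
  proof (rule E.integral_image[OF W.ring_axioms subfieldE(1)[OF L] h A_L])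
    show "b = \<zero>" if "b \<in> A" "\<iota> b = \<zero>\<^bsub>W\<^esub>" for b
      using \<iota>_eq[of b \<zero>] that A_L \<iota>_zero LE(2) by auto
  qed (use that x \<iota>_M in \<open>auto simp: RL_def\<close>)
  show "x \<in> RL" if "\<iota> x \<in> T"
    unfolding RL_def
    by (rule E.integral_preimage[OF W.ring_axioms subfieldE(1)[OF L] h A_L _ subringE(3)[OF A(1)] x])
      (use that in \<open>auto simp: T_def intro!: inj_onI \<iota>_eq\<close>)
qed

lemma T_stable: "g \<in> G \<Longrightarrow> t \<in> T \<Longrightarrow> g t \<in> T"
proof -
  assume g: "g \<in> G" and t: "t \<in> T"
  have sub: "\<iota> ` A \<subseteq> M" using \<iota>_M A_L by auto
  have "g t \<in> integral_closure W (g ` \<iota> ` A) M"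
  proof (rule W.integral_image[OF W.ring_axioms subfieldE(1)[OF W.M] W.act_hom[OF g] sub])
    show "b = \<zero>\<^bsub>W\<^esub>" if "b \<in> \<iota> ` A" "g b = \<zero>\<^bsub>W\<^esub>" for b
      using W.act_inj[OF g, of b "\<zero>\<^bsub>W\<^esub>"] W.act_zero[OF g] that sub W.ME(2) by auto
  qed (use t g W.act_closed T_M in \<open>auto simp: T_def\<close>)
  moreover have "g ` \<iota> ` A = \<iota> ` A" using fixK[OF g] A(2) by (auto simp: image_image subset_iff image_iff)
  ultimately show ?thesis by (simp add: T_def)
qed

lemma fixed_ring: "{t \<in> T. \<forall>g \<in> G. g t = t} = \<iota> ` RK"
proof (intro equalityI subsetI)
  fix t assume t: "t \<in> {t \<in> T. \<forall>g \<in> G. g t = t}"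
  then obtain k where k: "k \<in> K" "t = \<iota> k" using fixed[of t] T_M by auto
  then show "t \<in> \<iota> ` RK" using mem_RL_iff[of k] K_L t by (auto simp: RK_iff)
next
  fix t assume "t \<in> \<iota> ` RK"
  then obtain k where "k \<in> RL" "k \<in> K" "t = \<iota> k" by (auto simp: RK_iff)
  then show "t \<in> {t \<in> T. \<forall>g \<in> G. g t = t}" using mem_RL_iff[of k] K_L fixK by auto
qed

lemma exists_prime_above:
  assumes q: "primeideal q (E\<lparr>carrier := RK\<rparr>)"
  shows "\<exists>P. W.prime_in T P \<and> P \<inter> \<iota> ` RK = \<iota> ` q"
proof (rule W.lying_over)
  show "subring T W" "T \<subseteq> M" by (rule T_subring, rule T_M)
  show "g t \<in> T" if "g \<in> G" "t \<in> T" for g t using T_stable that .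
  show "\<iota> ` RK = {t \<in> T. \<forall>g \<in> G. g t = t}" using fixed_ring by simp
  have q': "E.prime_in RK q" using q E.prime_in_iff[OF RK_subring] by simp
  then interpret q: subring_prime E RK q
    by (intro subring_prime.intro subring_prime_axioms.intro E.domain_axioms RK_subring)
  have RKL: "x \<in> RK \<Longrightarrow> x \<in> L" for x using RK_iff RL_L by blast
  have eq: "x \<in> q" if "x \<in> RK" "\<iota> x = \<iota> y" "y \<in> q" for x y
    using \<iota>_eq[of x y] RKL that q.P_T by auto
  show "W.prime_in (\<iota> ` RK) (\<iota> ` q)"
    unfolding W.prime_in_def
  proof (intro conjI ballI impI)
    show "\<iota> ` q \<subseteq> \<iota> ` RK" using q.P_T by auto
    show "\<zero>\<^bsub>W\<^esub> \<in> \<iota> ` q" using q.P_zero \<iota>_zero by force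
    show "\<one>\<^bsub>W\<^esub> \<notin> \<iota> ` q" using eq[OF q.TE(3)] q.P_one \<iota>_one by auto
  next
    fix x y assume "x \<in> \<iota> ` q" "y \<in> \<iota> ` q"
    then obtain a b where "a \<in> q" "b \<in> q" "x = \<iota> a" "y = \<iota> b" by auto
    then show "x \<oplus>\<^bsub>W\<^esub> y \<in> \<iota> ` q"
      using \<iota>_add[of a b] q.P_add q.P_T RKL by (metis imageI)
  next
    fix x y assume "x \<in> \<iota> ` RK" "y \<in> \<iota> ` q"
    then obtain a b where "a \<in> RK" "b \<in> q" "x = \<iota> a" "y = \<iota> b" by auto
    then show "x \<otimes>\<^bsub>W\<^esub> y \<in> \<iota> ` q"
      using \<iota>_mult[of a b] q.P_mult q.P_T RKL by (metis imageI)
  next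
    fix x y assume xy: "x \<in> \<iota> ` RK" "y \<in> \<iota> ` RK" "x \<otimes>\<^bsub>W\<^esub> y \<in> \<iota> ` q"
    then obtain a b c where abc: "a \<in> RK" "b \<in> RK" "c \<in> q" "x = \<iota> a" "y = \<iota> b" "x \<otimes>\<^bsub>W\<^esub> y = \<iota> c" by auto
    have "a \<otimes> b \<in> q"
      using eq[of "a \<otimes> b" c] \<iota>_mult[of a b] abc RKL q.TE(6) by auto
    then show "x \<in> \<iota> ` q \<or> y \<in> \<iota> ` q" using q.P_prime abc by blast
  qed
qed

text \<open>The embeddings of \<open>L/K\<close> into \<open>M\<close> that the group induces.\<close>

definition C where "C = (\<lambda>g. \<lambda>x \<in> L. g (\<iota> x)) ` G"

lemma C_finite: "finite C" using W.fin by (simp add: C_def)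

lemma C_ex: "\<tau> \<in> C \<Longrightarrow> \<exists>g \<in> G. \<tau> = (\<lambda>x \<in> L. g (\<iota> x)) \<and> (\<forall>x \<in> L. \<tau> x = g (\<iota> x))"
proof -
  assume "\<tau> \<in> C"
  then obtain g where g: "g \<in> G" "\<tau> = (\<lambda>x \<in> L. g (\<iota> x))" unfolding C_def by blast
  have "\<forall>x \<in> L. \<tau> x = g (\<iota> x)" unfolding g(2) by simp
  then show ?thesis using g by blast
qed

lemma C_M: "\<tau> \<in> C \<Longrightarrow> x \<in> L \<Longrightarrow> \<tau> x \<in> M"
proof -
  assume "\<tau> \<in> C" and x: "x \<in> L"
  then obtain g where "g \<in> G" "\<tau> x = g (\<iota> x)" using C_ex by blast
  then show ?thesis using W.act_closed \<iota>_M[OF x] by simp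
qed

lemma C_hom: "\<tau> \<in> C \<Longrightarrow> \<tau> \<in> ring_hom (E\<lparr>carrier := L\<rparr>) W"
proof -
  assume "\<tau> \<in> C"
  then obtain g where g: "g \<in> G" "\<And>x. x \<in> L \<Longrightarrow> \<tau> x = g (\<iota> x)" using C_ex by blast
  show ?thesis
  proof (rule ring_hom_memI)
    fix x y assume "x \<in> carrier (E\<lparr>carrier := L\<rparr>)" "y \<in> carrier (E\<lparr>carrier := L\<rparr>)"
    then have xy: "x \<in> L" "y \<in> L" by auto
    show "\<tau> (x \<otimes>\<^bsub>E\<lparr>carrier := L\<rparr>\<^esub> y) = \<tau> x \<otimes>\<^bsub>W\<^esub> \<tau> y"
      using g(2)[OF LE(6)[OF xy]] g(2) xy \<iota>_mult W.act_mult[OF g(1)] \<iota>_M by simp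
    show "\<tau> (x \<oplus>\<^bsub>E\<lparr>carrier := L\<rparr>\<^esub> y) = \<tau> x \<oplus>\<^bsub>W\<^esub> \<tau> y"
      using g(2)[OF LE(7)[OF xy]] g(2) xy \<iota>_add W.act_add[OF g(1)] \<iota>_M by simp
  next
    fix x assume "x \<in> carrier (E\<lparr>carrier := L\<rparr>)"
    then show "\<tau> x \<in> carrier W" using C_M[OF \<open>\<tau> \<in> C\<close>] W.M_carrier by simp
  next
    show "\<tau> \<one>\<^bsub>E\<lparr>carrier := L\<rparr>\<^esub> = \<one>\<^bsub>W\<^esub>" using g LE(3) \<iota>_one W.act_one by simp
  qed
qed

lemma \<iota>_C: "(\<lambda>x \<in> L. \<iota> x) \<in> C"
proof -
  have "(\<lambda>x \<in> L. \<iota> x) = (\<lambda>x \<in> L. (\<lambda>y \<in> M. y) (\<iota> x))" by (rule restrict_ext) (use \<iota>_M in auto)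
  moreover have "(\<lambda>x \<in> L. (\<lambda>y \<in> M. y) (\<iota> x)) \<in> C" unfolding C_def by (rule imageI[OF W.one])
  ultimately show ?thesis by (simp only:)
qed

lemma C_sum_fixed:
  assumes h: "h \<in> G" and x: "x \<in> L"
  shows "h (\<Oplus>\<^bsub>W\<^esub>\<tau> \<in> C. \<tau> x) = (\<Oplus>\<^bsub>W\<^esub>\<tau> \<in> C. \<tau> x)"
proof -
  let ?\<Phi> = "\<lambda>\<tau>. \<lambda>x \<in> L. h (\<tau> x)"
  have \<Phi>: "?\<Phi> \<tau> \<in> C" if \<tau>: "\<tau> \<in> C" for \<tau>
  proof -
    obtain g where g: "g \<in> G" "\<tau> = (\<lambda>x \<in> L. g (\<iota> x))" using C_ex[OF \<tau>] by blast
    have "?\<Phi> \<tau> = (\<lambda>x \<in> L. compose M h g (\<iota> x))"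
      by (rule restrict_ext) (use g \<iota>_M in \<open>auto simp: compose_eq\<close>)
    then show ?thesis using W.comp[OF h g(1)] by (auto simp: C_def)
  qed
  have inj: "inj_on ?\<Phi> C"
  proof (rule inj_onI)
    fix \<sigma> \<tau> assume st: "\<sigma> \<in> C" "\<tau> \<in> C" "?\<Phi> \<sigma> = ?\<Phi> \<tau>"
    show "\<sigma> = \<tau>"
    proof (rule extensionalityI[of _ L])
      show "\<sigma> \<in> extensional L" "\<tau> \<in> extensional L" using st by (auto simp: C_def)
      fix y assume y: "y \<in> L"
      have "h (\<sigma> y) = h (\<tau> y)" using fun_cong[OF st(3), of y] y by simp
      then show "\<sigma> y = \<tau> y" using W.act_inj[OF h] C_M st y by blast
    qed
  qed
  have surj: "?\<Phi> ` C = C" using endo_inj_surj[OF C_finite _ inj] \<Phi> by blast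
  have "h (\<Oplus>\<^bsub>W\<^esub>\<tau> \<in> C. \<tau> x) = (\<Oplus>\<^bsub>W\<^esub>\<tau> \<in> C. h (\<tau> x))"
    by (rule W.act_sum[OF h]) (use C_M x in auto)
  also have "\<dots> = (\<Oplus>\<^bsub>W\<^esub>\<tau> \<in> C. ?\<Phi> \<tau> x)" using x by simp
  also have "\<dots> = (\<Oplus>\<^bsub>W\<^esub>\<tau> \<in> ?\<Phi> ` C. \<tau> x)"
    by (rule W.finsum_reindex[symmetric, OF _ inj]) (use surj C_M x W.M_carrier in auto)
  finally show ?thesis using surj by simp
qed

text \<open>Composition with an element of the group permutes \<open>C\<close>, so the sum is fixed and lies in \<open>\<iota>(K)\<close>.
  This is what \<open>field_trace_eq_sum\<close> needs to know about \<open>C\<close>.\<close>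

lemma trace_eq:
  assumes x: "x \<in> L"
  shows "field_trace E K L x \<in> K" "\<iota> (field_trace E K L x) = (\<Oplus>\<^bsub>W\<^esub>\<tau> \<in> C. \<tau> x)"
proof -
  have "field_trace E K L x \<in> K \<and> (\<lambda>x \<in> L. \<iota> x) (field_trace E K L x) = (\<Oplus>\<^bsub>W\<^esub>\<tau> \<in> C. \<tau> x)"
  proof (rule E.field_trace_eq_sum[OF W.field_axioms K L KL fd C_finite C_hom _ \<iota>_C _ _ x])
    fix \<sigma> \<tau> assume st: "\<sigma> \<in> C" "\<tau> \<in> C" "\<sigma> \<noteq> \<tau>"
    show "\<exists>x \<in> L. \<sigma> x \<noteq> \<tau> x"
    proof (rule ccontr)
      assume "\<not> ?thesis"
      then have "\<sigma> = \<tau>" by (intro extensionalityI[of _ L]) (use st in \<open>auto simp: C_def\<close>)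
      then show False using st by simp
    qed
  next
    fix \<tau> k assume t: "\<tau> \<in> C" "k \<in> K"
    then show "\<tau> k = (\<lambda>x \<in> L. \<iota> x) k" using C_ex[OF t(1)] fixK K_L by auto
  next
    fix y assume y: "y \<in> L"
    have "(\<Oplus>\<^bsub>W\<^esub>\<tau> \<in> C. \<tau> y) \<in> M"
      by (rule W.finsum_mem) (use W.ME(1,2,7) C_M y in auto)
    then have "(\<Oplus>\<^bsub>W\<^esub>\<tau> \<in> C. \<tau> y) \<in> \<iota> ` K" using fixed C_sum_fixed[OF _ y] by blast
    then show "(\<Oplus>\<^bsub>W\<^esub>\<tau> \<in> C. \<tau> y) \<in> (\<lambda>x \<in> L. \<iota> x) ` K" using K_L by (metis (no_types, lifting) image_cong restrict_apply')
  qed auto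
  then show "field_trace E K L x \<in> K" "\<iota> (field_trace E K L x) = (\<Oplus>\<^bsub>W\<^esub>\<tau> \<in> C. \<tau> x)"
    using K_L by auto
qed

text \<open>The subgroup that belongs to \<open>L\<close>; its cosets are the fibres of \<open>G \<rightarrow> C\<close>.\<close>

definition H where "H = {g \<in> G. \<forall>x \<in> L. g (\<iota> x) = \<iota> x}"

lemma H_aut_group: "aut_group W M H"
proof (intro aut_group.intro aut_group_axioms.intro W.field_axioms W.M)
  show "finite H" using W.fin by (simp add: H_def)
  show "H \<subseteq> extensional M" using W.ext by (auto simp: H_def)
  show "(\<lambda>x \<in> M. x) \<in> H" using W.one \<iota>_M by (auto simp: H_def)
  fix g assume g: "g \<in> H"
  then show "g \<in> ring_hom (W\<lparr>carrier := M\<rparr>) (W\<lparr>carrier := M\<rparr>)" using W.hom by (simp add: H_def)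
  fix h assume "h \<in> H"
  then show "compose M g h \<in> H" using g W.comp \<iota>_M by (auto simp: H_def compose_eq)
qed

lemma C_fiber:
  assumes g: "g \<in> G"
  shows "{k \<in> G. (\<lambda>x \<in> L. k (\<iota> x)) = (\<lambda>x \<in> L. g (\<iota> x))} = compose M g ` H"
proof (intro equalityI subsetI)
  fix k assume k: "k \<in> {k \<in> G. (\<lambda>x \<in> L. k (\<iota> x)) = (\<lambda>x \<in> L. g (\<iota> x))}"
  then have kG: "k \<in> G" by simp
  have kg: "k (\<iota> x) = g (\<iota> x)" if "x \<in> L" for x
  proof -
    have "(\<lambda>x \<in> L. k (\<iota> x)) x = (\<lambda>x \<in> L. g (\<iota> x)) x" using k by simp
    then show ?thesis using that by simp
  qed
  obtain l where l: "l \<in> G" "\<And>x. x \<in> M \<Longrightarrow> g (l x) = x" "\<And>x. x \<in> M \<Longrightarrow> l (g x) = x"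
    using W.act_inverse[OF g] by metis
  have "compose M l k \<in> H"
    using W.comp[OF l(1) kG] kg l(3) \<iota>_M by (auto simp: H_def compose_eq)
  moreover have "k = compose M g (compose M l k)"
    by (rule W.G_ext[OF kG]) (use W.comp g l kG W.act_closed in \<open>auto simp: compose_eq\<close>)
  ultimately show "k \<in> compose M g ` H" by blast
next
  fix k assume "k \<in> compose M g ` H"
  then obtain h where h: "h \<in> G" "\<And>x. x \<in> L \<Longrightarrow> h (\<iota> x) = \<iota> x" "k = compose M g h" by (auto simp: H_def)
  have "(\<lambda>x \<in> L. k (\<iota> x)) = (\<lambda>x \<in> L. g (\<iota> x))"
    by (rule restrict_ext) (use h \<iota>_M in \<open>auto simp: compose_eq\<close>)
  then show "k \<in> {k \<in> G. (\<lambda>x \<in> L. k (\<iota> x)) = (\<lambda>x \<in> L. g (\<iota> x))}" using h W.comp[OF g h(1)] by simp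
qed

lemma card_C: "card G = card C * card H"
proof -
  let ?r = "\<lambda>g. \<lambda>x \<in> L. g (\<iota> x)"
  have "card G = (\<Sum>\<tau> \<in> C. card {g \<in> G. ?r g = \<tau>})"
    unfolding C_def using sum.image_gen[OF W.fin, of "\<lambda>_. 1::nat" ?r] by simp
  also have "\<dots> = (\<Sum>\<tau> \<in> C. card H)"
  proof (rule sum.cong)
    fix \<tau> assume "\<tau> \<in> C"
    then obtain g where g: "g \<in> G" "\<tau> = ?r g" by (auto simp: C_def)
    have "card (compose M g ` H) = card H"
      using card_image[OF inj_on_subset[OF W.left_mult_bij(1)[OF g(1)]]] by (auto simp: H_def)
    then show "card {g \<in> G. ?r g = \<tau>} = card H" using C_fiber[OF g(1)] g(2) by simp
  qed simp
  finally show ?thesis by simp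
qed

end

locale embedded_extension_prime = embedded_extension +
  fixes q P
  assumes q: "primeideal q (E\<lparr>carrier := RK\<rparr>)"
    and P: "W.prime_in T P" and above: "P \<inter> \<iota> ` RK = \<iota> ` q"
begin

sublocale P: aut_group_prime W M G T P
proof (intro aut_group_prime.intro aut_group_prime_axioms.intro W.aut_group_axioms
    subring_prime.intro subring_prime_axioms.intro W.domain_axioms)
  show "g t \<in> T" if "g \<in> G" "t \<in> T" for g t using T_stable[OF that] .
qed (rule T_subring P T_M)+

lemma q_mem_iff: "r \<in> RK \<Longrightarrow> r \<in> q \<longleftrightarrow> \<iota> r \<in> P"
proof
  assume r: "r \<in> RK"
  show "\<iota> r \<in> P" if "r \<in> q" using that above by auto
  show "r \<in> q" if "\<iota> r \<in> P"
  proof -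
    have "\<iota> r \<in> \<iota> ` q" using that above r by auto
    then obtain s where s: "s \<in> q" "\<iota> r = \<iota> s" by auto
    have "s \<in> RK" using s(1) E.prime_in_iff[OF RK_subring] q by (auto simp: E.prime_in_def)
    then show ?thesis using \<iota>_eq[of r s] s r RK_iff RL_L by auto
  qed
qed

lemma q_RK: "r \<in> q \<Longrightarrow> r \<in> RK"
proof -
  have "q \<subseteq> RK" using E.prime_in_iff[OF RK_subring, of q] q by (simp add: E.prime_in_def)
  then show "r \<in> q \<Longrightarrow> r \<in> RK" by blast
qed

lemma q_RL: "q \<subseteq> RL"
proof
  fix r assume "r \<in> q"
  then show "r \<in> RL" using q_RK[of r] RK_iff[of r] by simp
qed

lemma RL_T: "x \<in> RL \<Longrightarrow> \<iota> x \<in> T"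
proof -
  assume x: "x \<in> RL"
  show ?thesis using iffD1[OF mem_RL_iff[OF RL_L[OF x]] x] .
qed

lemma C_T: "\<tau> \<in> C \<Longrightarrow> x \<in> RL \<Longrightarrow> \<tau> x \<in> T"
proof -
  assume "\<tau> \<in> C" and x: "x \<in> RL"
  then obtain g where "g \<in> G" "\<tau> x = g (\<iota> x)" using C_ex RL_L by blast
  then show ?thesis using T_stable RL_T[OF x] by simp
qed

lemma trace_RK: "x \<in> RL \<Longrightarrow> field_trace E K L x \<in> RK"
proof -
  assume x: "x \<in> RL"
  have "\<iota> (field_trace E K L x) \<in> T"
    unfolding trace_eq(2)[OF RL_L[OF x]] by (rule P.T_sum) (use C_T x in auto)
  then show ?thesis using trace_eq(1)[OF RL_L[OF x]] mem_RL_iff K_L RK_iff by blast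
qed

lemma \<iota>_pow:
  assumes x: "x \<in> L"
  shows "\<iota> (x [^] (n::nat)) = \<iota> x [^]\<^bsub>W\<^esub> n \<and> x [^] n \<in> L"
proof (induct n)
  case 0
  have "x [^] (0::nat) = \<one>" "\<iota> x [^]\<^bsub>W\<^esub> (0::nat) = \<one>\<^bsub>W\<^esub>" by (rule E.nat_pow_0, rule W.nat_pow_0)
  then show ?case using \<iota>_one LE(3) by metis
next
  case (Suc n)
  have "x [^] Suc n = x [^] n \<otimes> x" "\<iota> x [^]\<^bsub>W\<^esub> Suc n = \<iota> x [^]\<^bsub>W\<^esub> n \<otimes>\<^bsub>W\<^esub> \<iota> x"
    by (rule E.nat_pow_Suc, rule W.nat_pow_Suc)
  then show ?case using \<iota>_mult[of "x [^] n" x] LE(6)[of "x [^] n" x] Suc x by metis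
qed

lemma act_pow:
  assumes g: "g \<in> G" and x: "x \<in> M"
  shows "g (x [^]\<^bsub>W\<^esub> (n::nat)) = g x [^]\<^bsub>W\<^esub> n \<and> x [^]\<^bsub>W\<^esub> n \<in> M"
proof (induct n)
  case 0
  have "x [^]\<^bsub>W\<^esub> (0::nat) = \<one>\<^bsub>W\<^esub>" "g x [^]\<^bsub>W\<^esub> (0::nat) = \<one>\<^bsub>W\<^esub>" by (rule W.nat_pow_0, rule W.nat_pow_0)
  then show ?case using W.act_one[OF g] W.ME(3) by metis
next
  case (Suc n)
  have "x [^]\<^bsub>W\<^esub> Suc n = x [^]\<^bsub>W\<^esub> n \<otimes>\<^bsub>W\<^esub> x" "g x [^]\<^bsub>W\<^esub> Suc n = g x [^]\<^bsub>W\<^esub> n \<otimes>\<^bsub>W\<^esub> g x"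
    by (rule W.nat_pow_Suc, rule W.nat_pow_Suc)
  then show ?case using W.act_mult[OF g, of "x [^]\<^bsub>W\<^esub> n" x] W.ME(6)[of "x [^]\<^bsub>W\<^esub> n" x] Suc x by metis
qed

lemma \<iota>_sum:
  assumes "finite I" "\<And>i. i \<in> I \<Longrightarrow> f i \<in> L"
  shows "\<iota> (finsum E f I) = (\<Oplus>\<^bsub>W\<^esub>i \<in> I. \<iota> (f i)) \<and> finsum E f I \<in> L"
  using assms
proof (induct I)
  case empty
  show ?case using \<iota>_zero LE(2) by simp
next
  case (insert i I)
  have f: "f i \<in> L" "f \<in> I \<rightarrow> carrier E" "(\<lambda>i. \<iota> (f i)) \<in> I \<rightarrow> carrier W"
    using insert.prems L_carrier \<iota>_carrier by auto
  have IH: "\<iota> (finsum E f I) = (\<Oplus>\<^bsub>W\<^esub>i \<in> I. \<iota> (f i))" "finsum E f I \<in> L"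
    using insert by auto
  have "finsum E f (insert i I) = f i \<oplus> finsum E f I"
    using E.finsum_insert[OF insert.hyps(1,2) f(2)] f(1) L_carrier by simp
  moreover have "(\<Oplus>\<^bsub>W\<^esub>i \<in> insert i I. \<iota> (f i)) = \<iota> (f i) \<oplus>\<^bsub>W\<^esub> (\<Oplus>\<^bsub>W\<^esub>i \<in> I. \<iota> (f i))"
    using W.finsum_insert[OF insert.hyps(1,2) f(3)] f(1) L_carrier \<iota>_carrier by simp
  ultimately show ?case using \<iota>_add[OF f(1) IH(2)] IH LE(7)[OF f(1) IH(2)] by simp
qed

text \<open>An element all of whose conjugates lie in \<open>P\<close> has a power in \<open>qR\<^sub>L\<close>, by the equation
  \<open>\<Prod>\<^sub>g (X - g s)\<close>, whose lower coefficients lie in \<open>P\<close> and in \<open>K\<close>.\<close>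

theorem radical_eq:
  "radical_of_ext E RL q = {s \<in> RL. \<forall>g \<in> G. g (\<iota> s) \<in> P}"
proof (intro equalityI subsetI)
  have rRL: "ring (E\<lparr>carrier := RL\<rparr>)" using E.subring_is_ring[OF RL_subring] .
  interpret RL: ring "E\<lparr>carrier := RL\<rparr>" by (rule rRL)
  note RE = subringE[OF RL_subring]
  let ?J = "{s \<in> RL. \<forall>g \<in> G. g (\<iota> s) \<in> P}" and ?I = "Idl\<^bsub>E\<lparr>carrier := RL\<rparr>\<^esub> q"
  {
    fix s assume s: "s \<in> radical_of_ext E RL q"
    then obtain n :: nat where n: "s \<in> RL" "s [^] n \<in> Idl\<^bsub>E\<lparr>carrier := RL\<rparr>\<^esub> q"
      by (auto simp: radical_of_ext_def)
    have "g (\<iota> \<zero>) \<in> P" if "g \<in> G" for g using W.act_zero[OF that] \<iota>_zero P.P_zero by simp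
    then have J0: "\<zero> \<in> ?J" using RE(2) by simp
    have Jadd: "x \<oplus> y \<in> ?J" if xy: "x \<in> ?J" "y \<in> ?J" for x y
    proof -
      have "g (\<iota> (x \<oplus> y)) \<in> P" if g: "g \<in> G" for g
        using xy g P.P_add \<iota>_add[of x y] W.act_add[OF g, of "\<iota> x" "\<iota> y"] \<iota>_M RL_L by auto
      then show ?thesis using xy RE(7) by simp
    qed
    have Jmult: "x \<otimes> y \<in> ?J \<and> y \<otimes> x \<in> ?J" if x: "x \<in> ?J" and y: "y \<in> RL" for x y
    proof -
      have "g (\<iota> (x \<otimes> y)) \<in> P" if g: "g \<in> G" for g
        using \<iota>_mult[of x y] W.act_mult[OF g, of "\<iota> x" "\<iota> y"] x y g \<iota>_M RL_L RL_T T_stable[OF g] P.P_mult'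
        by auto
      moreover have "x \<otimes> y = y \<otimes> x" using x y RL_L L_carrier E.m_comm by auto
      ultimately show ?thesis using RE(6) x y by auto
    qed
    have Jneg: "\<ominus> x \<in> ?J" if x: "x \<in> ?J" for x
      using Jmult[OF x RE(5)[OF RE(3)]] x RL_L L_carrier by (auto simp: E.l_minus E.r_minus)
    have "ideal ?J (E\<lparr>carrier := RL\<rparr>)"
    proof (rule idealI[OF rRL])
      show "subgroup ?J (add_monoid (E\<lparr>carrier := RL\<rparr>))"
      proof (rule RL.add.subgroupI)
        show "?J \<noteq> {}" using J0 by blast
        fix x assume x: "x \<in> ?J"
        have "\<ominus>\<^bsub>E\<lparr>carrier := RL\<rparr>\<^esub> x = \<ominus> x"
          by (rule RL.minus_equality) (use x RE(5) RL_L L_carrier in \<open>auto simp: E.l_neg\<close>)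
        then show "\<ominus>\<^bsub>E\<lparr>carrier := RL\<rparr>\<^esub> x \<in> ?J" using Jneg[OF x] by simp
      qed (use Jadd in auto)
    qed (use Jmult in auto)
    moreover have "q \<subseteq> ?J"
    proof
      fix r assume r: "r \<in> q"
      have "g (\<iota> r) = \<iota> r" if "g \<in> G" for g using fixK[OF that] q_RK[OF r] RK_iff by auto
      moreover have "\<iota> r \<in> P" using r q_mem_iff[OF q_RK[OF r]] by simp
      ultimately have "\<forall>g \<in> G. g (\<iota> r) \<in> P" by metis
      then show "r \<in> ?J" using r q_RL by blast
    qed
    ultimately have "?I \<subseteq> ?J" by (rule RL.genideal_minimal)
    then have "s [^] n \<in> ?J" using n(2) by (rule subsetD)
    then have pow: "g (\<iota> (s [^] n)) \<in> P" if "g \<in> G" for g using that by simp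
    have "g (\<iota> s) \<in> P" if g: "g \<in> G" for g
    proof (rule P.P_pow[OF T_stable[OF g RL_T[OF n(1)]]])
      show "g (\<iota> s) [^]\<^bsub>W\<^esub> n \<in> P"
        using pow[OF g] \<iota>_pow[OF RL_L[OF n(1)], of n] act_pow[OF g \<iota>_M[OF RL_L[OF n(1)]], of n] by simp
    qed
    then show "s \<in> ?J" using n(1) by simp
  }
  fix s assume s: "s \<in> ?J"
  have sL: "s \<in> L" "s \<in> carrier E" using s RL_L L_carrier by auto
  let ?n = "card G"
  have "\<exists>r \<in> q. \<iota> r = W.norm_coeff (\<iota> s) i" if i: "i < ?n" for i
  proof -
    have "W.norm_coeff (\<iota> s) i \<in> P"
      using P.norm_coeff_mem[of "\<iota> s" i] i s RL_T by auto
    moreover have "W.norm_coeff (\<iota> s) i \<in> \<iota> ` RK"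
      using calculation P.P_T W.norm_coeff_fixed[OF _ \<iota>_M[OF sL(1)]] by (auto simp flip: fixed_ring)
    ultimately show ?thesis using above by (metis IntI imageE)
  qed
  then obtain r where r: "\<And>i. i < ?n \<Longrightarrow> r i \<in> q" "\<And>i. i < ?n \<Longrightarrow> \<iota> (r i) = W.norm_coeff (\<iota> s) i"
    by metis
  have rL: "r i \<in> L" if "i < ?n" for i using r(1)[OF that] q_RL RL_L by auto
  have tL: "r i \<otimes> s [^] i \<in> L" if "i < ?n" for i using rL[OF that] \<iota>_pow[OF sL(1)] LE(6) by auto
  let ?S = "\<Oplus>i \<in> {..<?n}. r i \<otimes> s [^] i"
  have S: "\<iota> ?S = (\<Oplus>\<^bsub>W\<^esub>i \<in> {..<?n}. \<iota> (r i \<otimes> s [^] i)) \<and> ?S \<in> L"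
    by (rule \<iota>_sum) (use tL in auto)
  have "(\<Oplus>\<^bsub>W\<^esub>i \<in> {..<?n}. \<iota> (r i \<otimes> s [^] i)) = (\<Oplus>\<^bsub>W\<^esub>i \<in> {..<?n}. W.norm_coeff (\<iota> s) i \<otimes>\<^bsub>W\<^esub> \<iota> s [^]\<^bsub>W\<^esub> i)"
  proof (rule W.finsum_cong')
    fix i assume "i \<in> {..<?n}"
    then have i: "i < ?n" by simp
    show "\<iota> (r i \<otimes> s [^] i) = W.norm_coeff (\<iota> s) i \<otimes>\<^bsub>W\<^esub> \<iota> s [^]\<^bsub>W\<^esub> i"
      using \<iota>_mult[OF rL[OF i], of "s [^] i"] \<iota>_pow[OF sL(1), of i] r(2)[OF i] by simp
  next
    show "(\<lambda>i. W.norm_coeff (\<iota> s) i \<otimes>\<^bsub>W\<^esub> \<iota> s [^]\<^bsub>W\<^esub> i) \<in> {..<?n} \<rightarrow> carrier W"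
    proof
      fix i assume "i \<in> {..<?n}"
      then have i: "i < ?n" by simp
      show "W.norm_coeff (\<iota> s) i \<otimes>\<^bsub>W\<^esub> \<iota> s [^]\<^bsub>W\<^esub> i \<in> carrier W"
        using \<iota>_carrier[OF L_carrier[OF rL[OF i]]] \<iota>_carrier[OF sL(2)] by (simp add: r(2)[OF i])
    qed
  qed simp
  then have "\<iota> (s [^] ?n \<oplus> ?S) = \<iota> \<zero>"
    using \<iota>_add[of "s [^] ?n" ?S] \<iota>_pow[OF sL(1), of ?n] S W.norm_equation[OF \<iota>_M[OF sL(1)]] \<iota>_zero by presburger
  then have eq: "s [^] ?n \<oplus> ?S = \<zero>"
    using \<iota>_eq[of "s [^] ?n \<oplus> ?S" \<zero>] LE(2,7) \<iota>_pow[OF sL(1), of ?n] S by auto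
  have I: "ideal ?I (E\<lparr>carrier := RL\<rparr>)" using RL.genideal_ideal q_RL by simp
  interpret I: ideal ?I "E\<lparr>carrier := RL\<rparr>" by (rule I)
  have IRL: "?I \<subseteq> RL" using I.a_subset by simp
  have sp: "s [^] (i::nat) \<in> RL" for i by (induct i) (use s RE(3,6) in auto)
  have qI: "q \<subseteq> ?I" using RL.genideal_self q_RL by simp
  have tI: "r i \<otimes> s [^] i \<in> ?I" if "i < ?n" for i
    using I.I_r_closed[of "r i" "s [^] i"] r(1)[OF that] qI sp by auto
  have SI: "?S \<in> ?I"
  proof (rule E.finsum_mem)
    show "?I \<subseteq> carrier E" using IRL RE(1) by auto
    show "\<zero> \<in> ?I" using additive_subgroup.zero_closed[OF I.additive_subgroup_axioms] by simp
    show "\<And>x y. x \<in> ?I \<Longrightarrow> y \<in> ?I \<Longrightarrow> x \<oplus> y \<in> ?I"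
      using additive_subgroup.a_closed[OF I.additive_subgroup_axioms] by simp
  qed (use tI in auto)
  have "s [^] ?n = \<ominus> \<one> \<otimes> ?S"
    using eq E.minus_equality[of "s [^] ?n" ?S] sL(2) S L_carrier by (simp add: E.l_minus)
  then have "s [^] ?n \<in> ?I" using I.I_l_closed[OF SI, of "\<ominus> \<one>"] RE(3,5) by simp
  then show "s \<in> radical_of_ext E RL q" using s by (auto simp: radical_of_ext_def)
qed

lemma radical_subset_trace_ideal: "radical_of_ext E RL q \<subseteq> trace_ideal E K L RL q"
proof
  note RE = subringE[OF RL_subring]
  fix s assume "s \<in> radical_of_ext E RL q"
  then have s: "s \<in> RL" "\<And>g. g \<in> G \<Longrightarrow> g (\<iota> s) \<in> P" by (auto simp: radical_eq)
  have "field_trace E K L (s \<otimes> u) \<in> q" if u: "u \<in> RL" for u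
  proof -
    have su: "s \<otimes> u \<in> RL" using RE(6) s u by simp
    have "\<tau> (s \<otimes> u) \<in> P" if \<tau>: "\<tau> \<in> C" for \<tau>
    proof -
      obtain g where g: "g \<in> G" "\<And>x. x \<in> L \<Longrightarrow> \<tau> x = g (\<iota> x)" using C_ex[OF \<tau>] by blast
      show ?thesis
        using g(2)[OF RL_L[OF su]] \<iota>_mult[OF RL_L[OF s(1)] RL_L[OF u]]
          W.act_mult[OF g(1) \<iota>_M[OF RL_L[OF s(1)]] \<iota>_M[OF RL_L[OF u]]] s(2)[OF g(1)]
          T_stable[OF g(1) RL_T[OF u]] P.P_mult' by simp
    qed
    then have "\<iota> (field_trace E K L (s \<otimes> u)) \<in> P"
      unfolding trace_eq(2)[OF RL_L[OF su]] by (rule P.P_sum)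
    then show ?thesis using q_mem_iff[OF trace_RK[OF su]] by simp
  qed
  then show "s \<in> trace_ideal E K L RL q" using s(1) by (simp add: trace_ideal_def)
qed

text \<open>\<open>1\<close> is not in the radical, so it is not in the trace ideal.\<close>

lemma tame_imp_trace_nonzero:
  assumes tame: "tamely_ramified E K L RL q"
  shows "\<exists>u \<in> RL. (\<Oplus>\<^bsub>W\<^esub>\<tau> \<in> C. \<tau> u) \<notin> P"
proof -
  note RE = subringE[OF RL_subring]
  have "(\<lambda>x \<in> M. x) (\<iota> \<one>) \<notin> P" using W.act_one[OF W.one] \<iota>_one P.P_one by simp
  then have "\<one> \<notin> radical_of_ext E RL q" unfolding radical_eq using W.one by blast
  then have "\<one> \<notin> trace_ideal E K L RL q" using tame by (simp add: tamely_ramified_def)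
  then obtain u where u: "u \<in> RL" "field_trace E K L (\<one> \<otimes> u) \<notin> q" using RE(3) by (auto simp: trace_ideal_def)
  then have "field_trace E K L u \<notin> q" using RL_L L_carrier by simp
  then have "\<iota> (field_trace E K L u) \<notin> P" using q_mem_iff[OF trace_RK[OF u(1)]] by simp
  then show ?thesis using trace_eq(2)[OF RL_L[OF u(1)]] u(1) by auto
qed

text \<open>The trace is transitive: with \<open>v = Tr\<^sub>M\<^sub>/\<^sub>L(t)\<close>, the sum of \<open>g(st)\<close> over \<open>G\<close> is \<open>Tr\<^sub>L\<^sub>/\<^sub>K(sv)\<close>.
  For \<open>s\<close> in the trace ideal it is in \<open>P\<close> for all \<open>t \<in> T\<close>, and by nondegeneracy all
  conjugates of \<open>s\<close> are in \<open>P\<close>.\<close>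

theorem inertia_invertible_imp_tame:
  assumes n: "[card P.inertia] \<cdot>\<^bsub>W\<^esub> \<one>\<^bsub>W\<^esub> \<notin> P"
    and fixL: "\<And>x. x \<in> M \<Longrightarrow> (\<And>g. g \<in> H \<Longrightarrow> g x = x) \<Longrightarrow> x \<in> \<iota> ` L"
  shows "tamely_ramified E K L RL q"
proof -
  interpret H: aut_group W M H by (rule H_aut_group)
  have HG: "\<And>h. h \<in> H \<Longrightarrow> h \<in> G" by (auto simp: H_def)
  have "trace_ideal E K L RL q \<subseteq> radical_of_ext E RL q"
  proof
    fix s assume "s \<in> trace_ideal E K L RL q"
    then have s: "s \<in> RL" "\<And>u. u \<in> RL \<Longrightarrow> field_trace E K L (s \<otimes> u) \<in> q" by (auto simp: trace_ideal_def)
    note sL = RL_L[OF s(1)] and sM = \<iota>_M[OF RL_L[OF s(1)]] and sT = RL_T[OF s(1)]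
    have tr: "W.trace_sum (\<iota> s \<otimes>\<^bsub>W\<^esub> t) \<in> P" if t: "t \<in> T" for t
    proof -
      have tM: "t \<in> M" using t T_M by auto
      have HT: "H.trace_sum t \<in> T"
        unfolding H.trace_sum_def by (rule P.T_sum) (use HG T_stable t in auto)
      have "H.trace_sum t \<in> \<iota> ` L"
        using fixL[of "H.trace_sum t"] H.trace_sum_fixed[OF _ tM] HT T_M by auto
      then obtain v where v: "v \<in> L" "H.trace_sum t = \<iota> v" by auto
      have vR: "v \<in> RL" using mem_RL_iff[OF v(1)] HT v(2) by simp
      have sv: "s \<otimes> v \<in> RL" using subringE(6)[OF RL_subring] s(1) vR by simp
      have stM: "\<iota> s \<otimes>\<^bsub>W\<^esub> t \<in> M" using W.ME(6) sM tM by simp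
      let ?r = "\<lambda>g. \<lambda>x \<in> L. g (\<iota> x)"
      have "W.trace_sum (\<iota> s \<otimes>\<^bsub>W\<^esub> t) = (\<Oplus>\<^bsub>W\<^esub>\<tau> \<in> C. \<Oplus>\<^bsub>W\<^esub>g \<in> {g \<in> G. ?r g = \<tau>}. g (\<iota> s \<otimes>\<^bsub>W\<^esub> t))"
        unfolding W.trace_sum_def
        by (rule W.finsum_group) (use W.fin C_finite W.act_closed stM W.M_carrier in \<open>auto simp: C_def\<close>)
      also have "\<dots> = (\<Oplus>\<^bsub>W\<^esub>\<tau> \<in> C. \<tau> (s \<otimes> v))"
      proof (rule W.finsum_cong')
        fix \<tau> assume "\<tau> \<in> C"
        then obtain g where g: "g \<in> G" "\<tau> = ?r g" by (auto simp: C_def)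
        have hM: "h t \<in> M" if "h \<in> H" for h using H.act_closed[OF that tM] .
        have "(\<Oplus>\<^bsub>W\<^esub>k \<in> {k \<in> G. ?r k = \<tau>}. k (\<iota> s \<otimes>\<^bsub>W\<^esub> t)) = (\<Oplus>\<^bsub>W\<^esub>k \<in> compose M g ` H. k (\<iota> s \<otimes>\<^bsub>W\<^esub> t))"
          using C_fiber[OF g(1)] g(2) by simp
        also have "\<dots> = (\<Oplus>\<^bsub>W\<^esub>h \<in> H. compose M g h (\<iota> s \<otimes>\<^bsub>W\<^esub> t))"
        proof (rule W.finsum_reindex)
          show "inj_on (compose M g) H"
            using inj_on_subset[OF W.left_mult_bij(1)[OF g(1)]] HG by blast
          show "(\<lambda>k. k (\<iota> s \<otimes>\<^bsub>W\<^esub> t)) \<in> compose M g ` H \<rightarrow> carrier W"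
            using W.comp[OF g(1)] HG W.act_closed stM W.M_carrier by auto
        qed
        also have "\<dots> = (\<Oplus>\<^bsub>W\<^esub>h \<in> H. g (\<iota> s) \<otimes>\<^bsub>W\<^esub> g (h t))"
        proof (rule W.finsum_cong')
          fix h assume h: "h \<in> H"
          have "h (\<iota> s) = \<iota> s" using h sL by (auto simp: H_def)
          then show "compose M g h (\<iota> s \<otimes>\<^bsub>W\<^esub> t) = g (\<iota> s) \<otimes>\<^bsub>W\<^esub> g (h t)"
            using stM H.act_mult[OF h sM tM] W.act_mult[OF g(1) sM hM[OF h]] by (simp add: compose_eq)
        qed (use g W.act_closed sM hM W.M_carrier in auto)
        also have "\<dots> = g (\<iota> s) \<otimes>\<^bsub>W\<^esub> (\<Oplus>\<^bsub>W\<^esub>h \<in> H. g (h t))"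
          using g W.act_closed sM hM W.M_carrier H.fin by (intro W.finsum_rdistr[symmetric]) auto
        also have "(\<Oplus>\<^bsub>W\<^esub>h \<in> H. g (h t)) = g (H.trace_sum t)"
          unfolding H.trace_sum_def using hM by (intro W.act_sum[OF g(1), symmetric]) auto
        also have "g (\<iota> s) \<otimes>\<^bsub>W\<^esub> g (H.trace_sum t) = \<tau> (s \<otimes> v)"
          using W.act_mult[OF g(1) sM \<iota>_M[OF v(1)]] \<iota>_mult[OF sL v(1)] v(2) g(2) RL_L[OF sv] by simp
        finally show "(\<Oplus>\<^bsub>W\<^esub>k \<in> {k \<in> G. ?r k = \<tau>}. k (\<iota> s \<otimes>\<^bsub>W\<^esub> t)) = \<tau> (s \<otimes> v)" .
      qed (use C_M RL_L[OF sv] W.M_carrier in auto)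
      also have "\<dots> = \<iota> (field_trace E K L (s \<otimes> v))" using trace_eq(2)[OF RL_L[OF sv]] by simp
      also have "\<dots> \<in> P" using s(2)[OF vR] q_mem_iff[OF trace_RK[OF sv]] by simp
      finally show ?thesis .
    qed
    have "g (\<iota> s) \<in> P" if "g \<in> G" for g
      using P.inertia_invertible_imp_trace_form_nondegenerate[OF n sT tr that] .
    then show "s \<in> radical_of_ext E RL q" using s(1) by (simp add: radical_eq)
  qed
  then show ?thesis using radical_subset_trace_ideal by (auto simp: tamely_ramified_def)
qed

text \<open>If the whole group is inertial, the trace is multiplication by the number of conjugates
  modulo \<open>P\<close>.\<close>

theorem tame_inertial_imp_index_invertible:
  assumes tame: "tamely_ramified E K L RL q" and inert: "P.inertia = G"
  shows "[card C] \<cdot>\<^bsub>W\<^esub> \<one>\<^bsub>W\<^esub> \<notin> P"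
proof
  assume n: "[card C] \<cdot>\<^bsub>W\<^esub> \<one>\<^bsub>W\<^esub> \<in> P"
  obtain u where u: "u \<in> RL" "(\<Oplus>\<^bsub>W\<^esub>\<tau> \<in> C. \<tau> u) \<notin> P" using tame_imp_trace_nonzero[OF tame] by auto
  have uR: "\<iota> u \<in> carrier W" using P.T_carrier RL_T u(1) by blast
  have "(\<Oplus>\<^bsub>W\<^esub>\<tau> \<in> C. \<tau> u) \<ominus>\<^bsub>W\<^esub> (\<Oplus>\<^bsub>W\<^esub>\<tau> \<in> C. \<iota> u) \<in> P"
  proof (rule P.diff_sum)
    fix \<tau> assume \<tau>: "\<tau> \<in> C"
    obtain g where g: "g \<in> G" "\<And>x. x \<in> L \<Longrightarrow> \<tau> x = g (\<iota> x)" using C_ex[OF \<tau>] by blast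
    have "g (\<iota> u) \<ominus>\<^bsub>W\<^esub> \<iota> u \<in> P" using inert g(1) RL_T[OF u(1)] by (auto simp: P.inertia_def)
    then show "\<tau> u \<ominus>\<^bsub>W\<^esub> \<iota> u \<in> P" using g(2)[OF RL_L[OF u(1)]] by simp
  qed (use C_T RL_T u(1) in auto)
  moreover have "(\<Oplus>\<^bsub>W\<^esub>\<tau> \<in> C. \<iota> u) = ([card C] \<cdot>\<^bsub>W\<^esub> \<one>\<^bsub>W\<^esub>) \<otimes>\<^bsub>W\<^esub> \<iota> u"
    using W.add.finprod_const[OF uR, of C] uR by (simp add: W.add_pow_ldistr)
  moreover have "([card C] \<cdot>\<^bsub>W\<^esub> \<one>\<^bsub>W\<^esub>) \<otimes>\<^bsub>W\<^esub> \<iota> u \<in> P" using P.P_mult'[OF n RL_T[OF u(1)]] .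
  ultimately have "(\<Oplus>\<^bsub>W\<^esub>\<tau> \<in> C. \<tau> u) \<in> P"
    using P.diff_mem_iff P.T_sum[of C "\<lambda>\<tau>. \<tau> u"] C_T u(1) P.P_T by metis
  then show False using u(2) by simp
qed

end

section \<open>Composite fields\<close>

context field
begin

lemma ring_hom_restrict:
  assumes "h \<in> ring_hom (R\<lparr>carrier := N\<rparr>) S" "B \<subseteq> N"
  shows "h \<in> ring_hom (R\<lparr>carrier := B\<rparr>) S"
  using ring_hom_memE[OF assms(1)] assms(2) by (intro ring_hom_memI) (auto simp: subset_iff)

lemma hom_image_subring:
  assumes S: "ring S" and h: "h \<in> ring_hom (R\<lparr>carrier := N\<rparr>) S" and B: "subring B R" "B \<subseteq> N"
  shows "subring (h ` B) S"
proof -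
  interpret B: ring "R\<lparr>carrier := B\<rparr>" using subring_is_ring[OF B(1)] .
  interpret H: ring_hom_ring "R\<lparr>carrier := B\<rparr>" S h
    by (rule ring_hom_ringI2[OF B.ring_axioms S ring_hom_restrict[OF h B(2)]])
  show ?thesis using H.img_is_subring[OF B.carrier_is_subring] by simp
qed

lemma hom_image_subfield:
  assumes S: "field S" and h: "h \<in> ring_hom (R\<lparr>carrier := N\<rparr>) S" and B: "subfield B R" "B \<subseteq> N"
  shows "subfield (h ` B) S"
proof -
  interpret S: field S by fact
  interpret B: field "R\<lparr>carrier := B\<rparr>" using subfield_iff(2)[OF B(1)] .
  interpret H: ring_hom_ring "R\<lparr>carrier := B\<rparr>" S h
    by (rule ring_hom_ringI2[OF B.ring_axioms S.ring_axioms ring_hom_restrict[OF h B(2)]])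
  show ?thesis using H.img_is_subfield(2)[OF B.carrier_is_subfield S.one_not_zero] by simp
qed

lemma hom_inj_on_subfield:
  assumes "field S" "subfield N R" "h \<in> ring_hom (R\<lparr>carrier := N\<rparr>) S"
  shows "inj_on h N"
  using non_trivial_field_hom_is_inj[OF assms(3) subfield_iff(2)[OF assms(2)] assms(1)] by simp

lemma hom_simple_extension_mem:
  assumes S: "field S" and N: "subring N R" and h: "h \<in> ring_hom (R\<lparr>carrier := N\<rparr>) S"
    and K: "subring K R" "K \<subseteq> N" and x: "x \<in> N" and y: "y \<in> simple_extension K x"
    and B: "subring B S" "h ` K \<subseteq> B" "h x \<in> B"
  shows "h y \<in> B"
proof -
  interpret S: field S by fact
  have xR: "x \<in> carrier R" using subringE(1)[OF N] x by auto
  obtain p where p: "set p \<subseteq> K" "y = eval p x" using simple_extension_obtain_list[OF K(1) xR y] .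
  have "h y = S.eval (map h p) (h x)"
    using hom_eval[OF S.ring_axioms N h _ x, of p] p K(2) by auto
  also have "\<dots> \<in> B" by (rule S.eval_mem_subring[OF B(1) _ B(3)]) (use p B(2) in auto)
  finally show ?thesis .
qed

text \<open>The images of the \<open>deg f\<close> zeros are distinct zeros of the image of \<open>f\<close>, which has no more.\<close>

lemma hom_splits_simply:
  assumes S: "field S" and N: "subfield N R" and h: "h \<in> ring_hom (R\<lparr>carrier := N\<rparr>) S"
    and f: "f \<in> carrier (N[X])" "splits_simply f" "zeros f \<subseteq> N"
  shows "ring.splits_simply S (map h f)" "ring.zeros S (map h f) = h ` zeros f"
proof -
  interpret S: field S by fact
  note N' = subfieldE(1)[OF N]
  have hf: "map h f \<in> carrier (poly_ring S)" "map h f \<noteq> []"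
    using ring_hom_memE(1)[OF map_poly_hom[OF S N h] f(1)] f(2) by (auto simp: splits_simply_def)
  have sub: "h ` zeros f \<subseteq> S.zeros (map h f)"
  proof
    fix y assume "y \<in> h ` zeros f"
    then obtain x where x: "x \<in> N" "eval f x = \<zero>" "y = h x" using f(3) by (auto simp: zeros_def)
    have "S.eval (map h f) y = \<zero>\<^bsub>S\<^esub>"
      using hom_root[OF S.ring_axioms N' h set_poly_subset[OF f(1)] x(1,2)] x(3) by simp
    then show "y \<in> S.zeros (map h f)" using ring_hom_memE(1)[OF h] x by (auto simp: S.zeros_def)
  qed
  have "card (h ` zeros f) = card (zeros f)"
    using card_image[OF inj_on_subset[OF hom_inj_on_subfield[OF S N h] f(3)]] .
  then have c: "card (h ` zeros f) = degree (map h f)" using f(2) by (simp add: splits_simply_def)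
  have "card (S.zeros (map h f)) = card (h ` zeros f)"
    using card_mono[OF S.finite_zeros(1)[OF hf] sub] S.finite_zeros(2)[OF hf] c by simp
  then show "ring.zeros S (map h f) = h ` zeros f"
    using card_subset_eq[OF S.finite_zeros(1)[OF hf] sub] by simp
  then show "ring.splits_simply S (map h f)" using hf c by (simp add: S.splits_simply_def)
qed

lemma (in cring) prime_in_contraction:
  assumes S: "ring S" and B: "subring B R" and h: "h \<in> ring_hom (R\<lparr>carrier := B\<rparr>) S" "h ` B \<subseteq> T"
    and P: "ring.prime_in S T P"
  shows "prime_in B {b \<in> B. h b \<in> P}"
proof -
  interpret S: ring S by fact
  interpret B: ring "R\<lparr>carrier := B\<rparr>" using subring_is_ring[OF B] .
  interpret H: ring_hom_ring "R\<lparr>carrier := B\<rparr>" S h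
    by (rule ring_hom_ringI2[OF B.ring_axioms S.ring_axioms h(1)])
  note BE = subringE[OF B] and hE = ring_hom_memE[OF h(1)]
  have "h \<zero> = \<zero>\<^bsub>S\<^esub>" using H.hom_zero by simp
  then show ?thesis
    using P h(2) BE hE unfolding prime_in_def S.prime_in_def by (auto simp: image_subset_iff)
qed

text \<open>A ring integral over \<open>A\<close> is mapped to a ring integral over the image of \<open>A\<close>, so transitivity of
  integrality applies. So all integral closures can be formed from \<open>R\<close> instead of \<open>S\<close>.\<close>

lemma integral_closure_image_trans:
  assumes E: "field E" and L: "subfield L R" and h: "h \<in> ring_hom (R\<lparr>carrier := L\<rparr>) E"
    and A: "subring A R" "A \<subseteq> L" and L': "L' \<subseteq> carrier E"
  shows "integral_closure E (h ` integral_closure R A L) L' = integral_closure E (h ` A) L'"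
proof -
  interpret E: field E by fact
  note L1 = subfieldE(1)[OF L]
  have sub: "integral_closure R A L \<subseteq> L" by (auto simp: integral_closure_def)
  have h0: "b = \<zero>" if "b \<in> A" "h b = \<zero>\<^bsub>E\<^esub>" for b
    using inj_onD[OF hom_inj_on_subfield[OF E L h], of b \<zero>] that A(2)
      hom_zero[OF E.ring_axioms L1 h] subringE(2)[OF L1] by auto
  show ?thesis
  proof (rule E.integral_closure_trans[OF _ _ _ _ L'])
    show "subring (h ` A) E" using hom_image_subring[OF E.ring_axioms h A] .
    show "subring (h ` integral_closure R A L) E"
      using hom_image_subring[OF E.ring_axioms h integral_closure_subring[OF A(1) L1] sub] .
    show "h ` A \<subseteq> h ` integral_closure R A L"
      using base_subset_integral_closure[OF A subringE(1)[OF L1]] by (rule image_mono)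
    show "h ` integral_closure R A L \<subseteq> integral_closure E (h ` A) (carrier E)"
    proof
      fix y assume "y \<in> h ` integral_closure R A L"
      then obtain x where x: "x \<in> integral_closure R A L" "y = h x" by auto
      then have "h x \<in> carrier E" using sub ring_hom_memE(1)[OF h] by auto
      then show "y \<in> integral_closure E (h ` A) (carrier E)"
        using integral_image[OF E.ring_axioms L1 h A(2) h0 x(1)] x(2) by blast
    qed
  qed
qed

text \<open>\<open>K'(\<phi>(a))\<close> is already a field, because \<open>\<phi>(a)\<close> is algebraic over \<open>K'\<close>.\<close>

lemma composite_field:
  assumes E: "field E" and K: "subfield K R" and a: "a \<in> carrier R" "(algebraic over K) a"
    and L: "L = simple_extension K a" and \<phi>: "\<phi> \<in> ring_hom (R\<lparr>carrier := L\<rparr>) E"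
    and K': "subfield K' E" "\<phi> ` K \<subseteq> K'"
  shows "subfield (generate_field E (\<phi> ` L \<union> K')) E"
    and "ring.finite_dimension E K' (generate_field E (\<phi> ` L \<union> K'))"
    and "generate_field E (\<phi> ` L \<union> K') = ring.simple_extension E K' (\<phi> a)"
    and "\<phi> a \<in> carrier E"
proof -
  interpret E: field E by fact
  note K1 = subfieldE(1)[OF K] and K'1 = subfieldE(1)[OF K'(1)]
  have Lf: "subfield L R" using simple_extension_is_subfield[OF K a(1)] a(2) L by simp
  note L1 = subfieldE(1)[OF Lf]
  have KL: "K \<subseteq> L" "a \<in> L"
    using simple_extension_incl[OF subringE(1)[OF K1] a(1)] simple_extension_mem[OF K1 a(1)] L by auto
  have LE: "\<phi> ` L \<subseteq> carrier E" using ring_hom_memE(1)[OF \<phi>] by auto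
  show aE: "\<phi> a \<in> carrier E" using LE KL by auto
  note I = IrrE[OF K a]
  have fc: "set (Irr K a) \<subseteq> K" using set_poly_subset[OF I(1)] .
  have fL: "Irr K a \<in> carrier (L[X])"
    using I(1) KL(1) by (auto simp: univ_poly_carrier[symmetric] polynomial_def)
  have ne: "Irr K a \<noteq> []" using pirreducibleE(1)[OF K1 I(1)] I(2) by auto
  have hf: "map \<phi> (Irr K a) \<in> carrier (poly_ring E)"
    using ring_hom_memE(1)[OF map_poly_hom[OF E Lf \<phi>] fL] .
  have "map \<phi> (Irr K a) \<in> carrier (K'[X]\<^bsub>E\<^esub>)"
    using hf ne fc K'(2) by (auto simp: univ_poly_carrier[symmetric] polynomial_def)
  moreover have "E.eval (map \<phi> (Irr K a)) (\<phi> a) = \<zero>\<^bsub>E\<^esub>"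
    using hom_root[OF E.ring_axioms L1 \<phi> _ KL(2) I(4)] fc KL(1) by auto
  ultimately have alg: "(E.algebraic over K') (\<phi> a)"
    using E.algebraicI[of _ K'] ne by (auto simp: over_def)
  let ?L' = "generate_field E (\<phi> ` L \<union> K')" and ?N = "E.simple_extension K' (\<phi> a)"
  have sub: "\<phi> ` L \<union> K' \<subseteq> carrier E" using LE subringE(1)[OF K'1] by auto
  show L': "subfield ?L' E" using E.generate_field_is_subfield[OF sub] .
  have Nf: "subfield ?N E" using E.simple_extension_is_subfield[OF K'(1) aE] alg by simp
  have KN: "K' \<subseteq> ?N" "\<phi> a \<in> ?N"
    using E.simple_extension_incl[OF subringE(1)[OF K'1] aE] E.simple_extension_mem[OF K'1 aE] by auto
  have gen: "\<phi> ` L \<union> K' \<subseteq> ?L'" by (auto intro: generate_field.incl)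
  have "\<phi> ` L \<subseteq> ?N"
    using hom_simple_extension_mem[OF E L1 \<phi> K1 KL _ subfieldE(1)[OF Nf] _ KN(2)] K'(2) KN(1) L by auto
  then have "?L' \<subseteq> ?N" using E.generate_field_min_subfield1[OF sub Nf] KN(1) by simp
  moreover have "?N \<subseteq> ?L'"
    using E.simple_extension_subring_incl[OF subfieldE(1)[OF L']] gen KL(2) by auto
  ultimately show eq: "?L' = ?N" by auto
  show "E.finite_dimension K' ?L'"
    using E.finite_dimension_simple_extension[OF K'(1) aE] alg eq by simp
qed

lemma gal_aut_group:
  assumes M: "subfield M R" "K \<subseteq> M" and fin: "finite (gal K M)"
  shows "aut_group R M (gal K M)"
proof (intro aut_group.intro aut_group_axioms.intro field_axioms M(1) fin)
  show "gal K M \<subseteq> extensional M" by (auto simp: gal_def)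
  show "(\<lambda>x \<in> M. x) \<in> gal K M"
    using M subringE(3,6,7)[OF subfieldE(1)[OF M(1)]] by (auto simp: gal_def intro!: ring_hom_memI)
  fix g assume g: "g \<in> gal K M"
  show gh: "g \<in> ring_hom (R\<lparr>carrier := M\<rparr>) (R\<lparr>carrier := M\<rparr>)" using g by (simp add: gal_def)
  fix h assume h: "h \<in> gal K M"
  have hh: "h \<in> ring_hom (R\<lparr>carrier := M\<rparr>) (R\<lparr>carrier := M\<rparr>)" using h by (simp add: gal_def)
  note gE = ring_hom_memE[OF gh] and hE = ring_hom_memE[OF hh]
  have "compose M g h \<in> ring_hom (R\<lparr>carrier := M\<rparr>) (R\<lparr>carrier := M\<rparr>)"
    by (rule ring_hom_memI)
      (use gE hE subringE(3,6,7)[OF subfieldE(1)[OF M(1)]] in \<open>auto simp: compose_eq\<close>)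
  moreover have "compose M g h k = k" if "k \<in> K" for k
    using g h that M(2) by (auto simp: gal_def compose_eq)
  ultimately show "compose M g h \<in> gal K M" by (simp add: gal_def)
qed

end

context aut_group
begin

text \<open>Lagrange's theorem in the group with the multiplication \<open>compose M\<close>.\<close>

lemma card_subgroup_dvd:
  assumes H: "aut_group R M H" "H \<subseteq> G"
  shows "card H dvd card G"
proof -
  let ?G = "\<lparr>carrier = G, monoid.mult = compose M, one = (\<lambda>x \<in> M. x)\<rparr>"
  interpret H: aut_group R M H by fact
  interpret \<G>: group ?G
  proof (rule groupI)
    fix f g h assume fgh: "f \<in> carrier ?G" "g \<in> carrier ?G" "h \<in> carrier ?G"
    show "f \<otimes>\<^bsub>?G\<^esub> g \<otimes>\<^bsub>?G\<^esub> h = f \<otimes>\<^bsub>?G\<^esub> (g \<otimes>\<^bsub>?G\<^esub> h)"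
      using fgh act_closed by (auto simp: compose_def fun_eq_iff restrict_def)
  next
    fix g assume g: "g \<in> carrier ?G"
    show "\<one>\<^bsub>?G\<^esub> \<otimes>\<^bsub>?G\<^esub> g = g"
      using g comp[OF one] by (auto intro!: G_ext simp: compose_eq act_closed)
    show "\<exists>h \<in> carrier ?G. h \<otimes>\<^bsub>?G\<^esub> g = \<one>\<^bsub>?G\<^esub>"
    proof -
      have gG: "g \<in> G" using g by simp
      obtain k where k: "k \<in> G" "\<And>x. x \<in> M \<Longrightarrow> g (k x) = x" "\<And>x. x \<in> M \<Longrightarrow> k (g x) = x"
        using act_inverse[OF gG] by metis
      have "compose M k g = (\<lambda>x \<in> M. x)" using k(3) by (auto simp: compose_def restrict_def)
      then show ?thesis using k(1) by auto
    qed
  qed (use one comp in auto)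
  have "subgroup H ?G"
  proof (rule \<G>.subgroupI)
    show "H \<subseteq> carrier ?G" "H \<noteq> {}" using H(2) H.one by auto
    fix g assume g: "g \<in> H"
    obtain k where k: "k \<in> H" "\<And>x. x \<in> M \<Longrightarrow> g (k x) = x" "\<And>x. x \<in> M \<Longrightarrow> k (g x) = x"
      using H.act_inverse[OF g] by metis
    have "compose M k g = (\<lambda>x \<in> M. x)" using k(3) by (auto simp: compose_def restrict_def)
    then have "inv\<^bsub>?G\<^esub> g = k" using \<G>.inv_equality[of k g] k(1) g H(2) by auto
    then show "inv\<^bsub>?G\<^esub> g \<in> H" using k(1) by simp
    fix h assume "h \<in> H"
    then show "g \<otimes>\<^bsub>?G\<^esub> h \<in> H" using H.comp[OF g] by simp
  qed
  then show ?thesis using \<G>.lagrange[of H] by (metis dvd_triv_right order_def partial_object.select_convs(1))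
qed

end

section \<open>Galois closures and their inertia groups\<close>

text \<open>\<open>M\<close> is the Galois closure of \<open>L/K\<close>, in the form that the conjugates of a primitive element
  generate it.\<close>

locale conjugate_field = separable_closure R K for R (structure) and K +
  fixes a L M A
  assumes a: "a \<in> carrier R" and L: "L = simple_extension K a"
    and conj: "\<exists>zs. set zs = zeros (Irr K a) \<and> M = finite_extension K zs"
    and A: "subring A R" "A \<subseteq> K" "integral_closure R A K = A"
begin

definition G where "G = gal K M"
definition T where "T = integral_closure R A M"
definition inertia where "inertia P = {g \<in> G. \<forall>t \<in> T. g t \<ominus> t \<in> P}"

lemma normal:
  assumes "x \<in> M" "y \<in> zeros (Irr K x)"
  shows "\<exists>g \<in> G. g x = y"
  using conj conjugate_field_normal[OF a _ _ assms] by (auto simp: G_def)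

lemma M_subfield: "subfield M R" and M_fd: "finite_dimension K M" and K_M: "K \<subseteq> M"
  and zeros_M: "zeros (Irr K a) \<subseteq> M"
  and M_least: "\<lbrakk>subring N R; K \<subseteq> N; zeros (Irr K a) \<subseteq> N\<rbrakk> \<Longrightarrow> M \<subseteq> N"
proof -
  obtain zs where zs: "set zs = zeros (Irr K a)" "M = finite_extension K zs" using conj by auto
  have zsR: "set zs \<subseteq> carrier R" using zs(1) by (auto simp: zeros_def)
  show "subfield M R" "finite_dimension K M"
    using finite_extension_is_subfield[OF base zsR] finite_extension_finite_dimension(1)[OF base zsR]
      algebraic zsR zs(2) by auto
  show "K \<subseteq> M" "zeros (Irr K a) \<subseteq> M"
    using finite_extension_incl[OF subringE(1)[OF K_subring] zsR] finite_extension_mem[OF K_subring zsR] zs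
    by auto
  show "\<lbrakk>subring N R; K \<subseteq> N; zeros (Irr K a) \<subseteq> N\<rbrakk> \<Longrightarrow> M \<subseteq> N"
    using finite_extension_subring_incl zs by blast
qed

lemmas M_subring = subfieldE(1)[OF M_subfield]

lemma M_in_R: "x \<in> M \<Longrightarrow> x \<in> carrier R" using subringE(1)[OF M_subring] by auto

lemma a_M: "a \<in> M" using zeros_M Irr_root[OF a] a by (auto simp: zeros_def)

lemma L_subfield: "subfield L R" and K_L: "K \<subseteq> L" and a_L: "a \<in> L" and L_M: "L \<subseteq> M"
proof -
  show "subfield L R" using simple_extension_is_subfield[OF base a] algebraic[OF a] L by simp
  show "K \<subseteq> L" "a \<in> L"
    using simple_extension_incl[OF subringE(1)[OF K_subring] a] simple_extension_mem[OF K_subring a] L by auto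
  show "L \<subseteq> M" using simple_extension_subring_incl[OF M_subring K_M a_M] L by simp
qed

lemma ex_primitive: "\<exists>\<eta> \<in> M. M = simple_extension K \<eta>"
  using primitive_element[OF base M_subfield K_M M_fd] Irr_splits_simply M_in_R by blast

lemma zeros_Irr_M: "\<eta> \<in> M \<Longrightarrow> zeros (Irr K \<eta>) \<subseteq> M"
proof
  fix y assume "\<eta> \<in> M" "y \<in> zeros (Irr K \<eta>)"
  then obtain g where "g \<in> G" "g \<eta> = y" using normal by blast
  then show "y \<in> M" using \<open>\<eta> \<in> M\<close> by (auto simp: G_def gal_def dest: ring_hom_memE(1))
qed

lemma G_fixed: "x \<in> M \<Longrightarrow> (\<And>g. g \<in> G \<Longrightarrow> g x = x) \<Longrightarrow> x \<in> K"
  and G_finite: "finite G"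
proof -
  obtain \<eta> where \<eta>: "\<eta> \<in> M" "M = simple_extension K \<eta>" using ex_primitive by auto
  note g = gal_simple_extension[OF base M_in_R[OF \<eta>(1)] algebraic[OF M_in_R[OF \<eta>(1)]]
      Irr_splits_simply[OF M_in_R[OF \<eta>(1)]] \<eta>(2) zeros_Irr_M[OF \<eta>(1)]]
  show "x \<in> M \<Longrightarrow> (\<And>g. g \<in> G \<Longrightarrow> g x = x) \<Longrightarrow> x \<in> K" using g(2) by (simp add: G_def)
  show "finite G" using g(1) by (simp add: G_def)
qed

sublocale aut_group R M G
  using gal_aut_group[OF M_subfield K_M] G_finite by (simp add: G_def)

lemma G_K: "g \<in> G \<Longrightarrow> k \<in> K \<Longrightarrow> g k = k" by (simp add: G_def gal_def)

lemma T_subring: "subring T R"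
  unfolding T_def by (rule integral_closure_subring[OF A(1) M_subring])

lemma T_M: "T \<subseteq> M" by (auto simp: T_def integral_closure_def)

lemma A_M: "A \<subseteq> M" using A(2) K_M by auto

lemma A_T: "A \<subseteq> T"
  unfolding T_def by (rule base_subset_integral_closure[OF A(1) A_M subringE(1)[OF M_subring]])

text \<open>The extension \<open>M/K\<close> is the case \<open>L = M\<close> of the setting above, where the subgroup that belongs to
  \<open>L\<close> is trivial.\<close>

lemma trivial_embedding: "embedded_extension R R M G id K M A"
proof (intro embedded_extension.intro embedded_extension_axioms.intro field_axioms aut_group_axioms
    base M_subfield K_M M_fd A(1,2))
  show "id \<in> ring_hom R R" by (auto intro: ring_hom_memI)
  show "x \<in> M \<Longrightarrow> (\<And>g. g \<in> G \<Longrightarrow> g x = x) \<Longrightarrow> x \<in> id ` K" for x using G_fixed[of x] by simp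
qed (auto simp: G_K)

context
begin

interpretation I: embedded_extension R R M G id K M A by (rule trivial_embedding)

lemma I_rings: "I.RK = A" "I.RL = T" "I.T = T"
  using A(3) by (auto simp: I.RK_def I.RL_def I.T_def T_def)

lemma T_stable: "g \<in> G \<Longrightarrow> t \<in> T \<Longrightarrow> g t \<in> T"
  using I.T_stable[of g t] I_rings by simp

context
  fixes p
  assumes p: "primeideal p (R\<lparr>carrier := A\<rparr>)"
begin

lemma exists_prime_over: "\<exists>P. prime_in T P \<and> P \<inter> A = p"
  using I.exists_prime_above[of p] p I_rings by simp

context
  fixes P
  assumes P: "prime_in T P" "P \<inter> A = p"
begin

interpretation I: embedded_extension_prime R R M G id K M A p P
  by (intro embedded_extension_prime.intro embedded_extension_prime_axioms.intro trivial_embedding)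
    (use p P I_rings in auto)

lemma I_inertia: "aut_group_prime.inertia R G T P = inertia P"
  using I.P.inertia_def unfolding I_rings inertia_def .

lemma I_C: "I.C = G"
proof -
  have "(\<lambda>x \<in> M. g (id x)) = g" if "g \<in> G" for g
    by (rule extensionalityI[of _ M]) (use ext that in auto)
  then show ?thesis unfolding I.C_def by simp
qed

lemma tame_imp_inertia_invertible:
  assumes "tamely_ramified R K M T p"
  shows "[card (inertia P)] \<cdot> \<one> \<notin> P"
proof -
  obtain u where u: "u \<in> T" "(\<Oplus>\<tau> \<in> G. \<tau> u) \<notin> P"
    using I.tame_imp_trace_nonzero assms I_rings I_C by auto
  then have "trace_sum u \<notin> P" by (simp add: trace_sum_def)
  then show ?thesis using I.P.trace_nonzero_imp_inertia_invertible[of u] u(1) I_rings I_inertia by simp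
qed

lemma inertia_invertible_imp_tame:
  assumes "[card (inertia P)] \<cdot> \<one> \<notin> P"
  shows "tamely_ramified R K M T p"
  using I.inertia_invertible_imp_tame assms I_rings I_inertia by simp

lemma inertia_aut_group: "aut_group R M (inertia P)"
  using I.P.inertia_aut_group unfolding I_rings I_inertia .

end

end

end

end

section \<open>Tame ramification after base change\<close>

lemma (in ring) hom_minus:
  assumes S: "ring S" and N: "subring N R" and h: "h \<in> ring_hom (R\<lparr>carrier := N\<rparr>) S"
    and x: "x \<in> N" "y \<in> N"
  shows "h (x \<ominus> y) = h x \<ominus>\<^bsub>S\<^esub> h y"
proof -
  interpret S: ring S by fact
  have R: "x \<in> carrier R" "y \<in> carrier R" using subringE(1)[OF N] x by auto
  have d: "x \<ominus> y \<in> N" using subringE(5,7)[OF N] x by (simp add: a_minus_def)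
  have "h (x \<ominus> y \<oplus> y) = h (x \<ominus> y) \<oplus>\<^bsub>S\<^esub> h y" using ring_hom_memE(3)[OF h, of "x \<ominus> y" y] d x by simp
  moreover have "x \<ominus> y \<oplus> y = x" using R by (simp add: a_minus_def a_assoc l_neg)
  moreover have "h x \<in> carrier S" "h y \<in> carrier S" "h (x \<ominus> y) \<in> carrier S"
    using ring_hom_memE(1)[OF h] x d by auto
  ultimately show ?thesis by (simp add: a_minus_def S.a_assoc S.r_neg)
qed

text \<open>Any extension of \<open>\<iota> \<circ> \<phi>\<close> from \<open>L\<close> to \<open>M\<close>, with values in a field \<open>W\<close> over \<open>E\<close>, gives a Galois
  extension \<open>M'\<close> of \<open>\<iota>(K')\<close> that contains the composite field.\<close>

locale base_change = conjugate_field R K a L M A + E: field E + W: field W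
  for R (structure) and K a L M A and E (structure) and W (structure) +
  fixes \<phi> K' \<iota> \<psi> \<eta>
  assumes \<phi>: "\<phi> \<in> ring_hom (R\<lparr>carrier := L\<rparr>) E"
    and K': "subfield K' E" "\<phi> ` K \<subseteq> K'"
    and \<iota>: "\<iota> \<in> ring_hom E W"
    and \<psi>: "\<psi> \<in> ring_hom (R\<lparr>carrier := M\<rparr>) W" "\<And>x. x \<in> L \<Longrightarrow> \<psi> x = \<iota> (\<phi> x)"
    and \<eta>: "\<eta> \<in> M" "M = simple_extension K \<eta>"
begin

definition L' where "L' = generate_field E (\<phi> ` L \<union> K')"
definition f where "f = map \<psi> (Irr K \<eta>)"
definition K1 where "K1 = \<iota> ` K'"
definition M' where "M' = W.simple_extension K1 (\<psi> \<eta>)"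
definition G' where "G' = W.gal K1 M'"

lemmas \<eta>R = M_in_R[OF \<eta>(1)]

lemma Irr_set: "set (Irr K \<eta>) \<subseteq> K" using set_poly_subset[OF Irr_poly[OF \<eta>R]] .

lemma f_roots: "W.splits_simply f" "W.zeros f = \<psi> ` zeros (Irr K \<eta>)"
proof -
  have "Irr K \<eta> \<in> carrier (M[X]\<^bsub>R\<^esub>)"
    using Irr_poly[OF \<eta>R] K_M by (auto simp: univ_poly_carrier[symmetric] polynomial_def)
  then show "W.splits_simply f" "W.zeros f = \<psi> ` zeros (Irr K \<eta>)"
    unfolding f_def
    using hom_splits_simply[OF W.field_axioms M_subfield \<psi>(1) _ Irr_splits_simply[OF \<eta>R] zeros_Irr_M[OF \<eta>(1)]]
    by auto
qed

lemma \<psi>_K: "k \<in> K \<Longrightarrow> \<psi> k \<in> K1"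
  using \<psi>(2)[of k] K_L K'(2) by (auto simp: K1_def)

lemma K1_subfield: "subfield K1 W"
  unfolding K1_def using E.hom_image_subfield[OF W.field_axioms _ K'(1) subfieldE(3)[OF K'(1)]] \<iota> by simp

lemma \<theta>_carrier: "\<psi> \<eta> \<in> carrier W" using ring_hom_memE(1)[OF \<psi>(1)] \<eta>(1) by simp

lemma f_poly: "f \<in> carrier (K1[X]\<^bsub>W\<^esub>)" "f \<noteq> []" "W.eval f (\<psi> \<eta>) = \<zero>\<^bsub>W\<^esub>"
proof -
  have f: "f \<in> carrier (poly_ring W)" "f \<noteq> []" using f_roots(1) by (auto simp: W.splits_simply_def)
  then show "f \<noteq> []" by simp
  have "set f \<subseteq> K1" using Irr_set \<psi>_K by (auto simp: f_def)
  then show "f \<in> carrier (K1[X]\<^bsub>W\<^esub>)" using f by (simp add: univ_poly_carrier[symmetric] polynomial_def)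
  have "\<eta> \<in> zeros (Irr K \<eta>)" using \<eta>R Irr_root by (simp add: zeros_def)
  then have "\<psi> \<eta> \<in> W.zeros f" using f_roots(2) by simp
  then show "W.eval f (\<psi> \<eta>) = \<zero>\<^bsub>W\<^esub>" by (simp add: W.zeros_def)
qed

text \<open>The minimal polynomial of \<open>\<psi>(\<eta>)\<close> divides the image of that of \<open>\<eta>\<close>, all of whose roots are
  images of conjugates of \<open>\<eta>\<close>. So \<open>M'\<close> is Galois over each field between \<open>\<iota>(K')\<close> and \<open>M'\<close>.\<close>

lemma algebraic_over:
  assumes N: "subfield N W" "K1 \<subseteq> N"
  shows "(W.algebraic over N) (\<psi> \<eta>)" "W.splits_simply (W.Irr N (\<psi> \<eta>))" "W.zeros (W.Irr N (\<psi> \<eta>)) \<subseteq> W.zeros f"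
proof -
  have fN: "f \<in> carrier (N[X]\<^bsub>W\<^esub>)"
    using f_poly(1) N(2) by (auto simp: univ_poly_carrier[symmetric] polynomial_def)
  show alg: "(W.algebraic over N) (\<psi> \<eta>)" using W.algebraicI[OF fN f_poly(2,3)] by (simp add: over_def)
  have "W.Irr N (\<psi> \<eta>) pdivides\<^bsub>W\<^esub> f" using W.Irr_minimal[OF N(1) \<theta>_carrier alg fN f_poly(3)] .
  moreover have "W.Irr N (\<psi> \<eta>) \<in> carrier (poly_ring W)"
    using W.IrrE(1)[OF N(1) \<theta>_carrier alg] W.carrier_polynomial_shell[OF subfieldE(1)[OF N(1)]] by simp
  ultimately show "W.splits_simply (W.Irr N (\<psi> \<eta>))" "W.zeros (W.Irr N (\<psi> \<eta>)) \<subseteq> W.zeros f"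
    using W.splits_simply_divisor[OF f_roots(1)] by auto
qed

lemma M'_subfield: "subfield M' W"
  unfolding M'_def using W.simple_extension_is_subfield[OF K1_subfield \<theta>_carrier] algebraic_over(1)[OF K1_subfield]
  by simp

lemma K1_M': "K1 \<subseteq> M'" and \<theta>_M': "\<psi> \<eta> \<in> M'"
  unfolding M'_def
  using W.simple_extension_incl[OF subfieldE(3)[OF K1_subfield] \<theta>_carrier]
    W.simple_extension_mem[OF subfieldE(1)[OF K1_subfield] \<theta>_carrier] by auto

lemma \<psi>_M': "x \<in> M \<Longrightarrow> \<psi> x \<in> M'"
  using hom_simple_extension_mem[OF W.field_axioms M_subring \<psi>(1) K_subring K_M \<eta>(1) _
      subfieldE(1)[OF M'_subfield] _ \<theta>_M'] \<psi>_K K1_M' \<eta>(2) by auto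

lemma composite: "subfield L' E" "E.finite_dimension K' L'" "L' = E.simple_extension K' (\<phi> a)"
  "\<phi> a \<in> carrier E"
  unfolding L'_def using composite_field[OF E.field_axioms base a algebraic[OF a] L \<phi> K'] by auto

lemma K'_L': "K' \<subseteq> L'" by (auto simp: L'_def intro: generate_field.incl)

lemma \<iota>_L': "\<iota> ` L' \<subseteq> M'"
proof
  have h: "\<iota> \<in> ring_hom (E\<lparr>carrier := carrier E\<rparr>) W" using \<iota> by simp
  fix y assume "y \<in> \<iota> ` L'"
  then obtain x where x: "x \<in> E.simple_extension K' (\<phi> a)" "y = \<iota> x" using composite(3) by auto
  have "\<iota> (\<phi> a) \<in> M'" using \<psi>_M'[OF a_M] \<psi>(2)[OF a_L] by simp
  then show "y \<in> M'"
    using E.hom_simple_extension_mem[OF W.field_axioms E.carrier_is_subring h subfieldE(1,3)[OF K'(1)]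
        composite(4) x(1) subfieldE(1)[OF M'_subfield]] K1_M' x(2) by (simp add: K1_def)
qed

lemma L1_subfield: "subfield (\<iota> ` L') W"
  using E.hom_image_subfield[OF W.field_axioms _ composite(1) subfieldE(3)[OF composite(1)]] \<iota> by simp

lemma K1_L1: "K1 \<subseteq> \<iota> ` L'" using K'_L' by (auto simp: K1_def)

lemma gal_M':
  assumes N: "subfield N W" "K1 \<subseteq> N" "N \<subseteq> M'"
  shows "finite (W.gal N M')" "\<And>x. x \<in> M' \<Longrightarrow> (\<And>g. g \<in> W.gal N M' \<Longrightarrow> g x = x) \<Longrightarrow> x \<in> N"
proof -
  note alg = algebraic_over[OF N(1,2)]
  have eq: "M' = W.simple_extension N (\<psi> \<eta>)"
    using W.mono_simple_extension[OF N(2), of "\<psi> \<eta>"]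
      W.simple_extension_subring_incl[OF subfieldE(1)[OF M'_subfield] N(3) \<theta>_M'] M'_def by auto
  have z: "W.zeros (W.Irr N (\<psi> \<eta>)) \<subseteq> M'"
    using alg(3) f_roots(2) zeros_Irr_M[OF \<eta>(1)] \<psi>_M' by auto
  show "finite (W.gal N M')" "\<And>x. x \<in> M' \<Longrightarrow> (\<And>g. g \<in> W.gal N M' \<Longrightarrow> g x = x) \<Longrightarrow> x \<in> N"
    using W.gal_simple_extension[OF N(1) \<theta>_carrier alg(1,2) eq z] by auto
qed

lemma embedding: "embedded_extension E W M' G' \<iota> K' L' (\<phi> ` A)"
proof (intro embedded_extension.intro embedded_extension_axioms.intro E.field_axioms \<iota> K'(1)
    composite(1,2) K'_L' \<iota>_L')
  show "aut_group W M' G'"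
    unfolding G'_def using W.gal_aut_group[OF M'_subfield K1_M' gal_M'(1)[OF K1_subfield _ K1_M']] by simp
  show "g (\<iota> k) = \<iota> k" if "g \<in> G'" "k \<in> K'" for g k using that by (simp add: G'_def W.gal_def K1_def)
  show "x \<in> \<iota> ` K'" if "x \<in> M'" "\<And>g. g \<in> G' \<Longrightarrow> g x = x" for x
    using gal_M'(2)[OF K1_subfield _ K1_M' that(1)] that(2) by (simp add: G'_def K1_def)
  show "subring (\<phi> ` A) E" using hom_image_subring[OF E.ring_axioms \<phi> A(1)] A(2) K_L by auto
  show "\<phi> ` A \<subseteq> K'" using A(2) K'(2) by auto
qed

text \<open>An automorphism of \<open>M'\<close> permutes the conjugates of the primitive element \<open>\<eta>\<close> and therefore
  comes from an automorphism of \<open>M\<close>.\<close>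

lemma restriction:
  assumes h: "h \<in> G'"
  shows "\<exists>g \<in> G. \<forall>x \<in> M. \<psi> (g x) = h (\<psi> x)"
proof -
  have hW: "h \<in> ring_hom (W\<lparr>carrier := M'\<rparr>) W"
    using W.gal_imp_hom[OF _ subfieldE(1)[OF M'_subfield]] h by (simp add: G'_def)
  have hK: "h k = k" if "k \<in> K1" for k using h that by (simp add: G'_def W.gal_def)
  have "W.eval f (h (\<psi> \<eta>)) = \<zero>\<^bsub>W\<^esub>"
    by (rule W.fixing_hom_root[OF subfieldE(1)[OF M'_subfield] hW hK K1_M' W.set_poly_subset[OF f_poly(1)]
          \<theta>_M' f_poly(3)])
  moreover have "h (\<psi> \<eta>) \<in> carrier W" using ring_hom_memE(1)[OF hW] \<theta>_M' by simp
  ultimately have "h (\<psi> \<eta>) \<in> W.zeros f" by (simp add: W.zeros_def)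
  then obtain y where y: "y \<in> zeros (Irr K \<eta>)" "h (\<psi> \<eta>) = \<psi> y" using f_roots(2) by auto
  obtain g where g: "g \<in> G" "g \<eta> = y" using normal[OF \<eta>(1) y(1)] by auto
  have 1: "\<psi> \<circ> g \<in> ring_hom (R\<lparr>carrier := M\<rparr>) W"
    using ring_hom_trans[OF hom[OF g(1)] \<psi>(1)] .
  have "\<psi> \<in> ring_hom (R\<lparr>carrier := M\<rparr>) (W\<lparr>carrier := M'\<rparr>)"
    using ring_hom_memE[OF \<psi>(1)] \<psi>_M' by (intro ring_hom_memI) auto
  then have 2: "h \<circ> \<psi> \<in> ring_hom (R\<lparr>carrier := M\<rparr>) W"
    using ring_hom_trans[OF _ hW] by auto
  have "(\<psi> \<circ> g) x = (h \<circ> \<psi>) x" if "x \<in> M" for x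
  proof (rule hom_determined_on_simple_extension[OF W.ring_axioms K_subring \<eta>R
        1[unfolded \<eta>(2)] 2[unfolded \<eta>(2)] _ _ that[unfolded \<eta>(2)]])
    show "(\<psi> \<circ> g) k = (h \<circ> \<psi>) k" if "k \<in> K" for k using G_K[OF g(1) that] hK[OF \<psi>_K[OF that]] by simp
    show "(\<psi> \<circ> g) \<eta> = (h \<circ> \<psi>) \<eta>" using g(2) y(2) by simp
  qed
  then show ?thesis using g(1) by auto
qed

lemma restriction_inj:
  assumes h: "h \<in> G'" "k \<in> G'" and eq: "\<And>x. x \<in> M \<Longrightarrow> h (\<psi> x) = k (\<psi> x)"
  shows "h = k"
proof (rule extensionalityI[of _ M'])
  show "h \<in> extensional M'" "k \<in> extensional M'" using h by (auto simp: G'_def W.gal_def)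
  fix y assume y: "y \<in> M'"
  have W: "h \<in> ring_hom (W\<lparr>carrier := M'\<rparr>) W" "k \<in> ring_hom (W\<lparr>carrier := M'\<rparr>) W"
    using W.gal_imp_hom[OF _ subfieldE(1)[OF M'_subfield]] h by (auto simp: G'_def)
  show "h y = k y"
    by (rule W.hom_determined_on_simple_extension[OF W.ring_axioms subfieldE(1)[OF K1_subfield] \<theta>_carrier])
      (use W[unfolded M'_def] h y eq[OF \<eta>(1)] in \<open>auto simp: G'_def W.gal_def M'_def\<close>)
qed

text \<open>Restriction embeds the inertia group of a prime \<open>P'\<close> above into the inertia group of
  \<open>\<psi>\<^sup>-\<^sup>1(P')\<close>, so the order of the former divides the order of the latter.\<close>

theorem tame_base_change:
  assumes p: "primeideal p (R\<lparr>carrier := A\<rparr>)" and tame: "tamely_ramified R K M T p"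
    and q: "primeideal q (E\<lparr>carrier := integral_closure E (\<phi> ` A) K'\<rparr>)" "q \<inter> \<phi> ` A = \<phi> ` p"
  shows "tamely_ramified E K' L' (integral_closure E (\<phi> ` A) L') q"
proof -
  interpret X: embedded_extension E W M' G' \<iota> K' L' "\<phi> ` A" by (rule embedding)
  have q': "primeideal q (E\<lparr>carrier := X.RK\<rparr>)" using q(1) by (simp add: X.RK_def)
  obtain P' where P': "W.prime_in X.T P'" "P' \<inter> \<iota> ` X.RK = \<iota> ` q" using X.exists_prime_above[OF q'] by auto
  interpret X: embedded_extension_prime E W M' G' \<iota> K' L' "\<phi> ` A" q P'
    by (intro embedded_extension_prime.intro embedded_extension_prime_axioms.intro embedding q' P')
  have \<psi>A: "\<psi> ` A = \<iota> ` \<phi> ` A" using \<psi>(2) A(2) K_L by (force simp: image_image)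
  have \<psi>T: "\<psi> t \<in> X.T" if t: "t \<in> T" for t
    unfolding X.T_def \<psi>A[symmetric]
  proof (rule integral_image[OF W.ring_axioms M_subring \<psi>(1) A_M])
    show "b = \<zero>" if "b \<in> A" "\<psi> b = \<zero>\<^bsub>W\<^esub>" for b
      using inj_onD[OF hom_inj_on_subfield[OF W.field_axioms M_subfield \<psi>(1)], of b \<zero>] that A_M ME(2)
        hom_zero[OF W.ring_axioms M_subring \<psi>(1)] by auto
  qed (use t T_M \<psi>_M' in \<open>auto simp: T_def\<close>)
  define P where "P = {t \<in> T. \<psi> t \<in> P'}"
  have \<psi>TT: "\<psi> \<in> ring_hom (R\<lparr>carrier := T\<rparr>) W" using ring_hom_restrict[OF \<psi>(1) T_M] .
  have P: "prime_in T P"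
    unfolding P_def by (rule prime_in_contraction[OF W.ring_axioms T_subring \<psi>TT _ P'(1)]) (use \<psi>T in auto)
  interpret P: subring_prime R T P
    by (intro subring_prime.intro subring_prime_axioms.intro domain_axioms T_subring P)
  have pA: "p \<subseteq> A" using prime_in_iff[OF A(1), of p] p by (simp add: prime_in_def)
  have inj\<phi>: "inj_on \<phi> L" using hom_inj_on_subfield[OF E.field_axioms L_subfield \<phi>] .
  have AL: "A \<subseteq> L" using A(2) K_L by auto
  have "r \<in> P \<longleftrightarrow> r \<in> p" if r: "r \<in> A" for r
  proof -
    have "\<phi> r \<in> X.RK"
      unfolding X.RK_def using E.base_subset_integral_closure[OF X.A subfieldE(3)[OF K'(1)]] r by auto
    then have "\<psi> r \<in> P' \<longleftrightarrow> \<phi> r \<in> q" using X.q_mem_iff \<psi>(2) r AL by auto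
    also have "\<dots> \<longleftrightarrow> \<phi> r \<in> \<phi> ` p" using q(2) r by blast
    also have "\<dots> \<longleftrightarrow> r \<in> p" using inj_on_image_mem_iff[OF inj\<phi>] r AL pA by blast
    finally show ?thesis using r A_T by (auto simp: P_def)
  qed
  then have PA: "P \<inter> A = p" using pA by auto
  have inv: "[card (inertia P)] \<cdot> \<one> \<notin> P" using tame_imp_inertia_invertible[OF p P PA tame] .
  define J where "J = {g \<in> G. \<exists>h \<in> X.P.inertia. \<forall>x \<in> M. \<psi> (g x) = h (\<psi> x)}"
  have IG: "h \<in> G'" if "h \<in> X.P.inertia" for h using that by (simp add: X.P.inertia_def)
  have \<psi>inj: "x = y" if "x \<in> M" "y \<in> M" "\<psi> x = \<psi> y" for x y
    using inj_onD[OF hom_inj_on_subfield[OF W.field_axioms M_subfield \<psi>(1)]] that by blast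
  have JI: "J \<subseteq> inertia P"
  proof
    fix g assume "g \<in> J"
    then obtain h where g: "g \<in> G" and h: "h \<in> X.P.inertia" "\<And>x. x \<in> M \<Longrightarrow> \<psi> (g x) = h (\<psi> x)"
      by (auto simp: J_def)
    have "g t \<ominus> t \<in> P" if t: "t \<in> T" for t
    proof -
      have tM: "t \<in> M" "g t \<in> M" using t T_M act_closed[OF g] by auto
      have "\<psi> (g t \<ominus> t) = \<psi> (g t) \<ominus>\<^bsub>W\<^esub> \<psi> t"
        using hom_minus[OF W.ring_axioms M_subring \<psi>(1) tM(2,1)] .
      also have "\<dots> \<in> P'" using h \<psi>T[OF t] tM by (simp add: X.P.inertia_def)
      finally show ?thesis using P.T_minus[OF T_stable[OF g t] t] by (simp add: P_def)
    qed
    then show "g \<in> inertia P" using g by (simp add: inertia_def)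
  qed
  have "\<exists>g \<in> J. \<forall>x \<in> M. \<psi> (g x) = h (\<psi> x)" if "h \<in> X.P.inertia" for h
    using restriction[OF IG[OF that]] that by (auto simp: J_def)
  then obtain r where r: "\<And>h. h \<in> X.P.inertia \<Longrightarrow> r h \<in> J"
    "\<And>h x. h \<in> X.P.inertia \<Longrightarrow> x \<in> M \<Longrightarrow> \<psi> (r h x) = h (\<psi> x)" by metis
  have "bij_betw r X.P.inertia J"
  proof (rule bij_betw_imageI)
    show "inj_on r X.P.inertia"
    proof (rule inj_onI)
      fix h k assume hk: "h \<in> X.P.inertia" "k \<in> X.P.inertia" "r h = r k"
      show "h = k"
        by (rule restriction_inj[OF IG[OF hk(1)] IG[OF hk(2)]]) (use r(2) hk in metis)
    qed
    show "r ` X.P.inertia = J"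
    proof (intro equalityI subsetI)
      fix g assume "g \<in> J"
      then obtain h where g: "g \<in> G" and h: "h \<in> X.P.inertia" "\<And>x. x \<in> M \<Longrightarrow> \<psi> (g x) = h (\<psi> x)"
        by (auto simp: J_def)
      have rG: "r h \<in> G" using r(1)[OF h(1)] by (simp add: J_def)
      have "g = r h"
        by (rule G_ext[OF g rG], rule \<psi>inj) (use h r(2)[OF h(1)] act_closed[OF g] act_closed[OF rG] in auto)
      then show "g \<in> r ` X.P.inertia" using h(1) by simp
    qed (use r(1) in auto)
  qed
  then have card: "card X.P.inertia = card J" by (rule bij_betw_same_card)
  interpret IX: aut_group W M' X.P.inertia by (rule X.P.inertia_aut_group)
  have "aut_group R M J"
  proof (intro aut_group.intro aut_group_axioms.intro field_axioms M_subfield)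
    show "finite J" "J \<subseteq> extensional M" using fin ext by (auto simp: J_def)
    show "(\<lambda>x \<in> M. x) \<in> J" using one IX.one \<psi>_M' by (auto simp: J_def intro!: bexI[OF _ IX.one])
    fix g assume g: "g \<in> J"
    show "g \<in> ring_hom (R\<lparr>carrier := M\<rparr>) (R\<lparr>carrier := M\<rparr>)" using g hom by (simp add: J_def)
    fix h assume h: "h \<in> J"
    obtain g' h' where gh: "g \<in> G" "h \<in> G" "g' \<in> X.P.inertia" "h' \<in> X.P.inertia"
      "\<And>x. x \<in> M \<Longrightarrow> \<psi> (g x) = g' (\<psi> x)" "\<And>x. x \<in> M \<Longrightarrow> \<psi> (h x) = h' (\<psi> x)"
      using g h by (auto simp: J_def)
    have "\<psi> (compose M g h x) = compose M' g' h' (\<psi> x)" if "x \<in> M" for x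
      using gh(5)[OF act_closed[OF gh(2) that]] gh(6)[OF that] that \<psi>_M' by (simp add: compose_eq)
    then show "compose M g h \<in> J" using comp[OF gh(1,2)] IX.comp[OF gh(3,4)] by (auto simp: J_def)
  qed
  then have "card J dvd card (inertia P)"
    using aut_group.card_subgroup_dvd[OF inertia_aut_group[OF p P PA] _ JI] by simp
  then obtain c where c: "card (inertia P) = card X.P.inertia * c" using card by auto
  have \<psi>nat: "\<psi> ([(n::nat)] \<cdot> \<one>) = [n] \<cdot>\<^bsub>W\<^esub> \<one>\<^bsub>W\<^esub> \<and> [n] \<cdot> \<one> \<in> T" for n
  proof (induct n)
    case 0
    show ?case using hom_zero[OF W.ring_axioms M_subring \<psi>(1)] P.TE(2) by simp
  next
    case (Suc n)
    then show ?case
      using ring_hom_memE(3)[OF \<psi>TT, of "[n] \<cdot> \<one>" \<one>] ring_hom_memE(4)[OF \<psi>TT] P.TE(3,7) by simp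
  qed
  have "[card X.P.inertia] \<cdot>\<^bsub>W\<^esub> \<one>\<^bsub>W\<^esub> \<notin> P'"
  proof
    assume "[card X.P.inertia] \<cdot>\<^bsub>W\<^esub> \<one>\<^bsub>W\<^esub> \<in> P'"
    then have "[card X.P.inertia] \<cdot> \<one> \<in> P" using \<psi>nat by (simp add: P_def)
    then have "([card X.P.inertia] \<cdot> \<one>) \<otimes> ([c] \<cdot> \<one>) \<in> P" using P.P_mult' \<psi>nat by blast
    moreover have "([card X.P.inertia] \<cdot> \<one>) \<otimes> ([c] \<cdot> \<one>) = [card (inertia P)] \<cdot> \<one>"
      unfolding c by (simp add: add_pow_ldistr add_pow_rdistr add.nat_pow_pow mult.commute)
    ultimately show False using inv by simp
  qed
  moreover have "x \<in> \<iota> ` L'" if x: "x \<in> M'" "\<And>g. g \<in> X.H \<Longrightarrow> g x = x" for x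
  proof (rule gal_M'(2)[OF L1_subfield K1_L1 \<iota>_L' x(1)])
    fix g assume "g \<in> W.gal (\<iota> ` L') M'"
    then have "g \<in> G'" "\<forall>x \<in> L'. g (\<iota> x) = \<iota> x" using K1_L1 by (auto simp: G'_def W.gal_def)
    then have "g \<in> X.H" by (simp add: X.H_def)
    then show "g x = x" by (rule x(2))
  qed
  ultimately show ?thesis using X.inertia_invertible_imp_tame by (simp add: X.RL_def)
qed

end

section \<open>Universal tameness\<close>

lemma (in aut_group) fixed_subfield: "subfield {x \<in> M. \<forall>g \<in> G. g x = x} R"
proof (rule subfieldI')
  show "subring {x \<in> M. \<forall>g \<in> G. g x = x} R"
  proof (rule subringI)
    show "{x \<in> M. \<forall>g \<in> G. g x = x} \<subseteq> carrier R" using ME(1) by auto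
    show "\<one> \<in> {x \<in> M. \<forall>g \<in> G. g x = x}" using ME(3) act_one by simp
    fix x assume "x \<in> {x \<in> M. \<forall>g \<in> G. g x = x}"
    then have x: "x \<in> M" "\<And>g. g \<in> G \<Longrightarrow> g x = x" by blast+
    have "g (\<ominus> x) = \<ominus> x" if "g \<in> G" for g using act_neg[OF that x(1)] x(2)[OF that] by simp
    then show "\<ominus> x \<in> {x \<in> M. \<forall>g \<in> G. g x = x}" using ME(5) x(1) by blast
    fix y assume "y \<in> {x \<in> M. \<forall>g \<in> G. g x = x}"
    then have y: "y \<in> M" "\<And>g. g \<in> G \<Longrightarrow> g y = y" by blast+
    have "g (x \<otimes> y) = x \<otimes> y" "g (x \<oplus> y) = x \<oplus> y" if "g \<in> G" for g
      using act_mult[OF that x(1) y(1)] act_add[OF that x(1) y(1)] x(2)[OF that] y(2)[OF that] by auto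
    then show "x \<otimes> y \<in> {x \<in> M. \<forall>g \<in> G. g x = x}" "x \<oplus> y \<in> {x \<in> M. \<forall>g \<in> G. g x = x}"
      using ME(6,7) x(1) y(1) by blast+
  qed
  fix x assume "x \<in> {x \<in> M. \<forall>g \<in> G. g x = x} - {\<zero>}"
  then have x: "x \<in> M" "x \<noteq> \<zero>" "\<And>g. g \<in> G \<Longrightarrow> g x = x" by blast+
  have i: "inv x \<in> M" "x \<otimes> inv x = \<one>" using subfield_m_inv(1,2)[OF M, of x] x(1,2) by auto
  have "g (inv x) = inv x" if g: "g \<in> G" for g
  proof -
    have "x \<otimes> g (inv x) = \<one>"
      using act_mult[OF g x(1) i(1)] act_one[OF g] i(2) x(3)[OF g] by simp
    then show ?thesis
      using comm_inv_char[OF M_carrier[OF x(1)] M_carrier[OF act_closed[OF g i(1)]]] by simp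
  qed
  then show "inv x \<in> {x \<in> M. \<forall>g \<in> G. g x = x}" using i(1) by blast
qed

text \<open>\<open>M\<close> is a simple extension of \<open>L\<close>, and in an algebraically closed field the minimal polynomial of
  its generator acquires a root.\<close>

lemma (in conjugate_field) extend_to_M:
  assumes W: "algebraically_closed W" and h: "h \<in> ring_hom (R\<lparr>carrier := L\<rparr>) W"
  shows "\<exists>\<psi> \<in> ring_hom (R\<lparr>carrier := M\<rparr>) W. \<forall>x \<in> L. \<psi> x = h x"
proof -
  interpret W: algebraically_closed W by fact
  obtain \<eta> where \<eta>: "\<eta> \<in> M" "M = simple_extension K \<eta>" using ex_primitive by auto
  note \<eta>R = M_in_R[OF \<eta>(1)] and L1 = subfieldE(1)[OF L_subfield]
  have alg: "(algebraic over L) \<eta>"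
    using algebraic_mono[OF K_L] algebraic[OF \<eta>R] by (simp add: over_def)
  have M: "M = simple_extension L \<eta>"
    using mono_simple_extension[OF K_L, of \<eta>] simple_extension_subring_incl[OF M_subring L_M \<eta>(1)] \<eta>(2)
    by auto
  note I = IrrE[OF L_subfield \<eta>R alg]
  have deg: "degree (Irr L \<eta>) \<ge> 1" using pirreducible_degree[OF L_subfield I(1,2)] .
  let ?f = "map h (Irr L \<eta>)"
  have f: "?f \<in> carrier (poly_ring W)"
    using ring_hom_memE(1)[OF map_poly_hom[OF W.field_axioms L_subfield h] I(1)] .
  have "W.splitted ?f" using W.roots_over_carrier[OF f] .
  then have "W.roots ?f \<noteq> {#}" using deg by (auto simp: W.splitted_def)
  then obtain z where "z \<in># W.roots ?f" by auto
  then have z: "z \<in> carrier W" "W.eval ?f z = \<zero>\<^bsub>W\<^esub>"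
    using W.roots_mem_iff_is_root[OF f] by (auto simp: W.is_root_def)
  show ?thesis
    using hom_extends_to_simple_extension[OF W.field_axioms L_subfield h \<eta>R alg z] M by metis
qed

context conjugate_field
begin

text \<open>The base change is carried out in an algebraic closure \<open>W\<close> of \<open>E\<close>, as \<open>M\<close> need not embed into \<open>E\<close>.\<close>

theorem tame_imp_universally_tame:
  assumes p: "primeideal p (R\<lparr>carrier := A\<rparr>)" and tame: "tamely_ramified R K M T p"
  shows "universally_tamely_ramified TYPE('e) R K L A (integral_closure R A L) p"
  unfolding universally_tamely_ramified_def Let_def
proof (intro allI impI)
  fix E :: "'e ring" and \<phi> K' q
  assume as: "field E \<and> \<phi> \<in> ring_hom (R\<lparr>carrier := L\<rparr>) E \<and> subfield K' E \<and> \<phi> ` K \<subseteq> K'"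
    and q: "primeideal q (E\<lparr>carrier := integral_closure E (\<phi> ` A) K'\<rparr>) \<and> q \<inter> \<phi> ` A = \<phi> ` p"
  interpret E: field E using as by simp
  define W where "W = E.alg_closure"
  define \<iota> where "\<iota> = (E.indexed_const :: 'e \<Rightarrow> ('e list \<times> nat) multiset \<Rightarrow> 'e)"
  have \<iota>: "\<iota> \<in> ring_hom E W" using E.alg_closureE(2) by (simp add: W_def \<iota>_def)
  interpret W: algebraic_closure W "\<iota> ` carrier E"
    using E.alg_closureE(1) by (simp add: W_def \<iota>_def)
  have "\<iota> \<circ> \<phi> \<in> ring_hom (R\<lparr>carrier := L\<rparr>) W" using ring_hom_trans[OF conjunct1[OF conjunct2[OF as]] \<iota>] .
  from extend_to_M[OF W.algebraically_closed_axioms this]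
  obtain \<psi> where \<psi>: "\<psi> \<in> ring_hom (R\<lparr>carrier := M\<rparr>) W" "\<And>x. x \<in> L \<Longrightarrow> \<psi> x = \<iota> (\<phi> x)" by auto
  obtain \<eta> where \<eta>: "\<eta> \<in> M" "M = simple_extension K \<eta>" using ex_primitive by auto
  interpret B: base_change R K a L M A E W \<phi> K' \<iota> \<psi> \<eta>
    by (intro base_change.intro base_change_axioms.intro conjugate_field_axioms E.field_axioms W.field_axioms)
      (use as \<iota> \<psi> \<eta> in auto)
  have "A \<subseteq> L" using A(2) K_L by auto
  then have "integral_closure E (\<phi> ` integral_closure R A L) B.L' = integral_closure E (\<phi> ` A) B.L'"
    using integral_closure_image_trans[OF E.field_axioms L_subfield B.\<phi> A(1) _ subfieldE(3)[OF B.composite(1)]]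
    by simp
  then show "tamely_ramified E K' (generate_field E (\<phi> ` L \<union> K'))
      (integral_closure E (\<phi> ` integral_closure R A L) (generate_field E (\<phi> ` L \<union> K'))) q"
    using B.tame_base_change[OF p tame] q by (simp add: B.L'_def)
qed

text \<open>For \<open>g \<in> G\<close> and a group \<open>J\<close> of inertial automorphisms, the base change of \<open>L\<close> along
  \<open>g\<close> to the fixed field of \<open>J\<close> lies in the Galois extension \<open>M\<close> with group \<open>J\<close>, and its trace is
  congruent modulo \<open>P\<close> to multiplication by the index of the stabilizer of \<open>g(L)\<close>. The field \<open>E\<close> is
  a copy of the ambient field, carried to the type \<open>'e\<close> by an injection.\<close>

lemma universally_tame_imp_index_invertible:
  fixes c :: "'a \<Rightarrow> 'e"
  assumes c: "inj c" and p: "primeideal p (R\<lparr>carrier := A\<rparr>)"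
    and utame: "universally_tamely_ramified TYPE('e) R K L A (integral_closure R A L) p"
    and P: "prime_in T P" "P \<inter> A = p"
    and J: "aut_group R M J" "J \<subseteq> inertia P" and g: "g \<in> G"
  shows "\<exists>i. [(i::nat)] \<cdot> \<one> \<notin> P \<and> (\<exists>H. aut_group R M H \<and> H \<subseteq> J \<and> (\<forall>h \<in> H. h (g a) = g a) \<and> card J = i * card H)"
proof -
  interpret J: aut_group R M J by fact
  have JG: "h \<in> G" if "h \<in> J" for h using J(2) that by (auto simp: inertia_def)
  define E where "E = image_ring c R"
  have cR: "inj_on c (carrier R)" using c inj_on_subset by blast
  interpret E: field E unfolding E_def using inj_imp_image_ring_is_field[OF cR] .
  have iso: "c \<in> ring_iso R E" unfolding E_def using inj_imp_image_ring_iso[OF cR] .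
  define d where "d = inv_into (carrier R) c"
  have d: "d \<in> ring_iso E R" unfolding d_def using ring_iso_set_sym[OF ring_axioms iso] .
  have ch: "c \<in> ring_hom R E" and dh: "d \<in> ring_hom E R" using iso d by (auto simp: ring_iso_def)
  have dc: "d (c x) = x" if "x \<in> carrier R" for x using inv_into_f_f[OF cR that] by (simp add: d_def)
  have chM: "c \<in> ring_hom (R\<lparr>carrier := carrier R\<rparr>) E" using ch by simp
  note L_in_M = subsetD[OF L_M]
  have gL: "g \<in> ring_hom (R\<lparr>carrier := L\<rparr>) R" using ring_hom_restrict[OF act_hom[OF g] L_M] .
  define \<phi> where "\<phi> = c \<circ> g"
  have \<phi>: "\<phi> \<in> ring_hom (R\<lparr>carrier := L\<rparr>) E" unfolding \<phi>_def using ring_hom_trans[OF gL ch] .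
  have \<phi>K: "\<phi> k = c k" if "k \<in> K" for k using G_K[OF g that] by (simp add: \<phi>_def)
  define N where "N = {x \<in> M. \<forall>h \<in> J. h x = x}"
  have Nf: "subfield N R" unfolding N_def by (rule J.fixed_subfield)
  have KN: "K \<subseteq> N" using K_M JG G_K by (auto simp: N_def)
  have NR: "N \<subseteq> carrier R" using subfieldE(3)[OF Nf] .
  define K' where "K' = c ` N"
  have K': "subfield K' E" "\<phi> ` K \<subseteq> K'"
    unfolding K'_def using hom_image_subfield[OF E.field_axioms chM Nf NR] \<phi>K KN by auto
  define L' where "L' = generate_field E (\<phi> ` L \<union> K')"
  note comp = composite_field[OF E.field_axioms base a algebraic[OF a] L \<phi> K', folded L'_def]
  have gen: "\<phi> ` L \<union> K' \<subseteq> L'" by (auto simp: L'_def intro: generate_field.incl)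
  have cM: "subfield (c ` M) E"
    using hom_image_subfield[OF E.field_axioms chM M_subfield subringE(1)[OF M_subring]] .
  have gen_M: "\<phi> ` L \<union> K' \<subseteq> c ` M" using act_closed[OF g] L_in_M by (auto simp: \<phi>_def K'_def N_def)
  have L'M: "L' \<subseteq> c ` M"
    unfolding L'_def
    using E.generate_field_min_subfield1[OF subset_trans[OF gen_M subfieldE(3)[OF cM]] cM gen_M] .
  have \<phi>A: "\<phi> ` A = c ` A" by (rule image_cong) (use \<phi>K A(2) in auto)
  have "d ` c ` A = (\<lambda>x. x) ` A"
    unfolding image_image by (rule image_cong) (use dc subringE(1)[OF A(1)] in auto)
  then have dcA: "d ` \<phi> ` A = A" unfolding \<phi>A by simp
  have AL: "A \<subseteq> L" using A(2) K_L by auto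
  have emb: "embedded_extension E R M J d K' L' (\<phi> ` A)"
  proof (intro embedded_extension.intro embedded_extension_axioms.intro E.field_axioms J(1) dh K'(1) comp(1,2))
    show "K' \<subseteq> L'" using gen by auto
    show "d ` L' \<subseteq> M"
    proof
      fix y assume "y \<in> d ` L'"
      then obtain x where "x \<in> M" "y = d (c x)" using L'M by blast
      then show "y \<in> M" using dc[OF M_in_R[of x]] by simp
    qed
    show "h (d k) = d k" if h: "h \<in> J" and k: "k \<in> K'" for h k
    proof -
      obtain x where x: "x \<in> N" "k = c x" using k unfolding K'_def by blast
      have "h x = x" using x(1) h unfolding N_def by blast
      moreover have "d k = x" using dc[OF subsetD[OF NR x(1)]] x(2) by simp
      ultimately show ?thesis by simp
    qed
    show "x \<in> d ` K'" if x: "x \<in> M" "\<And>h. h \<in> J \<Longrightarrow> h x = x" for x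
    proof -
      have "x \<in> N" unfolding N_def using x by blast
      then have "d (c x) \<in> d ` K'" unfolding K'_def by blast
      then show ?thesis using dc[OF M_in_R[OF x(1)]] by simp
    qed
    show "subring (\<phi> ` A) E" using hom_image_subring[OF E.ring_axioms \<phi> A(1) AL] .
    show "\<phi> ` A \<subseteq> K'" using A(2) K'(2) by auto
  qed
  interpret X: embedded_extension E R M J d K' L' "\<phi> ` A" by (rule emb)
  have XT: "X.T = T" unfolding X.T_def dcA T_def ..
  have XRK: "X.RK = integral_closure E (\<phi> ` A) K'" by (simp add: X.RK_def)
  define q where "q = {x \<in> X.RK. d x \<in> P}"
  have dRK: "d ` X.RK \<subseteq> T" using X.mem_RL_iff X.RK_iff X.RL_L XT by auto
  have "d \<in> ring_hom (E\<lparr>carrier := X.RK\<rparr>) R"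
    using E.ring_hom_restrict[of d "carrier E" R X.RK] dh subringE(1)[OF X.RK_subring] by simp
  then have q: "primeideal q (E\<lparr>carrier := X.RK\<rparr>)"
    unfolding E.prime_in_iff[OF X.RK_subring] q_def
    by (rule E.prime_in_contraction[OF ring_axioms X.RK_subring _ dRK P(1)])
  have qA: "q \<inter> \<phi> ` A = \<phi> ` p"
  proof -
    have pA: "p \<subseteq> A" using P(2) by auto
    have "c r \<in> X.RK" if "r \<in> A" for r
      unfolding X.RK_def using E.base_subset_integral_closure[OF X.A subfieldE(3)[OF K'(1)]] \<phi>A that by auto
    moreover have "d (c r) = r" if "r \<in> A" for r using dc that subringE(1)[OF A(1)] by auto
    moreover have "\<phi> ` p = c ` p" by (rule image_cong) (use pA A(2) \<phi>K in auto)
    moreover have "r \<in> P \<longleftrightarrow> r \<in> p" if "r \<in> A" for r using P(2) that by blast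
    ultimately show ?thesis unfolding \<phi>A q_def using pA by auto
  qed
  interpret X: embedded_extension_prime E R M J d K' L' "\<phi> ` A" q P
    by (intro embedded_extension_prime.intro embedded_extension_prime_axioms.intro emb q)
      (use P(1) XT in \<open>auto simp: q_def\<close>)
  have "tamely_ramified E K' L' (integral_closure E (\<phi> ` integral_closure R A L) L') q"
    using utame[unfolded universally_tamely_ramified_def Let_def, rule_format, of E \<phi> K' q]
      E.field_axioms \<phi> K' q qA unfolding XRK L'_def by blast
  then have "tamely_ramified E K' L' X.RL q"
    unfolding integral_closure_image_trans[OF E.field_axioms L_subfield \<phi> A(1) AL subfieldE(3)[OF comp(1)]]
      X.RL_def .
  moreover have "X.P.inertia = J"
    unfolding X.P.inertia_def using J(2) unfolding inertia_def XT by blast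
  ultimately have i: "[card X.C] \<cdot> \<one> \<notin> P" by (rule X.tame_inertial_imp_index_invertible)
  have "h (g a) = g a" if h: "h \<in> X.H" for h
  proof -
    have "\<phi> a \<in> L'" using gen a_L by auto
    then have "h (d (\<phi> a)) = d (\<phi> a)" using h unfolding X.H_def by blast
    moreover have "d (\<phi> a) = g a" using dc[OF M_in_R[OF act_closed[OF g a_M]]] by (simp add: \<phi>_def)
    ultimately show ?thesis by simp
  qed
  moreover have "X.H \<subseteq> J" by (auto simp: X.H_def)
  ultimately show ?thesis using i X.H_aut_group X.card_C by blast
qed

text \<open>Among the groups of inertial automorphisms whose order lies in \<open>P\<close>, a smallest one fixes all
  conjugates of \<open>a\<close>, since otherwise the stabilizer of a conjugate would contain a smaller such group.
  The conjugates generate \<open>M\<close>, so the group is trivial.\<close>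

theorem universally_tame_imp_tame:
  fixes c :: "'a \<Rightarrow> 'e"
  assumes c: "inj c" and p: "primeideal p (R\<lparr>carrier := A\<rparr>)"
    and utame: "universally_tamely_ramified TYPE('e) R K L A (integral_closure R A L) p"
  shows "tamely_ramified R K M T p"
proof -
  obtain P where P: "prime_in T P" "P \<inter> A = p" using exists_prime_over[OF p] by auto
  interpret P: subring_prime R T P
    by (intro subring_prime.intro subring_prime_axioms.intro domain_axioms T_subring P(1))
  have "[card (inertia P)] \<cdot> \<one> \<notin> P"
  proof
    let ?Q = "\<lambda>J. aut_group R M J \<and> J \<subseteq> inertia P \<and> [card J] \<cdot> \<one> \<in> P"
    assume "[card (inertia P)] \<cdot> \<one> \<in> P"
    then have "?Q (inertia P)" using inertia_aut_group[OF p P] by simp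
    then obtain J where J: "?Q J" "\<And>H. ?Q H \<Longrightarrow> card J \<le> card H"
      using ex_has_least_nat[of ?Q "inertia P" card] by auto
    interpret J: aut_group R M J using J(1) by simp
    have fix_conj: "h (g a) = g a" if g: "g \<in> G" and h: "h \<in> J" for g h
    proof -
      obtain i :: nat and H where i: "[i] \<cdot> \<one> \<notin> P" "aut_group R M H" "H \<subseteq> J"
        "\<And>h. h \<in> H \<Longrightarrow> h (g a) = g a" "card J = i * card H"
        using universally_tame_imp_index_invertible[OF c p utame P _ _ g, of J] J(1) by auto
      have nat: "[(n::nat)] \<cdot> \<one> \<in> T" for n by (induct n) (use P.TE(2,3,7) in auto)
      have "([i] \<cdot> \<one>) \<otimes> ([card H] \<cdot> \<one>) = [card J] \<cdot> \<one>"
        unfolding i(5) by (simp add: add_pow_ldistr add_pow_rdistr add.nat_pow_pow mult.commute)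
      then have "[card H] \<cdot> \<one> \<in> P" using P.P_prime[OF nat[of i] nat[of "card H"]] J(1) i(1) by auto
      then have "card J \<le> card H" using J(2)[of H] i(2,3) J(1) by auto
      then have "H = J" using card_subset_eq[OF J.fin i(3) antisym[OF card_mono[OF J.fin i(3)]]] by blast
      then show ?thesis using i(4) h by simp
    qed
    have "M \<subseteq> {x \<in> M. \<forall>h \<in> J. h x = x}"
    proof (rule M_least)
      show "subring {x \<in> M. \<forall>h \<in> J. h x = x} R"
        by (rule subfieldE(1)[OF J.fixed_subfield])
      show "K \<subseteq> {x \<in> M. \<forall>h \<in> J. h x = x}" using K_M G_K J(1) by (auto simp: inertia_def)
      show "zeros (Irr K a) \<subseteq> {x \<in> M. \<forall>h \<in> J. h x = x}"
        using normal[OF a_M] fix_conj zeros_M by blast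
    qed
    then have triv: "h x = x" if "h \<in> J" "x \<in> M" for h x using that by blast
    have "h = (\<lambda>x \<in> M. x)" if h: "h \<in> J" for h
      by (rule J.G_ext[OF h J.one]) (use triv[OF h] in simp)
    then have "J = {\<lambda>x \<in> M. x}" using J.one by blast
    then have "[card J] \<cdot> \<one> = \<one>" by simp
    then show False using J(1) P.P_one by simp
  qed
  then show ?thesis using inertia_invertible_imp_tame[OF p P] by simp
qed

end

theorem theorem3p39:
  fixes F :: "('a, 'b) ring_scheme"
    and K L M R S T \<pp> :: "'a set"
  assumes "separable_closure_of F K"
    and "subring R F"
    and "noetherian_domain (F\<lparr>carrier := R\<rparr>)"
    and "K = fractions_of F R"
    and "integral_closure F R K = R"
    and "finite_separable_extension F K L"
    and "S = integral_closure F R L"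
    and "primeideal \<pp> (F\<lparr>carrier := R\<rparr>)"
    and "M = galois_closure F K L"
    and "T = integral_closure F R M"
  shows "universally_tamely_ramified TYPE('a + 'e) F K L R S \<pp> \<longleftrightarrow> tamely_ramified F K M T \<pp>"
proof -
  interpret separable_closure F K using separable_closure_ofD[OF assms(1)] .
  obtain a zs where a: "a \<in> L" "L = simple_extension K a" "set zs = zeros (Irr K a)"
    "galois_closure F K L = finite_extension K zs"
    by (rule galois_closure_eq_conjugate_field[OF assms(1,6)])
  have "subfield L F" using assms(6) by (simp add: finite_separable_extension_def)
  then have "a \<in> carrier F" using a(1) subfieldE(3) by blast
  moreover have "R \<subseteq> K" using assms(5) by (auto simp: integral_closure_def)
  ultimately interpret conjugate_field F K a L M R
    by (intro conjugate_field.intro conjugate_field_axioms.intro separable_closure_axioms a(2) assms(2,5)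
        exI[of _ zs] conjI a(3) a(4)[folded assms(9)])
  have T: "tamely_ramified F K M (integral_closure F R M) \<pp> \<longleftrightarrow> tamely_ramified F K M T \<pp>"
    by (simp only: assms(10))
  show ?thesis
  proof
    assume "universally_tamely_ramified TYPE('a + 'e) F K L R S \<pp>"
    then show "tamely_ramified F K M T \<pp>"
      using universally_tame_imp_tame[OF inj_Inl assms(8)] unfolding assms(7) T_def T by blast
  next
    assume "tamely_ramified F K M T \<pp>"
    then show "universally_tamely_ramified TYPE('a + 'e) F K L R S \<pp>"
      using tame_imp_universally_tame[OF assms(8)] unfolding assms(7) T_def T by blast
  qed
qed

end
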